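(* Let $D$ be a Jordan domain in $\mathbb C$ with rectifiable boundary, let $E\subseteq\partial D$ be measurable with respect to the natural parameter on $\partial D$, and let $u:D\to\mathbb R$ be a harmonic function that has angular limits on $E$ (that is, at every point of $E$ at which $\partial D$ has a tangent). Let $v:D\to\mathbb R$ be any conjugate harmonic function of $u$ in $D$. Then $v$ has a finite angular limit at almost every point of $E$ with respect to the natural parameter, and both boundary functions (the angular limits of $u$ and of $v$, defined almost everywhere on $E$) are measurable on $E$ with respect to the natural parameter.
   Context: A Jordan domain is the bounded component of the complement in $\mathbb C$ of a Jordan curve. The natural parameter on the rectifiable Jordan curve $\partial D$ is its arc length parameter; "measurable" and "almost every" with respect to the natural parameter refer to arc length measure on $\partial D$. A closed rectifiable Jordan curve has a tangent at almost every point with respect to the natural parameter. A conjugate harmonic function of $u$ in $D$ is a harmonic function $v:D\to\mathbb R$ such that $u+iv$ is analytic in $D$; it is unique up to an additive real constant. At a point $\zeta\in\partial D$ where $\partial D$ has a tangent, let $n_\zeta$ be the unit inner normal to $\partial D$; the angles in $D$ with vertex at $\zeta$ are the sectors $\{z:\ |\arg((z-\zeta)/n_\zeta)|<\alpha,\ 0<|z-\zeta|<r\}$ contained in $D$, with $0<\alpha<\pi/2$ and $r>0$. A path in $D$ terminating at $\zeta$ is nontangential at $\zeta$ if its part in some neighborhood of $\zeta$ lies inside such an angle. A function has the angular limit $L$ at $\zeta$ if it tends to $L$ along all nontangential paths at $\zeta$, i.e. it tends to $L$ as $z\to\zeta$ within every such angle. Angular limits are a priori allowed to be infinite ($L\in[-\infty,+\infty]$)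 unless they are said to be finite. *)

theory Defs
  imports "HOL-Analysis.Analysis"
begin

section \<open>Rectifiable Jordan curves and arc length\<close>

definition jordan_curve :: "(real \<Rightarrow> complex) \<Rightarrow> bool" where
  "jordan_curve \<gamma> \<longleftrightarrow> simple_path \<gamma> \<and> pathfinish \<gamma> = pathstart \<gamma>"

definition jordan_domain :: "(real \<Rightarrow> complex) \<Rightarrow> complex set \<Rightarrow> bool" where
  "jordan_domain \<gamma> D \<longleftrightarrow>
     jordan_curve \<gamma> \<and> D \<in> components (- path_image \<gamma>) \<and> bounded D"

text \<open>Lengths of the polygons inscribed in \<open>\<gamma>\<close> restricted to \<open>{a..b}\<close>.\<close>

definition polygonal_lengths :: "(real \<Rightarrow> complex) \<Rightarrow> real \<Rightarrow> real \<Rightarrow> real set" where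
  "polygonal_lengths \<gamma> a b =
     {(\<Sum>i<n. dist (\<gamma> (t i)) (\<gamma> (t (Suc i)))) | (n :: nat) (t :: nat \<Rightarrow> real).
        mono_on {..n} t \<and> t ` {..n} \<subseteq> {a..b}}"

definition rectifiable :: "(real \<Rightarrow> complex) \<Rightarrow> bool" where
  "rectifiable \<gamma> \<longleftrightarrow> path \<gamma> \<and> bdd_above (polygonal_lengths \<gamma> 0 1)"

definition arc_length :: "(real \<Rightarrow> complex) \<Rightarrow> real \<Rightarrow> real" where
  "arc_length \<gamma> t = Sup (polygonal_lengths \<gamma> 0 t)"

text \<open>The natural parametrization. For a rectifiable Jordan curve, \<open>arc_length \<gamma>\<close> is a
  strictly increasing continuous bijection from \<open>{0..1}\<close> onto \<open>{0..arc_length \<gamma> 1}\<close>.\<close>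

definition natural_param :: "(real \<Rightarrow> complex) \<Rightarrow> real \<Rightarrow> complex" where
  "natural_param \<gamma> s = \<gamma> (inv_into {0..1} (arc_length \<gamma>) s)"

text \<open>Arc length measure on the curve: Lebesgue measure of the natural parameter. It is
  complete, the measurable sets being exactly those whose set of natural parameters is
  Lebesgue measurable.\<close>

definition arc_length_measure :: "(real \<Rightarrow> complex) \<Rightarrow> complex measure" where
  "arc_length_measure \<gamma> =
     distr (lebesgue_on {0..arc_length \<gamma> 1})
       (sigma (path_image \<gamma>)
          {A. A \<subseteq> path_image \<gamma> \<and>
              natural_param \<gamma> -` A \<inter> {0..arc_length \<gamma> 1} \<in> sets lebesgue})
       (natural_param \<gamma>)"

section \<open>Tangents, inner normals and angular limits\<close>

text \<open>The curve passes through \<open>\<zeta>\<close> with tangent direction \<open>\<tau>\<close>: chord directions converge to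
  \<open>\<tau>\<close> forwards and to \<open>-\<tau>\<close> backwards (so cusps are excluded). Composing with \<open>frac\<close> extends
  the closed curve periodically, which treats the base point like any other point.\<close>

definition tangent_direction :: "(real \<Rightarrow> complex) \<Rightarrow> complex \<Rightarrow> complex \<Rightarrow> bool" where
  "tangent_direction \<gamma> \<zeta> \<tau> \<longleftrightarrow>
     (\<exists>t\<in>{0..<1}. \<gamma> t = \<zeta> \<and>
        ((\<lambda>s. sgn (\<gamma> (frac s) - \<zeta>)) \<longlongrightarrow> \<tau>) (at_right t) \<and>
        ((\<lambda>s. sgn (\<gamma> (frac s) - \<zeta>)) \<longlongrightarrow> - \<tau>) (at_left t))"

definition has_tangent :: "(real \<Rightarrow> complex) \<Rightarrow> complex \<Rightarrow> bool" where
  "has_tangent \<gamma> \<zeta> \<longleftrightarrow> (\<exists>\<tau>. tangent_direction \<gamma> \<zeta> \<tau>)"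

definition inner_normal ::
    "complex set \<Rightarrow> (real \<Rightarrow> complex) \<Rightarrow> complex \<Rightarrow> complex \<Rightarrow> bool" where
  "inner_normal D \<gamma> \<zeta> n \<longleftrightarrow>
     (\<exists>\<tau>. tangent_direction \<gamma> \<zeta> \<tau> \<and> (n = \<i> * \<tau> \<or> n = - \<i> * \<tau>)) \<and>
     (\<forall>\<^sub>F h in at_right (0 :: real). \<zeta> + of_real h * n \<in> D)"

definition sector :: "complex \<Rightarrow> complex \<Rightarrow> real \<Rightarrow> real \<Rightarrow> complex set" where
  "sector \<zeta> n \<alpha> r =
     {z. \<bar>Arg ((z - \<zeta>) / n)\<bar> < \<alpha> \<and> 0 < cmod (z - \<zeta>) \<and> cmod (z - \<zeta>) < r}"

definition has_angular_limit ::
    "complex set \<Rightarrow> (real \<Rightarrow> complex) \<Rightarrow> (complex \<Rightarrow> real) \<Rightarrow> complex \<Rightarrow> ereal \<Rightarrow> bool" where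
  "has_angular_limit D \<gamma> f \<zeta> L \<longleftrightarrow>
     (\<exists>n. inner_normal D \<gamma> \<zeta> n \<and>
        (\<forall>\<alpha> r. 0 < \<alpha> \<and> \<alpha> < pi / 2 \<and> 0 < r \<and> sector \<zeta> n \<alpha> r \<subseteq> D \<longrightarrow>
           ((\<lambda>z. ereal (f z)) \<longlongrightarrow> L) (at \<zeta> within sector \<zeta> n \<alpha> r)))"

text \<open>The boundary function; its value is unspecified where there is no angular limit.\<close>

definition angular_limit ::
    "complex set \<Rightarrow> (real \<Rightarrow> complex) \<Rightarrow> (complex \<Rightarrow> real) \<Rightarrow> complex \<Rightarrow> ereal" where
  "angular_limit D \<gamma> f \<zeta> = (THE L. has_angular_limit D \<gamma> f \<zeta> L)"

section \<open>Harmonic functions\<close>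

text \<open>Twice continuously differentiable with vanishing Laplacian; \<open>F'\<close> and \<open>F''\<close> are the
  first and second Frechet derivatives.\<close>

definition harmonic_on :: "(complex \<Rightarrow> real) \<Rightarrow> complex set \<Rightarrow> bool" where
  "harmonic_on f S \<longleftrightarrow>
     (\<exists>(F' :: complex \<Rightarrow> complex \<Rightarrow>\<^sub>L real) (F'' :: complex \<Rightarrow> complex \<Rightarrow>\<^sub>L (complex \<Rightarrow>\<^sub>L real)).
        (\<forall>z\<in>S. (f has_derivative blinfun_apply (F' z)) (at z)) \<and>
        (\<forall>z\<in>S. (F' has_derivative blinfun_apply (F'' z)) (at z)) \<and>
        continuous_on S F'' \<and>
        (\<forall>z\<in>S. blinfun_apply (blinfun_apply (F'' z) 1) 1
              + blinfun_apply (blinfun_apply (F'' z) \<i>) \<i> = 0))"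

definition conjugate_harmonic_on ::
    "(complex \<Rightarrow> real) \<Rightarrow> (complex \<Rightarrow> real) \<Rightarrow> complex set \<Rightarrow> bool" where
  "conjugate_harmonic_on u v S \<longleftrightarrow>
     harmonic_on v S \<and> (\<lambda>z. Complex (u z) (v z)) analytic_on S"

end

theory Submission
  imports Defs "HOL-Complex_Analysis.Complex_Analysis"
begin

text \<open>
  The proof works in the given domain itself and needs no conformal map. Put \<open>f = u + \<i>v\<close>. If \<open>u\<close>
  has an angular limit at a point, that limit is different from \<open>-\<infinity>\<close> or from \<open>+\<infinity>\<close>, so the real part
  of \<open>f\<close> or of \<open>- f\<close> is bounded below in a wide sector at that point. This one-sided bound is all
  that is taken from the hypothesis on \<open>u\<close>; it forces finite angular limits of \<open>f\<close> almost everywhere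
  (\<open>one_sided_bound_imp_limit_ae\<close>). In particular infinite limits of \<open>u\<close> occur only on a null set.

  Countably many choices of a frame and of a bound capture all such points. The points belonging to
  one choice lie on the graph of a function with small Lipschitz constant, the lower envelope of
  their sectors; above the graph the function stays in the domain and, after adding a constant, has
  real part at least one (\<open>sawtooth_limits\<close>). So the question is moved to a Lipschitz domain, where
  two facts combine. First, a bounded holomorphic function (here \<open>1 / f\<close>) has nontangential limits
  at almost every boundary point: its primitive is Lipschitz up to the boundary, hence differentiable
  almost everywhere along the boundary; a maximum principle with a square root as barrier carries
  the first order expansion into the domain, and Cauchy's inequality differentiates it
  (\<open>boundary_derivative_imp_limit\<close>). Second, that limit is almost nowhere zero: the real part of
  a primitive of \<open>sqrt f\<close> increases along every curve of small slope and so has bounded variation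
  along the raised graphs, and Fatou's lemma excludes that \<open>f\<close> becomes infinite on a set of
  positive measure (\<open>not_infinite_ae\<close>).

  Rectifiability enters through the natural parameter. It has a derivative of modulus one almost
  everywhere (\<open>unit_speed_ae\<close>), so the curve has a tangent there; and a set of parameters is null as
  soon as a real function with nonzero derivative maps it to a null set
  (\<open>negligible_by_nonzero_derivative\<close>), which brings the exceptional sets in the Lipschitz domains
  back to the curve. The former rests on the almost everywhere differentiability
  of Lipschitz functions (\<open>Lipschitz_differentiable_ae\<close>).

  For measurability, the boundary function is recovered almost everywhere from limits along the two
  normals of the natural parametrization, whose derivative is a measurable function of the parameter
  (\<open>angular_limit_measurable\<close>). That only one of them points into the domain is a consequence of the
  Jordan curve theorem (\<open>inner_normal_unique\<close>).
\<close>

section \<open>Lipschitz functions of a real variable\<close>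

text \<open>The points inside arbitrarily short intervals of mean slope greater than \<open>q\<close>, when \<open>n\<close> runs
  through all natural numbers; \<open>flat\<close> below is the counterpart for mean slope less than \<open>p\<close>. The point
  is strictly inside the interval, which makes both sets open.\<close>
definition steep :: "(real \<Rightarrow> real) \<Rightarrow> real \<Rightarrow> real set \<Rightarrow> nat \<Rightarrow> real set" where
  "steep f q W n = {x. \<exists>c d. c < x \<and> x < d \<and> {c..d} \<subseteq> W \<and> d - c < 1 / (Suc n) \<and> q * (d - c) < f d - f c}"

definition flat :: "(real \<Rightarrow> real) \<Rightarrow> real \<Rightarrow> real set \<Rightarrow> nat \<Rightarrow> real set" where
  "flat f p W n = {x. \<exists>c d. c < x \<and> x < d \<and> {c..d} \<subseteq> W \<and> d - c < 1 / (Suc n) \<and> f d - f c < p * (d - c)}"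

lemma open_steep: "open (steep f q W n)"
proof (subst open_subopen, intro ballI)
  fix x assume "x \<in> steep f q W n"
  then obtain c d where cd: "c < x" "x < d" "{c..d} \<subseteq> W" "d - c < 1 / (Suc n)" "q * (d - c) < f d - f c"
    unfolding steep_def by blast
  have "{c<..<d} \<subseteq> steep f q W n" using cd unfolding steep_def by (intro subsetI) auto
  then show "\<exists>T. open T \<and> x \<in> T \<and> T \<subseteq> steep f q W n"
    using cd by (intro exI[of _ "{c<..<d}"]) auto
qed

lemma open_flat: "open (flat f q W n)"
proof (subst open_subopen, intro ballI)
  fix x assume "x \<in> flat f q W n"
  then obtain c d where cd: "c < x" "x < d" "{c..d} \<subseteq> W" "d - c < 1 / (Suc n)" "f d - f c < q * (d - c)"
    unfolding flat_def by blast
  have "{c<..<d} \<subseteq> flat f q W n" using cd unfolding flat_def by (intro subsetI) auto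
  then show "\<exists>T. open T \<and> x \<in> T \<and> T \<subseteq> flat f q W n"
    using cd by (intro exI[of _ "{c<..<d}"]) auto
qed

text \<open>The intervals may be taken inside any given neighbourhood; this is what makes nested Vitali
  coverings possible.\<close>
lemma steep_in_open:
  assumes "open W" "x \<in> W" "\<And>n. x \<in> steep f q UNIV n"
  shows "x \<in> steep f q W n"
proof -
  obtain e where e: "e > 0" "ball x e \<subseteq> W" using assms by (meson open_contains_ball)
  obtain m where m: "1 / (Suc m) < e" using e(1) nat_approx_posE by blast
  obtain c d where cd: "c < x" "x < d" "d - c < 1 / (Suc (max m n))" "q * (d - c) < f d - f c"
    using assms(3)[of "max m n"] by (auto simp: steep_def)
  have "1 / real (Suc (max m n)) \<le> 1 / (Suc m)" "1 / real (Suc (max m n)) \<le> 1 / (Suc n)"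
    by (auto intro!: divide_left_mono)
  with cd m have "d - c < e" "d - c < 1 / (Suc n)" by linarith+
  then have "{c..d} \<subseteq> ball x e" using cd by (auto simp: dist_real_def)
  then show ?thesis using e cd \<open>d - c < 1 / (Suc n)\<close> unfolding steep_def by blast
qed

lemma flat_eq_steep_uminus: "flat f q W n = steep (\<lambda>t. - f t) (- q) W n"
proof -
  have "f d - f c < q * (d - c) \<longleftrightarrow> - q * (d - c) < - f d - (- f c)" for c d by auto
  then show ?thesis unfolding steep_def flat_def by presburger
qed

lemma flat_in_open:
  assumes "open W" "x \<in> W" "\<And>n. x \<in> flat f q UNIV n"
  shows "x \<in> flat f q W n"
  using assms unfolding flat_eq_steep_uminus by (rule steep_in_open)

text \<open>The Vitali covering theorem in terms of endpoints instead of centres and radii.\<close>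
lemma Vitali_intervals:
  fixes B :: "real set" and P :: "real \<Rightarrow> real \<Rightarrow> bool"
  assumes "\<And>x n. x \<in> B \<Longrightarrow> \<exists>c d. c < x \<and> x < d \<and> d - c < 1 / (Suc n) \<and> P c d"
  obtains C where "countable C" "\<And>c d. (c,d) \<in> C \<Longrightarrow> c < d \<and> P c d"
    "disjoint_family_on (\<lambda>(c,d). {c..d}) C" "negligible (B - (\<Union>(c,d)\<in>C. {c..d}))"
proof -
  define K where "K = {(c,d). c < d \<and> P c d}"
  define a r where "a = (\<lambda>(c,d). (c + d) / 2 :: real)" and "r = (\<lambda>(c,d). (d - c) / 2 :: real)"
  have cb: "cball (a i) (r i) = (case i of (c,d) \<Rightarrow> {c..d})" for i
    by (auto simp: a_def r_def cball_eq_atLeastAtMost field_simps split: prod.splits)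
  have 1: "0 < r i" if "i \<in> K" for i using that by (auto simp: K_def r_def)
  have 2: "\<exists>i. i \<in> K \<and> x \<in> cball (a i) (r i) \<and> r i < d" if x: "x \<in> B" and d: "0 < d" for x d
  proof -
    obtain n where n: "1 / (Suc n) < d" using d nat_approx_posE by blast
    obtain c e where "c < x" "x < e" "e - c < 1 / (Suc n)" "P c e" using assms[OF x, of n] by blast
    then show ?thesis using n by (intro exI[of _ "(c,e)"]) (auto simp: K_def cb, auto simp: r_def)
  qed
  from Vitali_covering_theorem_cballs[of K r B a, OF 1 2] obtain C where
    C: "countable C" "C \<subseteq> K"
     "pairwise (\<lambda>i j. disjnt (cball (a i) (r i)) (cball (a j) (r j))) C"
     "negligible(B - (\<Union>i \<in> C. cball (a i) (r i)))" by blast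
  show thesis
  proof (rule that[OF C(1)])
    show "c < d \<and> P c d" if "(c,d) \<in> C" for c d using that C(2) by (auto simp: K_def)
    show "disjoint_family_on (\<lambda>(c, d). {c..d}) C"
      using C(3) unfolding cb pairwise_def disjoint_family_on_def disjnt_def by blast
    show "negligible (B - (\<Union>(c,d)\<in>C. {c..d}))" using C(4) unfolding cb by simp
  qed
qed

lemma emeasure_le_if_diff_null:
  assumes "B \<in> sets borel" "J \<in> sets borel" "B - J \<in> null_sets lborel"
  shows "emeasure lborel B \<le> emeasure lborel J"
proof -
  have "emeasure lborel B \<le> emeasure lborel (J \<union> (B - J))"
    using assms by (intro emeasure_mono) auto
  then show ?thesis using assms by (simp add: emeasure_Un_null_set del: Un_Diff_cancel)
qed

text \<open>Let \<open>\<mu>\<close> be the Stieltjes measure of \<open>f\<close>. Cover the set \<open>B\<close> first by disjoint intervals \<open>I\<close> of slope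
  less than \<open>p\<close> inside an open set that is hardly larger than \<open>B\<close>, then by disjoint intervals \<open>J\<close> of slope greater than \<open>q\<close> inside
  the intervals \<open>I\<close>. Then \<open>q |B| \<le> \<mu>(\<Union>J) \<le> \<mu>(\<Union>I) \<le> p (|B| + e)\<close>, and \<open>p < q\<close> leaves only \<open>|B| = 0\<close>.\<close>
lemma steep_and_flat_null:
  fixes f :: "real \<Rightarrow> real"
  assumes mono: "mono f" and cont: "continuous_on UNIV f" and pq: "0 \<le> p" "p < q"
  shows "emeasure lborel {x \<in> {a<..<b}. \<forall>n. x \<in> steep f q UNIV n \<and> x \<in> flat f p UNIV n} = 0"
proof -
  define B where "B = {x \<in> {a<..<b}. \<forall>n. x \<in> steep f q UNIV n \<and> x \<in> flat f p UNIV n}"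
  have "B = {a<..<b} \<inter> (\<Inter>n. steep f q UNIV n \<inter> flat f p UNIV n)" by (auto simp: B_def)
  also have "\<dots> \<in> sets borel"
    by (intro sets.Int sets.countable_INT'' borel_open open_steep open_flat) auto
  finally have Bm: "B \<in> sets borel" .
  have BD: "x \<in> steep f q UNIV n" "x \<in> flat f p UNIV n" if "x \<in> B" for x n using that by (auto simp: B_def)
  have Bfin: "emeasure lborel B < \<infinity>"
  proof -
    have "emeasure lborel B \<le> emeasure lborel {a..b}"
      by (intro emeasure_mono) (auto simp: B_def)
    also have "\<dots> < \<infinity>" by (simp add: emeasure_lborel_Icc_eq)
    finally show ?thesis .
  qed
  let ?\<mu> = "interval_measure f"
  have mu: "emeasure ?\<mu> {c..d} = ennreal (f d - f c)" if "c \<le> d" for c d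
    using that by (intro emeasure_interval_measure_Icc) (auto intro: monoD[OF mono] cont)
  have meas: "emeasure M (\<Union>(c,d)\<in>C. {c..d}) = (\<integral>\<^sup>+i. emeasure M (case i of (c,d) \<Rightarrow> {c..d}) \<partial>count_space C)"
    if "sets M = sets borel" "countable C" "disjoint_family_on (\<lambda>(c,d). {c..d}) C" for M and C :: "(real \<times> real) set"
    using that by (intro emeasure_UN_countable) (auto split: prod.splits)
  have step: "ennreal q * emeasure lborel B \<le> ennreal p * (emeasure lborel B + ennreal e)" if e: "e > 0" for e
  proof -
    obtain U where U: "open U" "B \<subseteq> U" "emeasure lborel (U - B) < e"
      by (rule outer_regular_lborel[OF Bm e])
    have 1: "\<exists>c d. c < x \<and> x < d \<and> d - c < 1 / (Suc n) \<and> ({c..d} \<subseteq> U \<and> f d - f c < p * (d - c))"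
      if "x \<in> B" for x n
    proof -
      have "x \<in> flat f p U n" using that U BD by (rule_tac flat_in_open) blast+
      then show ?thesis unfolding flat_def by blast
    qed
    obtain C where C: "countable C" "\<And>c d. (c,d) \<in> C \<Longrightarrow> c < d \<and> {c..d} \<subseteq> U \<and> f d - f c < p * (d - c)"
      "disjoint_family_on (\<lambda>(c,d). {c..d}) C" "negligible (B - (\<Union>(c,d)\<in>C. {c..d}))"
      by (rule Vitali_intervals[where P="\<lambda>c d. {c..d} \<subseteq> U \<and> f d - f c < p * (d - c)", OF 1]) blast+
    define V where "V = (\<Union>(c,d)\<in>C. {c<..<d})"
    have V: "open V" by (auto simp: V_def)
    have "negligible ((\<Union>(c,d)\<in>C. {c,d}))"
      using C(1) countable_imp_null_set_lborel[of "\<Union>(c,d)\<in>C. {c,d}"]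
      by (auto simp: negligible_iff_null_sets null_sets_completionI split: prod.splits)
    moreover have "B - V \<subseteq> (B - (\<Union>(c,d)\<in>C. {c..d})) \<union> (\<Union>(c,d)\<in>C. {c,d})"
      by (fastforce simp: V_def)
    ultimately have BV: "negligible (B - V)" using C(4) negligible_Un negligible_subset by blast
    have 2: "\<exists>c d. c < x \<and> x < d \<and> d - c < 1 / (Suc n) \<and> ({c..d} \<subseteq> V \<and> q * (d - c) < f d - f c)"
      if "x \<in> B \<inter> V" for x n
    proof -
      have "x \<in> steep f q V n" using that V BD by (rule_tac steep_in_open) blast+
      then show ?thesis unfolding steep_def by blast
    qed
    obtain C' where C': "countable C'" "\<And>c d. (c, d) \<in> C' \<Longrightarrow> c < d \<and> {c..d} \<subseteq> V \<and> q * (d - c) < f d - f c"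
      "disjoint_family_on (\<lambda>(c,d). {c..d}) C'" "negligible (B \<inter> V - (\<Union>(c,d)\<in>C'. {c..d}))"
      by (rule Vitali_intervals[where P="\<lambda>c d. {c..d} \<subseteq> V \<and> q * (d - c) < f d - f c", OF 2]) blast+
    let ?I = "\<Union>(c,d)\<in>C. {c..d}" and ?J = "\<Union>(c,d)\<in>C'. {c..d}"
    have Im: "?I \<in> sets borel" and Jm: "?J \<in> sets borel"
      using C(1) C'(1) by (auto intro!: sets.countable_UN'' split: prod.splits)
    have "negligible (B - ?J)"
      by (rule negligible_subset[OF negligible_Un[OF BV C'(4)]]) auto
    then have BJ0: "B - ?J \<in> null_sets lborel"
      using sets.Diff[OF Bm Jm] by (simp add: negligible_iff_null_sets null_sets_completion_iff)
    have "emeasure lborel B \<le> emeasure lborel ?J"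
      by (rule emeasure_le_if_diff_null[OF Bm Jm BJ0])
    then have "ennreal q * emeasure lborel B \<le> ennreal q * emeasure lborel ?J"
      by (rule mult_left_mono) simp
    also have "\<dots> = (\<integral>\<^sup>+i. ennreal q * emeasure lborel (case i of (c,d) \<Rightarrow> {c..d}) \<partial>count_space C')"
      unfolding meas[OF sets_lborel C'(1) C'(3)] by (rule nn_integral_cmult[symmetric]) simp
    also have "\<dots> \<le> (\<integral>\<^sup>+i. emeasure ?\<mu> (case i of (c,d) \<Rightarrow> {c..d}) \<partial>count_space C')"
    proof (intro nn_integral_mono)
      fix i assume "i \<in> space (count_space C')"
      then obtain c d where i: "i = (c,d)" "(c,d) \<in> C'" by (cases i) auto
      have "c < d" "q * (d - c) < f d - f c" using C'(2)[OF i(2)] by auto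
      then show "ennreal q * emeasure lborel (case i of (c, d) \<Rightarrow> {c..d}) \<le> emeasure ?\<mu> (case i of (c, d) \<Rightarrow> {c..d})"
        using pq by (simp add: i mu ennreal_mult[symmetric] ennreal_leI)
    qed
    also have "\<dots> = emeasure ?\<mu> ?J" by (rule meas[OF _ C'(1) C'(3), symmetric]) simp
    also have "\<dots> \<le> emeasure ?\<mu> ?I"
    proof (intro emeasure_mono)
      have "V \<subseteq> ?I" unfolding V_def by (rule UN_mono) auto
      moreover have "?J \<subseteq> V" using C'(2) by (intro UN_least) (clarify, blast)
      ultimately show "?J \<subseteq> ?I" by blast
    qed (simp add: Im)
    also have "\<dots> = (\<integral>\<^sup>+i. emeasure ?\<mu> (case i of (c,d) \<Rightarrow> {c..d}) \<partial>count_space C)"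
      by (rule meas[OF _ C(1) C(3)]) simp
    also have "\<dots> \<le> (\<integral>\<^sup>+i. ennreal p * emeasure lborel (case i of (c,d) \<Rightarrow> {c..d}) \<partial>count_space C)"
    proof (intro nn_integral_mono)
      fix i assume "i \<in> space (count_space C)"
      then obtain c d where i: "i = (c,d)" "(c,d) \<in> C" by (cases i) auto
      have "c < d" "f d - f c < p * (d - c)" using C(2)[OF i(2)] by auto
      then show "emeasure ?\<mu> (case i of (c, d) \<Rightarrow> {c..d}) \<le> ennreal p * emeasure lborel (case i of (c, d) \<Rightarrow> {c..d})"
        using pq by (simp add: i mu ennreal_mult[symmetric] ennreal_leI)
    qed
    also have "\<dots> = ennreal p * emeasure lborel ?I"
      unfolding meas[OF sets_lborel C(1) C(3)] by (rule nn_integral_cmult) simp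
    also have "\<dots> \<le> ennreal p * emeasure lborel U"
    proof (intro mult_left_mono emeasure_mono)
      show "?I \<subseteq> U" using C(2) by (intro UN_least) (clarify, blast)
    qed (simp_all add: U(1))
    also have "emeasure lborel U \<le> emeasure lborel B + emeasure lborel (U - B)"
    proof -
      have "emeasure lborel U = emeasure lborel (B \<union> (U - B))" using U(2) by (simp add: Un_absorb1)
      also have "\<dots> \<le> emeasure lborel B + emeasure lborel (U - B)"
        using sets.Diff[OF borel_open[OF U(1)] Bm] by (intro emeasure_subadditive) (simp_all add: Bm)
      finally show ?thesis .
    qed
    also have "\<dots> \<le> emeasure lborel B + ennreal e" using U(3) by (intro add_left_mono) auto
    finally show ?thesis by (simp add: mult_left_mono)
  qed
  define \<beta> where "\<beta> = measure lborel B"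
  have \<beta>: "emeasure lborel B = ennreal \<beta>" "\<beta> \<ge> 0" using Bfin by (auto simp: \<beta>_def emeasure_eq_ennreal_measure)
  have "q * \<beta> \<le> p * \<beta> + p * e" if "e > 0" for e
    using step[OF that] \<beta>(2) that pq unfolding \<beta>(1)
    by (simp add: ennreal_mult[symmetric] ennreal_plus[symmetric] algebra_simps del: ennreal_plus)
  note le = this
  have "q * \<beta> \<le> p * \<beta> + e" if *: "e > 0" for e
  proof (cases "p = 0")
    case False
    then show ?thesis using le[of "e / p"] * pq by simp
  qed (use le[of e] * in simp)
  then have "q * \<beta> \<le> p * \<beta>" by (rule field_le_epsilon)
  then have "(q - p) * \<beta> \<le> 0" by (simp add: algebra_simps)
  then have "\<beta> = 0" using pq \<beta>(2) by (simp add: mult_le_0_iff)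
  then show ?thesis using \<beta> by (simp add: B_def)
qed

text \<open>Off the countable union of the null sets of the preceding lemma, over rational slopes, the upper and
  the lower limit of the mean slopes coincide. Intervals that start or end at the point are limits of
  intervals around it.\<close>
lemma monotone_Lipschitz_differentiable_ae:
  fixes f :: "real \<Rightarrow> real"
  assumes mono: "mono f" and K: "K-lipschitz_on UNIV f"
  shows "negligible {x. \<not> (\<exists>D. (f has_real_derivative D) (at x))}"
proof -
  have cont: "continuous_on UNIV f" using K by (rule lipschitz_on_continuous_on)
  let ?B = "\<lambda>p q a b. {x \<in> {a<..<b}. \<forall>n. x \<in> steep f q UNIV n \<and> x \<in> flat f p UNIV n}"
  define I :: "(real \<times> real \<times> real) set" where "I = {(p,q,m). p \<in> \<rat> \<and> q \<in> \<rat> \<and> 0 \<le> p \<and> p < q \<and> m \<in> (\<nat> :: real set)}"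
  define Z where "Z = (\<Union>(p,q,m)\<in>I. ?B p q (- m) m)"
  have "countable I"
  proof (rule countable_subset)
    show "I \<subseteq> \<rat> \<times> \<rat> \<times> \<nat>" by (auto simp: I_def)
    show "countable (\<rat> \<times> \<rat> \<times> (\<nat>::real set) :: (real \<times> real \<times> real) set)"
      by (intro countable_SIGMA countable_rat) (auto simp: Nats_def)
  qed
  moreover have "negligible (?B p q (-m) m)" if "(p,q,m) \<in> I" for p q m
  proof -
    have "?B p q (-m) m = {-m<..<m} \<inter> (\<Inter>n. steep f q UNIV n \<inter> flat f p UNIV n)" by auto
    also have "\<dots> \<in> sets borel"
      by (intro sets.Int sets.countable_INT'' borel_open open_steep open_flat) auto
    finally have "?B p q (-m) m \<in> sets borel" .
    moreover have "emeasure lborel (?B p q (-m) m) = 0"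
      using that by (intro steep_and_flat_null mono cont) (auto simp: I_def)
    ultimately show ?thesis
      by (simp add: negligible_iff_null_sets null_sets_completion_iff null_setsI)
  qed
  ultimately have Z: "negligible Z"
    unfolding Z_def by (intro negligible_countable_Union countable_image) auto
  have "\<exists>D. (f has_real_derivative D) (at x)" if x: "x \<notin> Z" for x
  proof -
    have K0: "K \<ge> 0" using K lipschitz_on_nonneg by blast
    define Q where "Q = {q. 0 \<le> q \<and> (\<exists>n. x \<notin> steep f q UNIV n)}"
    have KQ: "K \<in> Q"
    proof -
      have "x \<notin> steep f K UNIV 0"
      proof
        assume "x \<in> steep f K UNIV 0"
        then obtain c d where "c < x" "x < d" "K * (d - c) < f d - f c" unfolding steep_def by blast
        then show False using lipschitz_onD[OF K, of d c] by (auto simp: dist_real_def)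
      qed
      then show ?thesis using K0 by (auto simp: Q_def)
    qed
    have bQ: "bdd_below Q" by (rule bdd_belowI[of _ 0]) (auto simp: Q_def)
    define D where "D = Inf Q"
    have D0: "0 \<le> D" unfolding D_def by (rule cInf_greatest) (use KQ in \<open>auto simp: Q_def\<close>)
    have up: "\<exists>n. \<forall>c d. c < x \<and> x < d \<and> d - c < 1 / (Suc n) \<longrightarrow> f d - f c \<le> (D + e) * (d - c)" if e: "e > 0" for e
    proof -
      obtain q where q: "q \<in> Q" "q < D + e"
        using cInf_lessD[of Q "D + e"] KQ e by (auto simp: D_def)
      then obtain n where n: "x \<notin> steep f q UNIV n" by (auto simp: Q_def)
      show ?thesis
      proof (intro exI[of _ n] allI impI)
        fix c d assume cd: "c < x \<and> x < d \<and> d - c < 1 / (Suc n)"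
        then have "f d - f c \<le> q * (d - c)" using n by (force simp: steep_def)
        also have "\<dots> \<le> (D + e) * (d - c)" using q cd by (intro mult_right_mono) auto
        finally show "f d - f c \<le> (D + e) * (d - c)" .
      qed
    qed
    have lo: "\<exists>n. \<forall>c d. c < x \<and> x < d \<and> d - c < 1 / (Suc n) \<longrightarrow> (D - e) * (d - c) \<le> f d - f c" if e: "e > 0" for e
    proof (cases "D - e < 0")
      case True
      have "(D - e) * (d - c) \<le> f d - f c" if "c < x \<and> x < d" for c d
        using that True monoD[OF mono, of c d] mult_nonpos_nonneg[of "D - e" "d - c"] by linarith
      then show ?thesis by blast
    next
      case False
      obtain p where p: "p \<in> \<rat>" "D - e < p" "p < D" using Rats_dense_in_real[of "D - e" D] e by auto
      obtain q where q: "q \<in> \<rat>" "p < q" "q < D" using Rats_dense_in_real[of p D] p by auto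
      have qs: "x \<in> steep f q UNIV n" for n
      proof (rule ccontr)
        assume "x \<notin> steep f q UNIV n"
        then have "q \<in> Q" using p q False by (auto simp: Q_def)
        then have "D \<le> q" unfolding D_def by (intro cInf_lower bQ)
        then show False using q by simp
      qed
      obtain m where m: "\<bar>x\<bar> < real m" using reals_Archimedean2 by blast
      have "(p,q,real m) \<in> I" using p q False by (auto simp: I_def)
      then have "x \<notin> ?B p q (- real m) m" using x unfolding Z_def by blast
      then obtain n where n: "x \<notin> flat f p UNIV n" using qs m by auto
      show ?thesis
      proof (intro exI[of _ n] allI impI)
        fix c d assume cd: "c < x \<and> x < d \<and> d - c < 1 / (Suc n)"
        then have "f d - f c \<ge> p * (d - c)" using n by (force simp: flat_def)
        moreover have "p * (d - c) \<ge> (D - e) * (d - c)" using p cd by (intro mult_right_mono) auto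
        ultimately show "(D - e) * (d - c) \<le> f d - f c" by simp
      qed
    qed
    have both: "\<exists>r>0. \<forall>y. y \<noteq> x \<and> \<bar>y - x\<bar> < r \<longrightarrow> \<bar>(f y - f x) / (y - x) - D\<bar> \<le> e" if e: "e > 0" for e
    proof -
      obtain n1 where n1: "\<And>c d. c < x \<and> x < d \<and> d - c < 1 / (Suc n1) \<Longrightarrow> f d - f c \<le> (D + e) * (d - c)" using up[OF e] by blast
      obtain n2 where n2: "\<And>c d. c < x \<and> x < d \<and> d - c < 1 / (Suc n2) \<Longrightarrow> (D - e) * (d - c) \<le> f d - f c" using lo[OF e] by blast
      define r where "r = min (1 / (Suc n1)) (1 / (Suc n2))"
      have r: "r > 0" by (simp add: r_def)
      have cf: "isCont f t" for t using cont by (simp add: continuous_on_eq_continuous_at)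
      have est: "(D - e) * (d - c) \<le> f d - f c \<and> f d - f c \<le> (D + e) * (d - c)"
        if "c < x" "x < d" "d - c < r" for c d using that n1[of c d] n2[of c d] by (auto simp: r_def)
      have R: "(D - e) * (d - x) \<le> f d - f x \<and> f d - f x \<le> (D + e) * (d - x)" if d: "x < d" "d - x < r" for d
      proof -
        have ev: "\<forall>\<^sub>F c in at_left x. c < x \<and> d - c < r"
          using d by (auto simp: eventually_at_left_field intro!: exI[of _ "d - r"])
        have t: "(f \<longlongrightarrow> f x) (at_left x)" using cf[of x] by (simp add: isCont_def filterlim_at_split)
        have "((\<lambda>c. f d - f c - (D - e) * (d - c)) \<longlongrightarrow> f d - f x - (D - e) * (d - x)) (at_left x)"
          "((\<lambda>c. (D + e) * (d - c) - (f d - f c)) \<longlongrightarrow> (D + e) * (d - x) - (f d - f x)) (at_left x)"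
          by (intro tendsto_intros t)+
        moreover have "\<forall>\<^sub>F c in at_left x. 0 \<le> f d - f c - (D - e) * (d - c)"
          "\<forall>\<^sub>F c in at_left x. 0 \<le> (D + e) * (d - c) - (f d - f c)"
          using ev by (eventually_elim, use est d(1) in force)+
        ultimately have "0 \<le> f d - f x - (D - e) * (d - x)" "0 \<le> (D + e) * (d - x) - (f d - f x)"
          by (auto intro: tendsto_lowerbound simp del: diff_ge_0_iff_ge)
        then show ?thesis by linarith
      qed
      have L: "(D - e) * (x - c) \<le> f x - f c \<and> f x - f c \<le> (D + e) * (x - c)" if d: "c < x" "x - c < r" for c
      proof -
        have ev: "\<forall>\<^sub>F d in at_right x. x < d \<and> d - c < r"
          using d by (auto simp: eventually_at_right_field intro!: exI[of _ "c + r"])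
        have t: "(f \<longlongrightarrow> f x) (at_right x)" using cf[of x] by (simp add: isCont_def filterlim_at_split)
        have "((\<lambda>d. f d - f c - (D - e) * (d - c)) \<longlongrightarrow> f x - f c - (D - e) * (x - c)) (at_right x)"
          "((\<lambda>d. (D + e) * (d - c) - (f d - f c)) \<longlongrightarrow> (D + e) * (x - c) - (f x - f c)) (at_right x)"
          by (intro tendsto_intros t)+
        moreover have "\<forall>\<^sub>F d in at_right x. 0 \<le> f d - f c - (D - e) * (d - c)"
          "\<forall>\<^sub>F d in at_right x. 0 \<le> (D + e) * (d - c) - (f d - f c)"
          using ev by (eventually_elim, use est d(1) in force)+
        ultimately have "0 \<le> f x - f c - (D - e) * (x - c)" "0 \<le> (D + e) * (x - c) - (f x - f c)"
          by (auto intro: tendsto_lowerbound simp del: diff_ge_0_iff_ge)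
        then show ?thesis by linarith
      qed
      show ?thesis
      proof (intro exI[of _ r] conjI r allI impI)
        fix y assume y: "y \<noteq> x \<and> \<bar>y - x\<bar> < r"
        show "\<bar>(f y - f x) / (y - x) - D\<bar> \<le> e"
        proof (cases "x < y")
          case True
          then have "(D - e) * (y - x) \<le> f y - f x \<and> f y - f x \<le> (D + e) * (y - x)" using R[of y] y by auto
          then have "D - e \<le> (f y - f x) / (y - x)" "(f y - f x) / (y - x) \<le> D + e" using True by (auto simp: pos_le_divide_eq pos_divide_le_eq)
          then show ?thesis by linarith
        next
          case False
          then have xy: "y < x" using y by auto
          then have "(D - e) * (x - y) \<le> f x - f y \<and> f x - f y \<le> (D + e) * (x - y)" using L[of y] y by auto
          then have "D - e \<le> (f x - f y) / (x - y)" "(f x - f y) / (x - y) \<le> D + e" using xy by (auto simp: pos_le_divide_eq pos_divide_le_eq)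
          moreover have "(f x - f y) / (x - y) = (f y - f x) / (y - x)" by (metis minus_diff_eq minus_divide_divide)
          ultimately show ?thesis by simp
        qed
      qed
    qed
    have "((\<lambda>y. (f y - f x) / (y - x)) \<longlongrightarrow> D) (at x)"
    proof (rule LIM_I)
      fix e :: real assume e: "e > 0"
      then obtain r where "r > 0" "\<And>y. y \<noteq> x \<and> \<bar>y - x\<bar> < r \<Longrightarrow> \<bar>(f y - f x) / (y - x) - D\<bar> \<le> e / 2"
        using both[of "e / 2"] by auto
      then show "\<exists>s>0. \<forall>y. y \<noteq> x \<and> norm (y - x) < s \<longrightarrow> norm ((f y - f x) / (y - x) - D) < e"
        using e by (intro exI[of _ r]) fastforce
    qed
    then show ?thesis by (auto simp: has_field_derivative_iff)
  qed
  then have "{x. \<not> (\<exists>D. (f has_real_derivative D) (at x))} \<subseteq> Z" by blast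
  then show ?thesis using Z negligible_subset by blast
qed

text \<open>Adding a steep linear function makes a Lipschitz function monotone.\<close>
lemma Lipschitz_differentiable_ae:
  fixes f :: "real \<Rightarrow> real"
  assumes K: "K-lipschitz_on UNIV f"
  shows "negligible {x. \<not> (\<exists>D. (f has_real_derivative D) (at x))}"
proof -
  let ?h = "\<lambda>x. f x + K * x"
  have K0: "K \<ge> 0" using K lipschitz_on_nonneg by blast
  have "mono ?h"
  proof (rule monoI)
    fix x y :: real assume "x \<le> y"
    then show "?h x \<le> ?h y" using lipschitz_onD[OF K, of x y] by (auto simp: dist_real_def algebra_simps abs_if split: if_splits)
  qed
  moreover have "(K + K)-lipschitz_on UNIV ?h"
    using K0 by (intro lipschitz_on_add K) (auto intro!: lipschitz_onI simp: dist_real_def abs_mult right_diff_distrib[symmetric])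
  ultimately have "negligible {x. \<not> (\<exists>D. (?h has_real_derivative D) (at x))}"
    by (rule monotone_Lipschitz_differentiable_ae)
  moreover have "\<exists>D. (f has_real_derivative D) (at x)" if h: "(?h has_real_derivative D) (at x)" for x D
  proof -
    from h have "((\<lambda>x. ?h x - K * x) has_real_derivative D - K * 1) (at x)"
      by (intro derivative_intros) auto
    then have "(f has_real_derivative D - K) (at x)" by simp
    then show ?thesis ..
  qed
  then have "{x. \<not> (\<exists>D. (f has_real_derivative D) (at x))} \<subseteq> {x. \<not> (\<exists>D. (?h has_real_derivative D) (at x))}"
    by blast
  ultimately show ?thesis by (rule negligible_subset)
qed

theorem Lipschitz_complex_differentiable_ae:
  fixes f :: "real \<Rightarrow> complex"
  assumes K: "K-lipschitz_on UNIV f"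
  shows "negligible {x. \<not> (\<exists>D. (f has_vector_derivative D) (at x))}"
proof -
  have "\<bar>Re (f x) - Re (f y)\<bar> \<le> K * \<bar>x - y\<bar>" "\<bar>Im (f x) - Im (f y)\<bar> \<le> K * \<bar>x - y\<bar>" for x y
    using lipschitz_onD[OF K, of x y] abs_Re_le_cmod[of "f x - f y"] abs_Im_le_cmod[of "f x - f y"]
    by (auto simp: dist_norm dist_real_def)
  then have "K-lipschitz_on UNIV (\<lambda>x. Re (f x))" "K-lipschitz_on UNIV (\<lambda>x. Im (f x))"
    using lipschitz_on_nonneg[OF K] by (auto intro!: lipschitz_onI simp: dist_real_def)
  from this[THEN Lipschitz_differentiable_ae]
  have "negligible ({x. \<not> (\<exists>D. ((\<lambda>x. Re (f x)) has_real_derivative D) (at x))} \<union>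
    {x. \<not> (\<exists>D. ((\<lambda>x. Im (f x)) has_real_derivative D) (at x))})"
    by (rule negligible_Un)
  moreover have "\<exists>D. (f has_vector_derivative D) (at x)"
    if "((\<lambda>x. Re (f x)) has_real_derivative a) (at x)" "((\<lambda>x. Im (f x)) has_real_derivative b) (at x)" for x a b
  proof -
    have "((\<lambda>x. of_real (Re (f x)) + \<i> * of_real (Im (f x))) has_vector_derivative (of_real a + \<i> * of_real b)) (at x)"
      using that by (intro has_vector_derivative_add has_vector_derivative_of_real has_vector_derivative_mult_right)
        (simp_all add: has_real_derivative_iff_has_vector_derivative)
    then show ?thesis by (auto simp: complex_eq[symmetric])
  qed
  then have "{x. \<not> (\<exists>D. (f has_vector_derivative D) (at x))} \<subseteq>
    {x. \<not> (\<exists>D. ((\<lambda>x. Re (f x)) has_real_derivative D) (at x))} \<union>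
    {x. \<not> (\<exists>D. ((\<lambda>x. Im (f x)) has_real_derivative D) (at x))}"
    by blast
  ultimately show ?thesis by (rule negligible_subset)
qed

lemma AE_lborel_if_negligible:
  assumes "negligible {x. \<not> P x}"
  shows "AE x in lborel. P x"
proof -
  have "AE x in completion lborel. P x"
    using assms unfolding negligible_iff_null_sets by (rule AE_I') simp
  then show ?thesis unfolding AE_completion_iff .
qed

lemma has_vector_derivative_quotient:
  fixes g :: "real \<Rightarrow> 'a::real_normed_vector"
  assumes "(g has_vector_derivative v) (at x)"
  shows "((\<lambda>y. (1 / (y - x)) *\<^sub>R (g y - g x)) \<longlongrightarrow> v) (at x)"
proof -
  have "((\<lambda>y. norm ((1 / norm (y - x)) *\<^sub>R (g y - (g x + (y - x) *\<^sub>R v)))) \<longlongrightarrow> 0) (at x)"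
    using assms unfolding has_vector_derivative_def has_derivative_within by (intro tendsto_norm_zero) simp
  moreover have "\<forall>\<^sub>F y in at x. norm ((1 / norm (y - x)) *\<^sub>R (g y - (g x + (y - x) *\<^sub>R v))) = norm ((1 / (y - x)) *\<^sub>R (g y - g x) - v)"
    unfolding eventually_at_filter
  proof (intro always_eventually allI impI)
    fix y assume "y \<noteq> x"
    then have "(1 / (y - x)) *\<^sub>R (g y - g x) - v = (1 / (y - x)) *\<^sub>R (g y - (g x + (y - x) *\<^sub>R v))"
      by (simp add: scaleR_diff_right scaleR_add_right)
    then show "norm ((1 / norm (y - x)) *\<^sub>R (g y - (g x + (y - x) *\<^sub>R v))) = norm ((1 / (y - x)) *\<^sub>R (g y - g x) - v)"
      by simp
  qed
  ultimately have "((\<lambda>y. norm ((1 / (y - x)) *\<^sub>R (g y - g x) - v)) \<longlongrightarrow> 0) (at x)"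
    by (rule Lim_transform_eventually)
  then show "((\<lambda>y. (1 / (y - x)) *\<^sub>R (g y - g x)) \<longlongrightarrow> v) (at x)"
    by (rule Lim_null[THEN iffD2, OF tendsto_norm_zero_cancel])
qed

lemma has_vector_derivative_quotient_sequence:
  fixes g :: "real \<Rightarrow> 'a::real_normed_vector"
  assumes "(g has_vector_derivative v) (at x)"
  shows "(\<lambda>n. real (Suc n) *\<^sub>R (g (x + 1 / real (Suc n)) - g x)) \<longlonglongrightarrow> v"
proof -
  from LIM_offset_zero[OF has_vector_derivative_quotient[OF assms]]
  have h: "((\<lambda>h. (1/h) *\<^sub>R (g (x + h) - g x)) \<longlongrightarrow> v) (at 0)"
    by simp
  have "filterlim (\<lambda>n. 1 / real (Suc n)) (at 0) sequentially"
    unfolding filterlim_at using LIMSEQ_Suc[OF lim_1_over_n] by auto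
  from filterlim_compose[OF h this] show ?thesis by simp
qed

text \<open>The fundamental theorem of calculus for Lipschitz functions. The difference quotients are bounded by
  the Lipschitz constant and converge almost everywhere, so dominated convergence applies; their
  integrals are difference quotients of an antiderivative of \<open>g\<close>. The derivative is given as a Borel
  function that agrees with the derivative wherever that exists.\<close>
theorem Lipschitz_increment_eq_integral:
  fixes g :: "real \<Rightarrow> complex"
  assumes K: "K-lipschitz_on UNIV g"
  obtains D where "D \<in> borel_measurable borel"
    "\<And>x v. (g has_vector_derivative v) (at x) \<Longrightarrow> D x = v"
    "AE x in lborel. norm (D x) \<le> K"
    "\<And>s t. s \<le> t \<Longrightarrow> set_integrable lborel {s..t} D"
    "\<And>s t. s \<le> t \<Longrightarrow> (LINT x:{s..t}|lborel. D x) = g t - g s"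
proof -
  define q where "q = (\<lambda>n x. real (Suc n) *\<^sub>R (g (x + 1 / real (Suc n)) - g x))"
  define D where "D = (\<lambda>x. lim (\<lambda>n. q n x))"
  have cont: "continuous_on UNIV g" using K by (rule lipschitz_on_continuous_on)
  have contq: "continuous_on A (q n)" for n A
    unfolding q_def by (intro continuous_intros continuous_on_compose2[OF cont]) auto
  have qm: "q n \<in> borel_measurable borel" for n using contq by (rule borel_measurable_continuous_onI)
  have Dm: "D \<in> borel_measurable borel" unfolding D_def by (intro borel_measurable_lim_metric qm)
  have K0: "K \<ge> 0" using K lipschitz_on_nonneg by blast
  have qK: "norm (q n x) \<le> K" for n x
    using lipschitz_onD[OF K, of "x + 1 / real (Suc n)" x] by (simp add: q_def dist_norm pos_le_divide_eq mult.commute)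
  have qlim: "(\<lambda>n. q n x) \<longlonglongrightarrow> v" if "(g has_vector_derivative v) (at x)" for x v
    using has_vector_derivative_quotient_sequence[OF that] by (simp add: q_def)
  have Dv: "D x = v" if "(g has_vector_derivative v) (at x)" for x v
    using qlim[OF that] by (simp add: D_def limI)
  have AEd: "AE x in lborel. \<exists>v. (g has_vector_derivative v) (at x)"
    by (rule AE_lborel_if_negligible) (rule Lipschitz_complex_differentiable_ae[OF K])
  then have AEl: "AE x in lborel. (\<lambda>n. q n x) \<longlonglongrightarrow> D x"
    by eventually_elim (use qlim Dv in auto)
  then have AEK: "AE x in lborel. norm (D x) \<le> K"
    by eventually_elim (rule tendsto_upperbound[OF tendsto_norm], assumption, simp_all add: qK)
  have eq: "set_integrable lborel {s..t} D \<and> (LINT x:{s..t}|lborel. D x) = g t - g s" if st: "s \<le> t" for s t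
  proof -
    let ?F = "\<lambda>n x. indicator {s..t} x *\<^sub>R q n x" and ?G = "\<lambda>x. indicator {s..t} x *\<^sub>R D x"
    have w: "integrable lborel (\<lambda>x. indicator {s..t} x * K :: real)"
      by (intro integrable_mult_left) (simp add: emeasure_lborel_Icc_eq integrable_indicator_iff)
    have AE1: "AE x in lborel. (\<lambda>n. ?F n x) \<longlonglongrightarrow> ?G x"
      using AEl by eventually_elim (intro tendsto_intros)
    have AE2: "AE x in lborel. norm (?F n x) \<le> indicator {s..t} x * K" for n
      using qK K0 by (intro AE_I2) (auto simp: indicator_def)
    have F: "?F n \<in> borel_measurable lborel" and G: "?G \<in> borel_measurable lborel" for n
      by (intro borel_measurable_scaleR borel_measurable_indicator, simp_all add: qm Dm)+
    note dc = integrable_dominated_convergence[OF G F w AE1 AE2] integrable_dominated_convergence2[OF G F w AE1 AE2] integral_dominated_convergence[OF G F w AE1 AE2]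
    have I: "set_integrable lborel {s..t} D" using dc(1) by (simp add: set_integrable_def)
    have lim: "(\<lambda>n. LINT x:{s..t}|lborel. q n x) \<longlonglongrightarrow> (LINT x:{s..t}|lborel. D x)"
      using dc(3) by (simp add: set_lebesgue_integral_def)
    obtain G where G: "\<And>x. x \<in> {s-1..t+2} \<Longrightarrow> (G has_vector_derivative g x) (at x within {s-1..t+2})"
      using antiderivative_continuous[OF continuous_on_subset[OF cont], of "s-1" "t+2"] by blast
    have G': "(G has_vector_derivative g x) (at x)" if "x \<in> {s-1<..<t+2}" for x
      using G[of x] that at_within_Icc_at[of "s-1" x "t+2"] by auto
    have val: "(LINT x:{s..t}|lborel. q n x) = real (Suc n) *\<^sub>R (G (t + 1 / real (Suc n)) - G t) - real (Suc n) *\<^sub>R (G (s + 1 / real (Suc n)) - G s)" for n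
    proof -
      have "set_integrable lborel {s..t} (q n)" using dc(2)[of n] by (simp add: set_integrable_def)
      then have "(LINT x:{s..t}|lborel. q n x) = integral {s..t} (q n)" by (rule set_borel_integral_eq_integral)
      also have "(q n has_integral (real (Suc n) *\<^sub>R (G (t + 1 / real (Suc n)) - G t) - real (Suc n) *\<^sub>R (G (s + 1 / real (Suc n)) - G s))) {s..t}"
      proof (rule fundamental_theorem_of_calculus[OF st])
        fix x assume x: "x \<in> {s..t}"
        have h: "0 < 1 / real (Suc n)" "1 / real (Suc n) \<le> 1" by auto
        have "((\<lambda>x. G (x + 1 / real (Suc n))) has_vector_derivative 1 *\<^sub>R g (x + 1 / real (Suc n))) (at x)"
        proof -
          have a: "((\<lambda>x. x + 1 / real (Suc n)) has_vector_derivative 1) (at x)" by (auto intro!: derivative_eq_intros)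
          have b: "(G has_vector_derivative g (x + 1 / real (Suc n))) (at (x + 1 / real (Suc n)))"
          proof (rule G')
            show "x + 1 / real (Suc n) \<in> {s-1<..<t+2}"
              using x h unfolding greaterThanLessThan_iff atLeastAtMost_iff by linarith
          qed
          show ?thesis using vector_diff_chain_at[OF a b] by (simp add: o_def)
        qed
        then have "((\<lambda>x. real (Suc n) *\<^sub>R (G (x + 1 / real (Suc n)) - G x)) has_vector_derivative q n x) (at x)"
          unfolding q_def using G'[of x] x by (intro derivative_eq_intros) auto
        then show "((\<lambda>x. real (Suc n) *\<^sub>R (G (x + 1 / real (Suc n)) - G x)) has_vector_derivative q n x) (at x within {s..t})"
          by (rule has_vector_derivative_at_within)
      qed
      then have "integral {s..t} (q n) = real (Suc n) *\<^sub>R (G (t + 1 / real (Suc n)) - G t) - real (Suc n) *\<^sub>R (G (s + 1 / real (Suc n)) - G s)"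
        by (rule integral_unique)
      finally show ?thesis .
    qed
    have GL: "(\<lambda>n. real (Suc n) *\<^sub>R (G (x + 1 / real (Suc n)) - G x)) \<longlonglongrightarrow> g x" if "x \<in> {s..t}" for x
      using that by (intro has_vector_derivative_quotient_sequence G') auto
    have "(\<lambda>n. LINT x:{s..t}|lborel. q n x) \<longlonglongrightarrow> g t - g s"
      unfolding val using st by (intro tendsto_diff GL) auto
    with lim I show ?thesis using LIMSEQ_unique by blast
  qed
  show thesis by (rule that[OF Dm Dv AEK]) (use eq in auto)
qed

text \<open>Where the derivative is nonzero the function is locally expanding, up to a constant. So the set splits
  into countably many pieces on which the inverse of \<open>p\<close> is Lipschitz, and a Lipschitz image of a null set is null.\<close>
lemma negligible_by_nonzero_derivative:
  fixes p :: "real \<Rightarrow> real"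
  assumes der: "\<And>s. s \<in> S \<Longrightarrow> \<exists>d. d \<noteq> 0 \<and> (p has_real_derivative d) (at s)" and N: "negligible (p ` S)"
  shows "negligible S"
proof -
  define T where "T = (\<lambda>n. {s \<in> S. \<forall>t. \<bar>t - s\<bar> < 1 / real (Suc n) \<longrightarrow> \<bar>t - s\<bar> / real (Suc n) \<le> \<bar>p t - p s\<bar>})"
  define T' where "T' = (\<lambda>(n,q). T n \<inter> ball q (1 / (2 * real (Suc n))))"
  have "negligible (T' (n,q))" for n q
  proof -
    have lb: "\<bar>t - s\<bar> \<le> real (Suc n) * \<bar>p t - p s\<bar>" if "t \<in> T' (n,q)" "s \<in> T' (n,q)" for s t
    proof -
      have "\<bar>t - s\<bar> < 1 / real (Suc n)" 
      proof -
        define h where "h = 1 / (2 * real (Suc n))"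
        have "\<bar>q - t\<bar> < h" "\<bar>q - s\<bar> < h" using that by (auto simp: T'_def dist_real_def h_def)
        then have "\<bar>t - s\<bar> < h + h" by linarith
        also have "h + h = 1 / real (Suc n)" by (simp add: h_def field_simps)
        finally show ?thesis .
      qed
      then have "\<bar>t - s\<bar> / real (Suc n) \<le> \<bar>p t - p s\<bar>" using that by (auto simp: T'_def T_def)
      then show ?thesis by (simp add: field_simps)
    qed
    have inj: "inj_on p (T' (n,q))"
    proof (rule inj_onI)
      fix s t assume "s \<in> T' (n,q)" "t \<in> T' (n,q)" "p s = p t"
      then show "s = t" using lb[of t s] by simp
    qed
    have sub: "T' (n,q) \<subseteq> S" by (auto simp: T'_def T_def)
    have "negligible (inv_into (T' (n,q)) p ` (p ` T' (n,q)))"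
    proof (rule negligible_locally_Lipschitz_image)
      show "negligible (p ` T' (n,q))" by (rule negligible_subset[OF N image_mono[OF sub]])
      show "\<exists>U B. open U \<and> x \<in> U \<and> (\<forall>y\<in>p ` T' (n, q) \<inter> U. norm (inv_into (T' (n, q)) p y - inv_into (T' (n, q)) p x) \<le> B * norm (y - x))"
        if "x \<in> p ` T' (n,q)" for x
        using that lb by (intro exI[of _ UNIV] exI[of _ "real (Suc n)"]) (auto simp: inv_into_f_f[OF inj])
    qed simp
    then show ?thesis using inv_into_image_cancel[OF inj subset_refl] by simp
  qed
  then have "negligible (\<Union>i\<in>UNIV \<times> \<rat>. T' i)"
    by (intro negligible_countable_Union countable_image countable_SIGMA countable_rat) auto
  moreover have "S \<subseteq> (\<Union>i\<in>UNIV \<times> \<rat>. T' i)"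
  proof
    fix s assume s: "s \<in> S"
    then obtain d where d: "d \<noteq> 0" "(p has_real_derivative d) (at s)" using der by blast
    then have "((\<lambda>t. (p t - p s) / (t - s)) \<longlongrightarrow> d) (at s)" by (simp add: has_field_derivative_iff)
    from LIM_D[OF this, of "\<bar>d\<bar> / 2"] d(1)
    obtain r where r: "r > 0" "\<And>t. t \<noteq> s \<and> norm (t - s) < r \<Longrightarrow> norm ((p t - p s) / (t - s) - d) < \<bar>d\<bar> / 2"
      by auto
    obtain n where n: "1 / real (Suc n) < min r (\<bar>d\<bar> / 2)" using r(1) d(1) nat_approx_posE[of "min r (\<bar>d\<bar> / 2)"] by auto
    have "s \<in> T n"
    proof -
      have "\<bar>t - s\<bar> / real (Suc n) \<le> \<bar>p t - p s\<bar>" if t: "\<bar>t - s\<bar> < 1 / real (Suc n)" for t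
      proof (cases "t = s")
        case False
        then have "\<bar>(p t - p s) / (t - s) - d\<bar> < \<bar>d\<bar> / 2" using r(2)[of t] t n by auto
        then have "\<bar>(p t - p s) / (t - s)\<bar> > \<bar>d\<bar> / 2" by linarith
        then have "1 / real (Suc n) \<le> \<bar>(p t - p s) / (t - s)\<bar>" using n by linarith
        then show ?thesis using False by (simp add: abs_divide pos_le_divide_eq mult.commute)
      qed simp
      then show ?thesis using s by (simp add: T_def)
    qed
    moreover obtain q where "q \<in> \<rat>" "s < q" "q < s + 1 / (2 * real (Suc n))"
      using Rats_dense_in_real[of s "s + 1 / (2 * real (Suc n))"] by auto
    ultimately show "s \<in> (\<Union>i\<in>UNIV \<times> \<rat>. T' i)" by (force simp: T'_def dist_real_def)
  qed
  ultimately show ?thesis by (rule negligible_subset)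
qed

section \<open>Arc length\<close>

lemma polygonal_lengthsI:
  assumes "mono_on {..n} t" "\<And>i. i \<le> n \<Longrightarrow> a \<le> t i \<and> t i \<le> b"
  shows "(\<Sum>i<n. dist (\<gamma> (t i)) (\<gamma> (t (Suc i)))) \<in> polygonal_lengths \<gamma> a b"
proof -
  have "t ` {..n} \<subseteq> {a..b}" using assms(2) by auto
  then show ?thesis using assms(1) unfolding polygonal_lengths_def by blast
qed

lemma polygonal_lengthsE:
  assumes "x \<in> polygonal_lengths \<gamma> a b"
  obtains n t where "mono_on {..n} t" "\<And>i. i \<le> n \<Longrightarrow> a \<le> t i \<and> t i \<le> b"
    "x = (\<Sum>i<n. dist (\<gamma> (t i)) (\<gamma> (t (Suc i))))"
proof -
  from assms obtain n t where nt: "mono_on {..n} t" "t ` {..n} \<subseteq> {a..b}"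
    "x = (\<Sum>i<n. dist (\<gamma> (t i)) (\<gamma> (t (Suc i))))"
    unfolding polygonal_lengths_def by blast
  show thesis
  proof (rule that[OF nt(1) _ nt(3)])
    show "a \<le> t i \<and> t i \<le> b" if "i \<le> n" for i
      using that nt(2) by (metis atLeastAtMost_iff atMost_iff image_subset_iff)
  qed
qed

lemma sum_lessThan_add: "(\<Sum>i<m + n. f i) = (\<Sum>i<m. f i) + (\<Sum>i<n. f (m + i))" for f :: "nat \<Rightarrow> real"
  by (induction n) (simp_all add: add.assoc)

lemma polygonal_lengths_concat:
  assumes "x \<in> polygonal_lengths \<gamma> a c" "y \<in> polygonal_lengths \<gamma> c b"
  obtains z where "z \<in> polygonal_lengths \<gamma> a b" "x + y \<le> z"
proof -
  obtain m s where s: "mono_on {..m} s" "\<And>i. i \<le> m \<Longrightarrow> a \<le> s i \<and> s i \<le> c"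
    "x = (\<Sum>i<m. dist (\<gamma> (s i)) (\<gamma> (s (Suc i))))" using assms(1) by (rule polygonal_lengthsE) (rule that)
  obtain n t where t: "mono_on {..n} t" "\<And>i. i \<le> n \<Longrightarrow> c \<le> t i \<and> t i \<le> b"
    "y = (\<Sum>i<n. dist (\<gamma> (t i)) (\<gamma> (t (Suc i))))" using assms(2) by (rule polygonal_lengthsE) (rule that)
  define r where "r = (\<lambda>i. if i \<le> m then s i else t (i - Suc m))"
  let ?z = "\<Sum>i<Suc m + n. dist (\<gamma> (r i)) (\<gamma> (r (Suc i)))"
  have cb: "a \<le> c" "c \<le> b" using s(2)[of 0] t(2)[of 0] by auto
  have "?z \<in> polygonal_lengths \<gamma> a b"
  proof (rule polygonal_lengthsI)
    show "mono_on {..Suc m + n} r"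
    proof (rule mono_onI)
      fix i j assume ij: "i \<in> {..Suc m + n}" "j \<in> {..Suc m + n}" "i \<le> j"
      consider "j \<le> m" | "i \<le> m" "m < j" | "m < i" using ij(3) by linarith
      then show "r i \<le> r j"
      proof cases
        case 1
        then show ?thesis using ij mono_onD[OF s(1), of i j] by (simp add: r_def)
      next
        case 2
        then have "s i \<le> c" "c \<le> t (j - Suc m)" using s(2)[of i] t(2)[of "j - Suc m"] ij by auto
        then show ?thesis using 2 by (simp add: r_def)
      next
        case 3
        then show ?thesis using ij mono_onD[OF t(1), of "i - Suc m" "j - Suc m"] by (simp add: r_def diff_le_mono)
      qed
    qed
    show "a \<le> r i \<and> r i \<le> b" if i: "i \<le> Suc m + n" for i
    proof (cases "i \<le> m")
      case True
      then show ?thesis using s(2)[of i] cb by (simp add: r_def)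
    next
      case False
      then have "c \<le> t (i - Suc m) \<and> t (i - Suc m) \<le> b" using t(2)[of "i - Suc m"] i by simp
      then show ?thesis using False cb by (simp add: r_def)
    qed
  qed
  moreover have "x + y \<le> ?z"
    unfolding sum_lessThan_add s(3) t(3)
  proof (rule add_mono)
    show "(\<Sum>i<m. dist (\<gamma> (s i)) (\<gamma> (s (Suc i)))) \<le> (\<Sum>i<Suc m. dist (\<gamma> (r i)) (\<gamma> (r (Suc i))))"
    proof -
      have "(\<Sum>i<m. dist (\<gamma> (s i)) (\<gamma> (s (Suc i)))) = (\<Sum>i<m. dist (\<gamma> (r i)) (\<gamma> (r (Suc i))))"
        by (rule sum.cong) (simp_all add: r_def)
      then show ?thesis by simp
    qed
    show "(\<Sum>i<n. dist (\<gamma> (t i)) (\<gamma> (t (Suc i)))) \<le> (\<Sum>i<n. dist (\<gamma> (r (Suc m + i))) (\<gamma> (r (Suc (Suc m + i)))))"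
      by (simp add: r_def)
  qed
  ultimately show thesis by (rule that)
qed

text \<open>Truncating the vertices of a polygon at \<open>c\<close> gives polygons for the two parts of the interval. This
  replaces any bookkeeping about the vertices next to \<open>c\<close>, both for the additivity of length and for its
  continuity.\<close>
lemma min_in_polygonal_lengths:
  assumes "mono_on {..n} t" "\<And>i. i \<le> n \<Longrightarrow> a \<le> t i" "a \<le> c"
  shows "(\<Sum>i<n. dist (\<gamma> (min (t i) c)) (\<gamma> (min (t (Suc i)) c))) \<in> polygonal_lengths \<gamma> a c"
proof (rule polygonal_lengthsI[where t="\<lambda>i. min (t i) c"])
  show "mono_on {..n} (\<lambda>i. min (t i) c)"
    by (rule mono_onI) (intro min.mono mono_onD[OF assms(1)], simp_all)
qed (use assms in simp)

lemma max_in_polygonal_lengths: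
  assumes "mono_on {..n} t" "\<And>i. i \<le> n \<Longrightarrow> t i \<le> b" "c \<le> b"
  shows "(\<Sum>i<n. dist (\<gamma> (max (t i) c)) (\<gamma> (max (t (Suc i)) c))) \<in> polygonal_lengths \<gamma> c b"
proof (rule polygonal_lengthsI[where t="\<lambda>i. max (t i) c"])
  show "mono_on {..n} (\<lambda>i. max (t i) c)"
    by (rule mono_onI) (intro max.mono mono_onD[OF assms(1)], simp_all)
qed (use assms in simp)

lemma polygonal_lengths_split:
  assumes "z \<in> polygonal_lengths \<gamma> a b" "a \<le> c" "c \<le> b"
  obtains x y where "x \<in> polygonal_lengths \<gamma> a c" "y \<in> polygonal_lengths \<gamma> c b" "z \<le> x + y"
proof -
  obtain n t where t: "mono_on {..n} t" "\<And>i. i \<le> n \<Longrightarrow> a \<le> t i \<and> t i \<le> b"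
    "z = (\<Sum>i<n. dist (\<gamma> (t i)) (\<gamma> (t (Suc i))))" using assms(1) by (rule polygonal_lengthsE) (rule that)
  have tri: "dist (\<gamma> (t i)) (\<gamma> (t (Suc i))) \<le> dist (\<gamma> (min (t i) c)) (\<gamma> (min (t (Suc i)) c)) + dist (\<gamma> (max (t i) c)) (\<gamma> (max (t (Suc i)) c))"
    if "i < n" for i
  proof -
    have le: "t i \<le> t (Suc i)" using that mono_onD[OF t(1), of i "Suc i"] by simp
    consider "t (Suc i) \<le> c" | "c \<le> t i" | "t i \<le> c" "c \<le> t (Suc i)" by linarith
    then show ?thesis
    proof cases
      case 1
      then have "t i \<le> c" using le by simp
      then show ?thesis using 1 by (simp add: min_absorb1)
    next
      case 2
      then have "c \<le> t (Suc i)" using le by simp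
      then show ?thesis using 2 by (simp add: max_absorb1)
    next
      case 3
      then show ?thesis using dist_triangle[of "\<gamma> (t i)" "\<gamma> (t (Suc i))" "\<gamma> c"]
        by (simp add: min_absorb1 min_absorb2 max_absorb1 max_absorb2)
    qed
  qed
  show thesis
  proof (rule that)
    show "(\<Sum>i<n. dist (\<gamma> (min (t i) c)) (\<gamma> (min (t (Suc i)) c))) \<in> polygonal_lengths \<gamma> a c"
      using t assms by (intro min_in_polygonal_lengths) simp_all
    show "(\<Sum>i<n. dist (\<gamma> (max (t i) c)) (\<gamma> (max (t (Suc i)) c))) \<in> polygonal_lengths \<gamma> c b"
      using t assms by (intro max_in_polygonal_lengths) simp_all
    show "z \<le> (\<Sum>i<n. dist (\<gamma> (min (t i) c)) (\<gamma> (min (t (Suc i)) c))) + (\<Sum>i<n. dist (\<gamma> (max (t i) c)) (\<gamma> (max (t (Suc i)) c)))"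
      unfolding t(3) sum.distrib[symmetric] by (rule sum_mono) (simp add: tri)
  qed
qed

lemma zero_in_polygonal_lengths: "a \<le> b \<Longrightarrow> 0 \<in> polygonal_lengths \<gamma> a b"
  using polygonal_lengthsI[of 0 "\<lambda>_. a" a b \<gamma>] by (simp add: mono_on_def)

lemma chord_in_polygonal_lengths:
  assumes "a \<le> b" shows "dist (\<gamma> a) (\<gamma> b) \<in> polygonal_lengths \<gamma> a b"
  using polygonal_lengthsI[of 1 "\<lambda>i. if i = 0 then a else b" a b \<gamma>] assms by (simp add: mono_on_def)

lemma polygonal_lengths_subset:
  assumes "a' \<le> a" "b \<le> b'" shows "polygonal_lengths \<gamma> a b \<subseteq> polygonal_lengths \<gamma> a' b'"
proof
  fix x assume "x \<in> polygonal_lengths \<gamma> a b"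
  then obtain n t where t: "mono_on {..n} t" "\<And>i. i \<le> n \<Longrightarrow> a \<le> t i \<and> t i \<le> b"
    "x = (\<Sum>i<n. dist (\<gamma> (t i)) (\<gamma> (t (Suc i))))" by (rule polygonal_lengthsE) (rule that)
  have "a' \<le> t i \<and> t i \<le> b'" if "i \<le> n" for i using t(2)[OF that] assms by linarith
  then show "x \<in> polygonal_lengths \<gamma> a' b'" unfolding t(3) by (rule polygonal_lengthsI[OF t(1)])
qed

locale rectifiable_path =
  fixes \<gamma> :: "real \<Rightarrow> complex"
  assumes rect: "rectifiable \<gamma>"
begin

lemma bdd: "0 \<le> a \<Longrightarrow> b \<le> 1 \<Longrightarrow> bdd_above (polygonal_lengths \<gamma> a b)"
  by (rule bdd_above_mono[of "polygonal_lengths \<gamma> 0 1"])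
    (use rect in \<open>simp_all add: rectifiable_def polygonal_lengths_subset\<close>)

lemma length_add:
  assumes "0 \<le> a" "a \<le> c" "c \<le> b" "b \<le> 1"
  shows "Sup (polygonal_lengths \<gamma> a b) = Sup (polygonal_lengths \<gamma> a c) + Sup (polygonal_lengths \<gamma> c b)"
proof (rule antisym)
  have ne: "polygonal_lengths \<gamma> a c \<noteq> {}" "polygonal_lengths \<gamma> c b \<noteq> {}" "polygonal_lengths \<gamma> a b \<noteq> {}"
    using zero_in_polygonal_lengths assms by (metis empty_iff order_trans)+
  have bd: "bdd_above (polygonal_lengths \<gamma> a c)" "bdd_above (polygonal_lengths \<gamma> c b)" "bdd_above (polygonal_lengths \<gamma> a b)"
    using assms by (simp_all add: bdd)
  show "Sup (polygonal_lengths \<gamma> a b) \<le> Sup (polygonal_lengths \<gamma> a c) + Sup (polygonal_lengths \<gamma> c b)"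
  proof (rule cSup_least[OF ne(3)])
    fix z assume "z \<in> polygonal_lengths \<gamma> a b"
    then obtain x y where xy: "x \<in> polygonal_lengths \<gamma> a c" "y \<in> polygonal_lengths \<gamma> c b" "z \<le> x + y"
      using assms(2,3) by (rule polygonal_lengths_split)
    show "z \<le> Sup (polygonal_lengths \<gamma> a c) + Sup (polygonal_lengths \<gamma> c b)"
      using cSup_upper[OF xy(1) bd(1)] cSup_upper[OF xy(2) bd(2)] xy(3) by linarith
  qed
  have sum_le: "x + y \<le> Sup (polygonal_lengths \<gamma> a b)"
    if xy: "x \<in> polygonal_lengths \<gamma> a c" "y \<in> polygonal_lengths \<gamma> c b" for x y
  proof -
    obtain z where z: "z \<in> polygonal_lengths \<gamma> a b" "x + y \<le> z"
      using xy by (rule polygonal_lengths_concat)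
    then show ?thesis using cSup_upper[OF z(1) bd(3)] by linarith
  qed
  have "x \<le> Sup (polygonal_lengths \<gamma> a b) - Sup (polygonal_lengths \<gamma> c b)" if x: "x \<in> polygonal_lengths \<gamma> a c" for x
  proof -
    have "y \<le> Sup (polygonal_lengths \<gamma> a b) - x" if "y \<in> polygonal_lengths \<gamma> c b" for y
      using sum_le[OF x that] by linarith
    then have "Sup (polygonal_lengths \<gamma> c b) \<le> Sup (polygonal_lengths \<gamma> a b) - x"
      by (rule cSup_least[OF ne(2)])
    then show ?thesis by simp
  qed
  then have "Sup (polygonal_lengths \<gamma> a c) \<le> Sup (polygonal_lengths \<gamma> a b) - Sup (polygonal_lengths \<gamma> c b)"
    by (rule cSup_least[OF ne(1)])
  then show "Sup (polygonal_lengths \<gamma> a c) + Sup (polygonal_lengths \<gamma> c b) \<le> Sup (polygonal_lengths \<gamma> a b)" by simp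
qed

abbreviation A where "A \<equiv> arc_length \<gamma>"
abbreviation g where "g \<equiv> natural_param \<gamma>"
abbreviation L where "L \<equiv> arc_length \<gamma> 1"

lemma chord_le_arc:
  assumes "0 \<le> s" "s \<le> t" "t \<le> 1" shows "dist (\<gamma> s) (\<gamma> t) \<le> A t - A s"
proof -
  have "A t = A s + Sup (polygonal_lengths \<gamma> s t)"
    unfolding arc_length_def using assms by (intro length_add) auto
  moreover have "dist (\<gamma> s) (\<gamma> t) \<le> Sup (polygonal_lengths \<gamma> s t)"
    using assms by (intro cSup_upper chord_in_polygonal_lengths bdd) auto
  ultimately show ?thesis by simp
qed

lemma arc_length_mono: "0 \<le> s \<Longrightarrow> s \<le> t \<Longrightarrow> t \<le> 1 \<Longrightarrow> A s \<le> A t"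
  using chord_le_arc[of s t] zero_le_dist[of "\<gamma> s" "\<gamma> t"] by linarith

lemma arc_length_0: "A 0 = 0"
proof -
  have "polygonal_lengths \<gamma> 0 0 = {0}"
  proof (intro equalityI subsetI)
    fix x assume "x \<in> polygonal_lengths \<gamma> 0 0"
    then obtain n t where t: "\<And>i. i \<le> n \<Longrightarrow> 0 \<le> t i \<and> t i \<le> (0::real)"
      "x = (\<Sum>i<n. dist (\<gamma> (t i)) (\<gamma> (t (Suc i))))" by (rule polygonal_lengthsE) (rule that)
    have "t i = 0" if "i \<le> n" for i using t(1)[OF that] by simp
    then show "x \<in> {0}" unfolding t(2) by simp
  qed (simp add: zero_in_polygonal_lengths)
  then show ?thesis by (simp add: arc_length_def)
qed

lemma path: "path \<gamma>" using rect by (simp add: rectifiable_def)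

text \<open>Both the length of the part before a parameter and the length of the part after it are lower
  semicontinuous: a polygon that is nearly optimal for one parameter, truncated at a nearby
  parameter, changes its length only slightly. As the two lengths have a constant sum, both are continuous.\<close>
lemma continuous_arc_length: "continuous_on {0..1} A"
proof -
  have contg: "continuous_on {0..1} \<gamma>" using path by (simp add: path_def)
  define B where "B = (\<lambda>t. Sup (polygonal_lengths \<gamma> t 1))"
  have AB: "L = A t + B t" if "t \<in> {0..1}" for t
    unfolding arc_length_def B_def using that by (intro length_add) auto
  have lscA: "\<exists>d>0. \<forall>s\<in>{0..1}. \<bar>s - t\<bar> < d \<longrightarrow> A t - e < A s" if t: "t \<in> {0..1}" and e: "e > 0" for t e
  proof -
    have "\<exists>z\<in>polygonal_lengths \<gamma> 0 t. A t - e < z"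
    proof (rule less_cSupD)
      show "polygonal_lengths \<gamma> 0 t \<noteq> {}" using zero_in_polygonal_lengths[of 0 t \<gamma>] t by auto
      show "A t - e < Sup (polygonal_lengths \<gamma> 0 t)" using e by (simp add: arc_length_def)
    qed
    then obtain z where zl: "z \<in> polygonal_lengths \<gamma> 0 t" and z': "A t - e < z" by blast
    obtain n r where r: "mono_on {..n} r" "\<And>i. i \<le> n \<Longrightarrow> 0 \<le> r i \<and> r i \<le> t"
      "z = (\<Sum>i<n. dist (\<gamma> (r i)) (\<gamma> (r (Suc i))))" using zl by (rule polygonal_lengthsE) (rule that)
    note z = z'[unfolded r(3)]
    define F where "F = (\<lambda>s. \<Sum>i<n. dist (\<gamma> (min (r i) s)) (\<gamma> (min (r (Suc i)) s)))"
    have c1: "continuous_on {0..1} (\<lambda>s. \<gamma> (min (r i) s))" if "i \<le> n" for i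
      by (rule continuous_on_compose2[OF contg]) (use r(2)[OF that] t in \<open>auto intro!: continuous_intros\<close>)
    have "continuous_on {0..1} F"
      unfolding F_def by (intro continuous_on_sum continuous_on_dist c1) auto
    moreover have "F t = (\<Sum>i<n. dist (\<gamma> (r i)) (\<gamma> (r (Suc i))))"
      unfolding F_def by (rule sum.cong) (use r(2) in \<open>simp_all add: min_absorb1\<close>)
    ultimately obtain d where d: "d > 0" "\<And>s. s \<in> {0..1} \<Longrightarrow> dist s t < d \<Longrightarrow> dist (F s) (F t) < F t - (A t - e)"
      using z t unfolding continuous_on_iff by (metis diff_gt_0_iff_gt)
    show ?thesis
    proof (intro exI[of _ d] conjI d(1) ballI impI)
      fix s :: real assume s: "s \<in> {0..1}" "\<bar>s - t\<bar> < d"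
      have "F s \<le> A s" unfolding arc_length_def F_def
        using s r t by (intro cSup_upper bdd min_in_polygonal_lengths) auto
      moreover have "dist (F s) (F t) < F t - (A t - e)" using d(2) s by (simp add: dist_real_def)
      ultimately show "A t - e < A s" unfolding dist_real_def by linarith
    qed
  qed
  have lscB: "\<exists>d>0. \<forall>s\<in>{0..1}. \<bar>s - t\<bar> < d \<longrightarrow> B t - e < B s" if t: "t \<in> {0..1}" and e: "e > 0" for t e
  proof -
    have "\<exists>z\<in>polygonal_lengths \<gamma> t 1. B t - e < z"
    proof (rule less_cSupD)
      show "polygonal_lengths \<gamma> t 1 \<noteq> {}" using zero_in_polygonal_lengths[of t 1 \<gamma>] t by auto
      show "B t - e < Sup (polygonal_lengths \<gamma> t 1)" using e by (simp add: B_def)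
    qed
    then obtain z where zl: "z \<in> polygonal_lengths \<gamma> t 1" and z': "B t - e < z" by blast
    obtain n r where r: "mono_on {..n} r" "\<And>i. i \<le> n \<Longrightarrow> t \<le> r i \<and> r i \<le> 1"
      "z = (\<Sum>i<n. dist (\<gamma> (r i)) (\<gamma> (r (Suc i))))" using zl by (rule polygonal_lengthsE) (rule that)
    note z = z'[unfolded r(3)]
    define F where "F = (\<lambda>s. \<Sum>i<n. dist (\<gamma> (max (r i) s)) (\<gamma> (max (r (Suc i)) s)))"
    have c1: "continuous_on {0..1} (\<lambda>s. \<gamma> (max (r i) s))" if "i \<le> n" for i
      by (rule continuous_on_compose2[OF contg]) (use r(2)[OF that] t in \<open>auto intro!: continuous_intros\<close>)
    have "continuous_on {0..1} F"
      unfolding F_def by (intro continuous_on_sum continuous_on_dist c1) auto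
    moreover have "F t = (\<Sum>i<n. dist (\<gamma> (r i)) (\<gamma> (r (Suc i))))"
      unfolding F_def by (rule sum.cong) (use r(2) in \<open>simp_all add: max_absorb1\<close>)
    ultimately obtain d where d: "d > 0" "\<And>s. s \<in> {0..1} \<Longrightarrow> dist s t < d \<Longrightarrow> dist (F s) (F t) < F t - (B t - e)"
      using z t unfolding continuous_on_iff by (metis diff_gt_0_iff_gt)
    show ?thesis
    proof (intro exI[of _ d] conjI d(1) ballI impI)
      fix s :: real assume s: "s \<in> {0..1}" "\<bar>s - t\<bar> < d"
      have "F s \<le> B s" unfolding B_def F_def
        using s r t by (intro cSup_upper bdd max_in_polygonal_lengths) auto
      moreover have "dist (F s) (F t) < F t - (B t - e)" using d(2) s by (simp add: dist_real_def)
      ultimately show "B t - e < B s" unfolding dist_real_def by linarith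
    qed
  qed
  show ?thesis
    unfolding continuous_on_iff
  proof (intro ballI allI impI)
    fix t e :: real assume t: "t \<in> {0..1}" and e: "e > 0"
    obtain d1 where d1: "d1 > 0" "\<And>s. s\<in>{0..1} \<Longrightarrow> \<bar>s - t\<bar> < d1 \<Longrightarrow> A t - e < A s" using lscA[OF t e] by blast
    obtain d2 where d2: "d2 > 0" "\<And>s. s\<in>{0..1} \<Longrightarrow> \<bar>s - t\<bar> < d2 \<Longrightarrow> B t - e < B s" using lscB[OF t e] by blast
    show "\<exists>d>0. \<forall>s\<in>{0..1}. dist s t < d \<longrightarrow> dist (A s) (A t) < e"
    proof (intro exI[of _ "min d1 d2"] conjI ballI impI)
      fix s :: real assume s: "s \<in> {0..1}" "dist s t < min d1 d2"
      then have "A t - e < A s" "B t - e < B s" using d1(2)[of s] d2(2)[of s] by (auto simp: dist_real_def)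
      then show "dist (A s) (A t) < e" using AB[OF t] AB[OF s(1)] by (simp add: dist_real_def abs_less_iff)
    qed (use d1 d2 in simp)
  qed
qed

end

locale rectifiable_jordan = rectifiable_path +
  assumes jordan: "jordan_curve \<gamma>"
begin

lemma simple: "simple_path \<gamma>" and closed: "\<gamma> 1 = \<gamma> 0"
  using jordan by (auto simp: jordan_curve_def pathfinish_def pathstart_def)

lemma \<gamma>_eqD: "s \<in> {0..1} \<Longrightarrow> t \<in> {0..1} \<Longrightarrow> \<gamma> s = \<gamma> t \<Longrightarrow> s = t \<or> s = 0 \<and> t = 1 \<or> s = 1 \<and> t = 0"
  using simple unfolding simple_path_def loop_free_def by blast

lemma arc_length_strict_mono: assumes "0 \<le> s" "s < t" "t \<le> 1" shows "A s < A t"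
proof -
  let ?m = "(s + t) / 2"
  have "\<gamma> s \<noteq> \<gamma> ?m" using \<gamma>_eqD[of s ?m] assms by auto
  then have "0 < dist (\<gamma> s) (\<gamma> ?m)" by simp
  also have "dist (\<gamma> s) (\<gamma> ?m) \<le> A ?m - A s" using assms by (intro chord_le_arc) auto
  finally have "A s < A ?m" by simp
  also have "A ?m \<le> A t" using assms by (intro arc_length_mono) auto
  finally show ?thesis .
qed

lemma inj_arc_length: "inj_on A {0..1}"
proof (rule linorder_inj_onI)
  show "A x \<noteq> A y" if "x < y" "x \<in> {0..1}" "y \<in> {0..1}" for x y
    using arc_length_strict_mono[of x y] that by auto
qed auto

lemma natural_param_arc_length: "t \<in> {0..1} \<Longrightarrow> g (A t) = \<gamma> t"
  unfolding natural_param_def by (simp add: inv_into_f_f[OF inj_arc_length])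

lemma L_pos: "0 < L" using arc_length_strict_mono[of 0 1] arc_length_0 by simp

lemma arc_length_image: "A ` {0..1} = {0..L}"
proof
  show "A ` {0..1} \<subseteq> {0..L}" using arc_length_mono[of 0] arc_length_mono[of _ 1] arc_length_0 by auto
  show "{0..L} \<subseteq> A ` {0..1}"
  proof
    fix s assume "s \<in> {0..L}"
    then show "s \<in> A ` {0..1}" using IVT'[of A 0 s 1] arc_length_0 continuous_arc_length by force
  qed
qed

lemma parameterE: assumes "s \<in> {0..L}" obtains t where "t \<in> {0..1}" "s = A t"
  using assms arc_length_image by (metis imageE)

lemma arc_length_le_iff: "s \<in> {0..1} \<Longrightarrow> t \<in> {0..1} \<Longrightarrow> A s \<le> A t \<longleftrightarrow> s \<le> t"
  using arc_length_strict_mono[of t s] arc_length_mono[of s t] by fastforce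

lemma natural_param_image: "g ` {0..L} = path_image \<gamma>"
  unfolding arc_length_image[symmetric] path_image_def image_image using natural_param_arc_length by auto

lemma natural_param_Lipschitz: "1-lipschitz_on {0..L} g"
proof (rule lipschitz_on_leI)
  fix x y assume x: "x \<in> {0..L}" and y: "y \<in> {0..L}" and xy: "x \<le> y"
  obtain s where s: "s \<in> {0..1}" "x = A s" using parameterE[OF x] .
  obtain t where t: "t \<in> {0..1}" "y = A t" using parameterE[OF y] .
  have "s \<le> t" using xy s t arc_length_le_iff by blast
  then show "dist (g x) (g y) \<le> 1 * dist x y"
    using chord_le_arc[of s t] s t xy by (simp add: natural_param_arc_length dist_real_def)
qed simp

lemma natural_param_eqD:
  assumes "x \<in> {0..L}" "y \<in> {0..L}" "g x = g y"
  shows "x = y \<or> x = 0 \<and> y = L \<or> x = L \<and> y = 0"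
proof -
  obtain s where s: "s \<in> {0..1}" "x = A s" using parameterE[OF assms(1)] .
  obtain t where t: "t \<in> {0..1}" "y = A t" using parameterE[OF assms(2)] .
  have "\<gamma> s = \<gamma> t" using assms(3) s t by (simp add: natural_param_arc_length)
  then show ?thesis using \<gamma>_eqD[OF s(1) t(1)] s t arc_length_0 by auto
qed

lemma natural_param_extension_Lipschitz: "1-lipschitz_on UNIV (\<lambda>s. g (max 0 (min s L)))"
proof (rule lipschitz_onI)
  have clamp: "max 0 (min s L) \<in> {0..L}" "\<bar>max 0 (min s L) - max 0 (min t L)\<bar> \<le> \<bar>s - t\<bar>" for s t
    using L_pos by (auto simp: max_def min_def)
  fix x y :: real
  show "dist (g (max 0 (min x L))) (g (max 0 (min y L))) \<le> 1 * dist x y"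
    using lipschitz_onD[OF natural_param_Lipschitz clamp(1)[of x] clamp(1)[of y]] clamp(2)[of x y]
    by (simp add: dist_real_def)
qed simp

text \<open>The natural parametrization has Lipschitz constant one, so its derivative has modulus at most one. Each
  polygon is at most as long as the integral of this modulus, hence so is the curve; as the
  interval has the same length as the curve, the modulus is one almost everywhere.\<close>
lemma unit_speed_ae:
  "negligible {s \<in> {0..L}. \<not> (s \<in> {0<..<L} \<and> (\<exists>\<tau>. norm \<tau> = 1 \<and> (g has_vector_derivative \<tau>) (at s)))}"
proof -
  define h where "h = (\<lambda>s. g (max 0 (min s L)))"
  have hg: "h s = g s" if "s \<in> {0..L}" for s using that by (simp add: h_def)
  have lip: "1-lipschitz_on UNIV h" unfolding h_def by (rule natural_param_extension_Lipschitz)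
  obtain D where D: "D \<in> borel_measurable borel"
    "\<And>x v. (h has_vector_derivative v) (at x) \<Longrightarrow> D x = v"
    "AE x in lborel. norm (D x) \<le> 1"
    "\<And>s t. s \<le> t \<Longrightarrow> set_integrable lborel {s..t} D"
    "\<And>s t. s \<le> t \<Longrightarrow> (LINT x:{s..t}|lborel. D x) = h t - h s"
    using Lipschitz_increment_eq_integral[OF lip] by blast
  define N where "N = (\<lambda>x. norm (D x))"
  have Ni: "set_integrable lborel {s..t} N" if "s \<le> t" for s t
    unfolding N_def by (rule set_integrable_norm[OF D(4)[OF that]])
  have Nint: "N integrable_on {s..t}" "(LINT x:{s..t}|lborel. N x) = integral {s..t} N" if "s \<le> t" for s t
    using set_borel_integral_eq_integral[OF Ni[OF that]] by auto
  have inc: "dist (h s) (h t) \<le> integral {s..t} N" if "s \<le> t" for s t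
  proof -
    have "norm (h t - h s) \<le> (LINT x:{s..t}|lborel. N x)"
      unfolding D(5)[OF that, symmetric] N_def by (rule set_integral_norm_bound[OF D(4)[OF that]])
    then show ?thesis using Nint(2)[OF that] by (simp add: dist_norm norm_minus_commute)
  qed
  have Lle: "L \<le> integral {0..L} N"
  proof -
    have "Sup (polygonal_lengths \<gamma> 0 1) \<le> integral {0..L} N"
    proof (rule cSup_least)
      show "polygonal_lengths \<gamma> 0 1 \<noteq> {}" using zero_in_polygonal_lengths[of 0 1 \<gamma>] by auto
      fix x assume "x \<in> polygonal_lengths \<gamma> 0 1"
      then obtain n t where t: "mono_on {..n} t" "\<And>i. i \<le> n \<Longrightarrow> 0 \<le> t i \<and> t i \<le> 1"
        "x = (\<Sum>i<n. dist (\<gamma> (t i)) (\<gamma> (t (Suc i))))" by (rule polygonal_lengthsE) (rule that)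
      have At: "A (t i) \<in> {0..L}" if "i \<le> n" for i using t(2)[OF that] arc_length_image by auto
      have \<gamma>h: "\<gamma> (t i) = h (A (t i))" if "i \<le> n" for i
        using t(2)[OF that] hg[OF At[OF that]] by (simp add: natural_param_arc_length)
      have le: "A (t i) \<le> A (t j)" if "i \<le> j" "j \<le> n" for i j
        using t(2)[of i] t(2)[of j] that mono_onD[OF t(1), of i j] by (intro arc_length_mono) auto
      have "(\<Sum>i<k. dist (\<gamma> (t i)) (\<gamma> (t (Suc i)))) \<le> integral {A (t 0)..A (t k)} N" if "k \<le> n" for k
        using that
      proof (induction k)
        case (Suc k)
        have "(\<Sum>i<Suc k. dist (\<gamma> (t i)) (\<gamma> (t (Suc i)))) \<le> integral {A (t 0)..A (t k)} N + integral {A (t k)..A (t (Suc k))} N"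
          using Suc inc[OF le[of k "Suc k"]] \<gamma>h[of k] \<gamma>h[of "Suc k"] by simp
        also have "\<dots> = integral {A (t 0)..A (t (Suc k))} N"
          using Suc le[of 0 k] le[of k "Suc k"] le[of 0 "Suc k"] by (intro Henstock_Kurzweil_Integration.integral_combine Nint(1)) auto
        finally show ?case .
      qed simp
      then have "x \<le> integral {A (t 0)..A (t n)} N" unfolding t(3) by simp
      also have "\<dots> \<le> integral {0..L} N"
        using At[of 0] At[of n] le[of 0 n] L_pos by (intro integral_subset_le Nint(1)) (auto simp: N_def)
      finally show "x \<le> integral {0..L} N" .
    qed
    then show ?thesis by (simp add: arc_length_def)
  qed
  have "AE x in lborel. indicator {0..L} x * (1 - N x) = (0::real)"
  proof -
    have 1: "integrable lborel (\<lambda>x. indicator {0..L} x * 1 :: real)"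
      by (simp add: emeasure_lborel_Icc_eq integrable_indicator_iff)
    have 2: "integrable lborel (\<lambda>x. indicator {0..L} x * N x)"
      using Ni[of 0 L] L_pos by (simp add: set_integrable_def)
    have eq: "(\<lambda>x. indicator {0..L} x * (1 - N x)) = (\<lambda>x. indicator {0..L} x * 1 - indicator {0..L} x * N x)"
      by (simp add: fun_eq_iff algebra_simps)
    have int: "integrable lborel (\<lambda>x. indicator {0..L} x * (1 - N x))"
      unfolding eq by (rule Bochner_Integration.integrable_diff[OF 1 2])
    have nn: "AE x in lborel. 0 \<le> indicator {0..L} x * (1 - N x)"
      using D(3) by eventually_elim (simp add: N_def)
    have "(LINT x|lborel. indicator {0..L} x * (1 - N x)) = L - integral {0..L} N"
      unfolding eq Bochner_Integration.integral_diff[OF 1 2] using Nint(2)[of 0 L] L_pos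
      by (simp add: set_lebesgue_integral_def)
    then have "(LINT x|lborel. indicator {0..L} x * (1 - N x)) = 0"
      using Lle integral_nonneg_AE[OF nn] by linarith
    then show ?thesis using integral_nonneg_eq_0_iff_AE[OF int nn] by simp
  qed
  then have "AE x in completion lborel. indicator {0..L} x * (1 - N x) = (0::real)"
    unfolding AE_completion_iff .
  then obtain Z where Z: "{x. indicator {0..L} x * (1 - N x) \<noteq> (0::real)} \<subseteq> Z" "Z \<in> null_sets lebesgue"
    by (auto simp: eventually_ae_filter)
  have neg: "negligible (Z \<union> {x. \<not> (\<exists>D. (h has_vector_derivative D) (at x))} \<union> {0,L})"
    using Z(2) Lipschitz_complex_differentiable_ae[OF lip] by (intro negligible_Un) (auto simp: negligible_iff_null_sets)
  show ?thesis
  proof (rule negligible_subset[OF neg], rule subsetI, rule ccontr)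
    fix s assume s: "s \<in> {s \<in> {0..L}. \<not> (s \<in> {0<..<L} \<and> (\<exists>\<tau>. norm \<tau> = 1 \<and> (g has_vector_derivative \<tau>) (at s)))}"
      "s \<notin> Z \<union> {x. \<not> (\<exists>D. (h has_vector_derivative D) (at x))} \<union> {0,L}"
    then have sL: "s \<in> {0<..<L}" by auto
    obtain v where v: "(h has_vector_derivative v) (at s)" using s by auto
    have "indicator {0..L} s * (1 - N s) = (0::real)" using s(2) Z(1) by auto
    then have "norm v = 1" using sL D(2)[OF v] by (simp add: N_def)
    moreover have "(g has_vector_derivative v) (at s)"
      by (rule has_vector_derivative_transform_within_open[OF v, of "{0<..<L}"]) (use sL hg in auto)
    ultimately show False using s sL by auto
  qed
qed

lemma tangent_direction_natural_param:
  assumes s: "s \<in> {0<..<L}" and d: "(g has_vector_derivative \<tau>) (at s)" and n: "norm \<tau> = 1"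
  shows "tangent_direction \<gamma> (g s) \<tau>"
proof -
  obtain t where t: "t \<in> {0..1}" "s = A t" using parameterE[of s] s by auto
  have t01: "t \<in> {0<..<1}" using t s arc_length_0 by (cases "t = 0"; cases "t = 1") auto
  have lim: "((\<lambda>y. (1 / (y - s)) *\<^sub>R (g y - g s)) \<longlongrightarrow> \<tau>) (at s)"
    using d by (rule has_vector_derivative_quotient)
  have "((\<lambda>y. sgn ((1 / (y - s)) *\<^sub>R (g y - g s))) \<longlongrightarrow> sgn \<tau>) (at s)"
    using n by (intro tendsto_sgn lim) auto
  then have lim': "((\<lambda>y. sgn (y - s) *\<^sub>R sgn (g y - g s)) \<longlongrightarrow> \<tau>) (at s)"
    using n by (simp add: sgn_scaleR sgn_div_norm[of \<tau>] divide_inverse)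
  have cont: "(A \<longlongrightarrow> s) (at t)"
  proof -
    have "continuous (at t) A"
      using continuous_arc_length t01 by (intro continuous_on_interior[of "{0..1}"]) auto
    then show ?thesis using t(2) by (simp add: isCont_def)
  qed
  have evR: "\<forall>\<^sub>F x in at_right t. x \<in> {t<..<1}" using t01 by (intro eventually_at_right_real) auto
  have evL: "\<forall>\<^sub>F x in at_left t. x \<in> {0<..<t}" using t01 by (intro eventually_at_left_real) auto
  have frac: "frac x = x" if "0 < x" "x < 1" for x :: real using that by (simp add: frac_eq)
  have AR: "filterlim A (at s) (at_right t)"
    unfolding filterlim_at
  proof
    show "(A \<longlongrightarrow> s) (at_right t)" using cont by (simp add: filterlim_at_split)
    show "\<forall>\<^sub>F x in at_right t. A x \<in> UNIV \<and> A x \<noteq> s"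
      using evR
    proof eventually_elim
      case (elim x)
      then show ?case using arc_length_strict_mono[of t x] t t01 by auto
    qed
  qed
  have AL: "filterlim A (at s) (at_left t)"
    unfolding filterlim_at
  proof
    show "(A \<longlongrightarrow> s) (at_left t)" using cont by (simp add: filterlim_at_split)
    show "\<forall>\<^sub>F x in at_left t. A x \<in> UNIV \<and> A x \<noteq> s"
      using evL
    proof eventually_elim
      case (elim x)
      then show ?case using arc_length_strict_mono[of x t] t t01 by auto
    qed
  qed
  have "((\<lambda>x. sgn (\<gamma> (frac x) - g s)) \<longlongrightarrow> \<tau>) (at_right t)"
  proof (rule Lim_transform_eventually[OF filterlim_compose[OF lim' AR]])
    show "\<forall>\<^sub>F x in at_right t. sgn (A x - s) *\<^sub>R sgn (g (A x) - g s) = sgn (\<gamma> (frac x) - g s)"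
      using evR
    proof eventually_elim
      case (elim x)
      then show ?case using arc_length_strict_mono[of t x] t t01 by (simp add: frac natural_param_arc_length)
    qed
  qed
  moreover have "((\<lambda>x. sgn (\<gamma> (frac x) - g s)) \<longlongrightarrow> - \<tau>) (at_left t)"
  proof (rule Lim_transform_eventually[OF tendsto_minus[OF filterlim_compose[OF lim' AL]]])
    show "\<forall>\<^sub>F x in at_left t. - (sgn (A x - s) *\<^sub>R sgn (g (A x) - g s)) = sgn (\<gamma> (frac x) - g s)"
      using evL
    proof eventually_elim
      case (elim x)
      then show ?case using arc_length_strict_mono[of x t] t t01 by (simp add: frac natural_param_arc_length)
    qed
  qed
  moreover have "\<gamma> t = g s" using t by (simp add: natural_param_arc_length)
  ultimately show ?thesis unfolding tangent_direction_def using t01 by auto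
qed

end

section \<open>Holomorphic functions above a Lipschitz graph\<close>

lemma closed_segment_coordinates:
  assumes "w \<in> closed_segment z1 (z2 :: complex)"
  obtains s where "0 \<le> s" "s \<le> 1" "Re w = Re z1 + s * (Re z2 - Re z1)" "Im w = Im z1 + s * (Im z2 - Im z1)"
proof -
  obtain s where s: "0 \<le> s" "s \<le> 1" "w = (1 - s) *\<^sub>R z1 + s *\<^sub>R z2" using assms unfolding closed_segment_def by blast
  show thesis
    by (rule that[OF s(1,2)]) (simp_all add: s(3) algebra_simps)
qed

text \<open>The model domain: the part of a square above a Lipschitz graph. The Lipschitz constant is small in order that
  segments of slope above one eighth leave the graph upwards, while there is still room for segments
  of larger slope that remain below slope one. The normalization at the origin keeps the graph
  in the lower part of the square.\<close>
locale lipschitz_graph =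
  fixes \<phi> :: "real \<Rightarrow> real"
  assumes lip: "\<And>x y. \<bar>\<phi> x - \<phi> y\<bar> \<le> \<bar>x - y\<bar> / 8" and \<phi>0: "\<bar>\<phi> 0\<bar> \<le> 1 / 16"
begin

definition Om :: "complex set" where "Om = {z. \<bar>Re z\<bar> < 1 \<and> \<phi> (Re z) < Im z \<and> Im z < 1}"
definition b :: "real \<Rightarrow> complex" where "b x = Complex x (\<phi> x)"
definition NT :: "real \<Rightarrow> real \<Rightarrow> complex set" where "NT \<kappa> x = {z. ball z (\<kappa> * cmod (z - b x)) \<subseteq> Om}"

lemma Re_b [simp]: "Re (b x) = x" and Im_b [simp]: "Im (b x) = \<phi> x" by (simp_all add: b_def)

lemma \<phi>_bound: "\<bar>\<phi> x\<bar> \<le> 1 / 16 + \<bar>x\<bar> / 8"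
proof -
  have "\<bar>\<phi> x - \<phi> 0\<bar> \<le> \<bar>x\<bar> / 8" using lip[of x 0] by simp
  then show ?thesis using \<phi>0 by linarith
qed

lemma \<phi>_le: "\<phi> y \<le> \<phi> x + \<bar>x - y\<bar> / 8"
  using lip[of x y] by linarith

lemma \<phi>_continuous: "continuous_on A \<phi>"
proof -
  have "(1/8)-lipschitz_on A \<phi>" using lip by (intro lipschitz_onI) (simp_all add: dist_real_def)
  then show ?thesis by (rule lipschitz_on_continuous_on)
qed

lemma open_Om: "open Om"
proof -
  have "continuous_on UNIV (\<lambda>z. \<phi> (Re z))"
    by (rule continuous_on_compose2[OF \<phi>_continuous[of UNIV]]) (auto intro: continuous_intros)
  then have "open {z. \<phi> (Re z) < Im z}" by (intro open_Collect_less) (auto intro: continuous_intros)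
  moreover have "open {z. \<bar>Re z\<bar> < 1}" "open {z. Im z < 1}" by (auto intro!: open_Collect_less continuous_intros)
  ultimately have "open ({z. \<bar>Re z\<bar> < 1} \<inter> {z. \<phi> (Re z) < Im z} \<inter> {z. Im z < 1})" by blast
  moreover have "\<dots> = Om" by (auto simp: Om_def)
  ultimately show ?thesis by simp
qed

text \<open>The domain is starlike about a point at height one half: a point far below it is joined to it
  by a steep segment, and a point at comparable height by a segment that stays above the whole graph.\<close>
lemma starlike_Om: "starlike Om"
  unfolding starlike_def
proof (intro bexI ballI subsetI)
  show c: "Complex 0 (1/2) \<in> Om" using \<phi>0 by (simp add: Om_def abs_le_iff)
  fix z w assume z: "z \<in> Om" and w: "w \<in> closed_segment (Complex 0 (1/2)) z"
  obtain s where s: "0 \<le> s" "s \<le> 1" "Re w = s * Re z" "Im w = 1/2 + s * (Im z - 1/2)"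
    using closed_segment_coordinates[OF w] by auto
  have Rew: "\<bar>Re w\<bar> \<le> \<bar>Re z\<bar>" using s by (simp add: abs_mult mult_left_le_one_le)
  have I1: "Im w < 1"
  proof -
    have "s * (Im z - 1/2) \<le> s * (1/2)" using s z by (intro mult_left_mono) (auto simp: Om_def)
    moreover have "s * (Im z - 1/2) < 1/2"
    proof (cases "s = 0")
      case False
      then have "s * (Im z - 1/2) < s * (1/2)" using s z by (intro mult_strict_left_mono) (auto simp: Om_def)
      then show ?thesis using s by linarith
    qed simp
    ultimately show ?thesis using s by linarith
  qed
  have I2: "\<phi> (Re w) < Im w"
  proof (cases "Im z < 3/8")
    case True
    have "\<phi> (Re w) \<le> \<phi> (Re z) + \<bar>Re z - Re w\<bar> / 8" by (rule \<phi>_le)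
    also have "Re z - Re w = (1 - s) * Re z" by (simp add: s(3) algebra_simps)
    also have "\<bar>(1 - s) * Re z\<bar> = (1 - s) * \<bar>Re z\<bar>" using s by (simp add: abs_mult)
    also have "(1 - s) * \<bar>Re z\<bar> \<le> (1 - s) * 1" using s z by (intro mult_left_mono) (auto simp: Om_def)
    also have "\<phi> (Re z) + (1 - s) * 1 / 8 < Im z + (1 - s) / 8" using z by (simp add: Om_def)
    also have "\<dots> \<le> Im z + (1 - s) * (1/2 - Im z)"
    proof -
      have "(1 - s) * (1/8) \<le> (1 - s) * (1/2 - Im z)" using True s by (intro mult_left_mono) auto
      then show ?thesis by simp
    qed
    also have "Im z + (1 - s) * (1/2 - Im z) = 1/2 + s * (Im z - 1/2)"
      by (simp add: left_diff_distrib right_diff_distrib diff_divide_distrib)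
    finally show ?thesis using s(4) by simp
  next
    case False
    have "\<phi> (Re w) \<le> 1/16 + 1/8" using \<phi>_bound[of "Re w"] Rew z unfolding Om_def mem_Collect_eq by argo
    moreover have "s * (- 1/8) \<le> s * (Im z - 1/2)" using False s by (intro mult_left_mono) auto
    then have "Im w \<ge> 3/8" using s by linarith
    ultimately show ?thesis by simp
  qed
  show "w \<in> Om" using Rew I1 I2 z by (simp add: Om_def)
qed

lemma primitive:
  assumes "f holomorphic_on Om"
  obtains G where "\<And>z. z \<in> Om \<Longrightarrow> (G has_field_derivative f z) (at z)"
proof -
  have "f field_differentiable at x" if "x \<in> Om - {}" for x
    using assms that open_Om holomorphic_on_imp_differentiable_at by blast
  then have "\<exists>g. \<forall>x\<in>Om. (g has_field_derivative f x) (at x)"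
    by (rule holomorphic_starlike_primitive[OF holomorphic_on_imp_continuous_on[OF assms] starlike_Om open_Om finite.emptyI])
  then show thesis using that by blast
qed

lemma steep_segment_aux:
  assumes "z1 \<in> Om" "z2 \<in> Om" "\<bar>Re z2 - Re z1\<bar> / 8 \<le> Im z2 - Im z1"
  shows "closed_segment z1 z2 \<subseteq> Om"
proof
  fix w assume "w \<in> closed_segment z1 z2"
  then obtain s where s: "0 \<le> s" "s \<le> 1" "Re w = Re z1 + s * (Re z2 - Re z1)" "Im w = Im z1 + s * (Im z2 - Im z1)"
    by (rule closed_segment_coordinates)
  have "\<phi> (Re w) \<le> \<phi> (Re z1) + \<bar>Re z1 - Re w\<bar> / 8" by (rule \<phi>_le)
  also have "\<bar>Re z1 - Re w\<bar> = s * \<bar>Re z2 - Re z1\<bar>" using s by (simp add: abs_mult)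
  also have "\<phi> (Re z1) + s * \<bar>Re z2 - Re z1\<bar> / 8 < Im z1 + s * (Im z2 - Im z1)"
    using assms mult_left_mono[OF assms(3) s(1)] by (simp add: Om_def)
  finally have 1: "\<phi> (Re w) < Im w" by (simp add: s)
  have cv: "convex {z. \<bar>Re z\<bar> < 1 \<and> Im z < 1}"
  proof -
    have "{z. \<bar>Re z\<bar> < 1 \<and> Im z < 1} = {z. Re z < 1} \<inter> {z. Re z > -1} \<inter> {z. Im z < 1}" by auto
    then show ?thesis by (simp add: convex_Int convex_halfspace_Re_lt convex_halfspace_Re_gt convex_halfspace_Im_lt)
  qed
  have "closed_segment z1 z2 \<subseteq> {z. \<bar>Re z\<bar> < 1 \<and> Im z < 1}"
    by (rule closed_segment_subset[OF _ _ cv]) (use assms in \<open>simp_all add: Om_def\<close>)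
  then show "w \<in> Om" using 1 \<open>w \<in> closed_segment z1 z2\<close> by (auto simp: Om_def)
qed

lemma steep_segment:
  assumes "z1 \<in> Om" "z2 \<in> Om" "\<bar>Re z2 - Re z1\<bar> / 8 \<le> \<bar>Im z2 - Im z1\<bar>"
  shows "closed_segment z1 z2 \<subseteq> Om"
proof (cases "Im z1 \<le> Im z2")
  case True
  then show ?thesis using assms by (intro steep_segment_aux) auto
next
  case False
  then have "closed_segment z2 z1 \<subseteq> Om" using assms by (intro steep_segment_aux) (auto simp: abs_minus_commute)
  then show ?thesis by (simp add: closed_segment_commute)
qed

text \<open>Two points are joined by one steep segment, or by two steep segments that meet at a point above the
  middle; the length of this path is comparable with the distance. The restriction to the
  lower half leaves room for the meeting point.\<close>
lemma primitive_Lipschitz: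
  assumes G: "\<And>z. z \<in> Om \<Longrightarrow> (G has_field_derivative f z) (at z)" and f1: "\<And>z. z \<in> Om \<Longrightarrow> cmod (f z) \<le> 1"
  shows "2-lipschitz_on {z \<in> Om. Im z < 1/2} G"
proof (rule lipschitz_onI)
  have seg: "cmod (G z - G w) \<le> cmod (z - w)" if "closed_segment z w \<subseteq> Om" for z w
  proof -
    have "cmod (G z - G w) \<le> 1 * cmod (z - w)"
      by (rule field_differentiable_bound[of "closed_segment z w" G f])
        (use that in \<open>auto intro!: f1 has_field_derivative_at_within[OF G]\<close>)
    then show ?thesis by simp
  qed
  fix z1 z2 assume z: "z1 \<in> {z \<in> Om. Im z < 1/2}" "z2 \<in> {z \<in> Om. Im z < 1/2}"
  show "dist (G z1) (G z2) \<le> 2 * dist z1 z2"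
  proof (cases "\<bar>Re z2 - Re z1\<bar> / 8 \<le> \<bar>Im z2 - Im z1\<bar>")
    case True
    have "cmod (G z1 - G z2) \<le> cmod (z1 - z2)" by (rule seg, rule steep_segment) (use z True in auto)
    then show ?thesis using norm_ge_zero[of "z1 - z2"] unfolding dist_norm by linarith
  next
    case False
    \<comment> \<open>Go up to a point from which both ends are seen steeply.\<close>
    define d where "d = \<bar>Re z2 - Re z1\<bar>"
    define z3 where "z3 = Complex ((Re z1 + Re z2) / 2) (max (Im z1) (Im z2) + d / 16)"
    have d2: "d \<le> 2" using z by (auto simp: Om_def d_def)
    have z3: "z3 \<in> Om"
    proof -
      have "\<phi> ((Re z1 + Re z2) / 2) \<le> \<phi> (Re z1) + \<bar>Re z1 - (Re z1 + Re z2) / 2\<bar> / 8" by (rule \<phi>_le)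
      also have "\<bar>Re z1 - (Re z1 + Re z2) / 2\<bar> = d / 2" by (simp add: d_def abs_if field_simps)
      also have "\<phi> (Re z1) + d / 2 / 8 < max (Im z1) (Im z2) + d / 16" using z by (simp add: Om_def less_max_iff_disj)
      finally have 1: "\<phi> (Re z3) < Im z3" by (simp add: z3_def)
      have 2: "Im z3 < 1" using z d2 by (simp add: z3_def max_def)
      have 3: "\<bar>Re z3\<bar> < 1" using z by (simp add: z3_def Om_def abs_less_iff)
      show ?thesis using 1 2 3 by (simp add: Om_def)
    qed
    have half: "\<bar>Re z3 - Re z1\<bar> = d / 2" "\<bar>Re z3 - Re z2\<bar> = d / 2" by (simp_all add: z3_def d_def abs_if field_simps)
    have st: "d / 2 / 8 \<le> Im z3 - Im z1" "d / 2 / 8 \<le> Im z3 - Im z2" by (simp_all add: z3_def)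
    have st': "\<bar>Re z3 - Re z1\<bar> / 8 \<le> \<bar>Im z3 - Im z1\<bar>" "\<bar>Re z3 - Re z2\<bar> / 8 \<le> \<bar>Im z3 - Im z2\<bar>"
      unfolding half using st abs_ge_self order_trans by blast+
    have i: "\<bar>Im z3 - Im z1\<bar> \<le> d / 16 + d / 8" "\<bar>Im z3 - Im z2\<bar> \<le> d / 16 + d / 8"
      using False unfolding z3_def d_def complex.sel by linarith+
    have "cmod (G z1 - G z3) \<le> cmod (z1 - z3)"
      by (rule seg, rule steep_segment) (use z z3 st' in \<open>simp_all add: abs_minus_commute\<close>)
    also have "cmod (z1 - z3) \<le> d / 2 + (d / 16 + d / 8)"
      using cmod_le[of "z1 - z3"] half i by (simp add: abs_minus_commute)
    finally have a: "cmod (G z1 - G z3) \<le> d" using d_def abs_ge_zero[of "Re z2 - Re z1"] by argo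
    have "cmod (G z2 - G z3) \<le> cmod (z2 - z3)"
      by (rule seg, rule steep_segment) (use z z3 st' in \<open>simp_all add: abs_minus_commute\<close>)
    also have "cmod (z2 - z3) \<le> d / 2 + (d / 16 + d / 8)"
      using cmod_le[of "z2 - z3"] half i by (simp add: abs_minus_commute)
    finally have b: "cmod (G z2 - G z3) \<le> d" using d_def abs_ge_zero[of "Re z2 - Re z1"] by argo
    have "cmod (G z1 - G z2) \<le> 2 * d"
      using a b norm_triangle_ineq4[of "G z1 - G z3" "G z2 - G z3"] by simp
    also have "d \<le> cmod (z1 - z2)" using abs_Re_le_cmod[of "z1 - z2"] by (simp add: d_def abs_minus_commute)
    finally show ?thesis by (simp add: dist_norm)
  qed
qed simp

lemma Re_csqrt_ge:
  assumes "- cmod \<omega> / 8 \<le> Re \<omega>" shows "sqrt (cmod \<omega>) / 2 \<le> Re (csqrt \<omega>)"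
proof -
  have "sqrt (cmod \<omega>) / 2 = sqrt (cmod \<omega> / 4)" by (simp add: real_sqrt_divide)
  also have "\<dots> \<le> sqrt ((cmod \<omega> + Re \<omega>) / 2)"
  proof (rule real_sqrt_le_mono)
    define c where "c = cmod \<omega>"
    have "0 \<le> c" "- c / 8 \<le> Re \<omega>" using assms by (simp_all add: c_def)
    then have "c / 4 \<le> (c + Re \<omega>) / 2" by (simp add: field_simps)
    then show "cmod \<omega> / 4 \<le> (cmod \<omega> + Re \<omega>) / 2" by (simp add: c_def)
  qed
  finally show ?thesis by simp
qed

lemma b_in_closure: assumes "\<bar>x\<bar> < 1" shows "b x \<in> closure {z \<in> Om. Im z < 1/2}"
  unfolding closure_approachable
proof (intro allI impI)
  fix e :: real assume e: "e > 0"
  let ?z = "Complex x (\<phi> x + min (e/2) (1/8))"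
  have "?z - b x = \<i> * of_real (min (e/2) (1/8))" by (simp add: b_def complex_eq_iff)
  then have "dist ?z (b x) < e" using e by (simp add: dist_norm norm_mult)
  moreover have "?z \<in> {z \<in> Om. Im z < 1/2}" using \<phi>_bound[of x] assms e by (auto simp: Om_def min_def)
  ultimately show "\<exists>y\<in>{z \<in> Om. Im z < 1/2}. dist y (b x) < e" by blast
qed

text \<open>A boundary estimate \<open>H = o(|z - \<zeta>|)\<close> propagates into the domain. For a point at distance \<open>h\<close>
  from \<open>\<zeta>\<close> consider the part of the domain within distance \<open>r = h l\<^sup>2\<close>, with \<open>l\<close> large. The domain
  lies in a sector at \<open>\<zeta>\<close> in which a suitable square root has real part of the order of the root of the modulus.
  Multiplying \<open>H\<close> by the exponential of \<open>- l\<close> times this root reduces the trivial bound \<open>K r\<close> on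
  the circular part of the boundary by the factor \<open>exp (- l / 3)\<close>, which beats \<open>l\<^sup>2\<close>, and costs only a
  constant at the given point.\<close>
lemma interior_estimate:
  assumes x0: "\<bar>x0\<bar> < 1/4"
    and H: "H holomorphic_on {z \<in> Om. Im z < 1/2}" "K-lipschitz_on (closure {z \<in> Om. Im z < 1/2}) H" "H (b x0) = 0"
    and bd: "\<And>e. e > 0 \<Longrightarrow> \<exists>d>0. \<forall>x. \<bar>x - x0\<bar> < d \<longrightarrow> cmod (H (b x)) \<le> e * \<bar>x - x0\<bar>"
    and e: "e > 0"
  shows "\<exists>d>0. \<forall>z. \<phi> (Re z) < Im z \<longrightarrow> cmod (z - b x0) < d \<longrightarrow> cmod (H z) \<le> e * cmod (z - b x0)"
proof -
  let ?U = "{z \<in> Om. Im z < 1/2}" and ?\<zeta> = "b x0"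
  have K0: "0 \<le> K" using H(2) by (rule lipschitz_on_nonneg)
  have "((\<lambda>l. K * l^2 * exp (- l / 3) * exp 2) \<longlongrightarrow> 0) at_top" by real_asymp
  then have "\<forall>\<^sub>F l in at_top. K * l^2 * exp (- l / 3) * exp 2 < e" using e by (rule order_tendstoD)
  then have "\<forall>\<^sub>F l in at_top. 2 \<le> l \<and> K * l^2 * exp (- l / 3) * exp 2 < e"
    using eventually_ge_at_top[of 2] by eventually_elim simp
  then obtain l where l: "2 \<le> l" "K * l^2 * exp (- l / 3) * exp 2 \<le> e"
    by (auto simp: eventually_at_top_linorder less_imp_le dest: spec)
  define e1 where "e1 = e / (l^2 * exp 2)"
  have e1: "e1 > 0" "e1 * l^2 * exp 2 = e" using e l by (simp_all add: e1_def)
  obtain d1 where d1: "d1 > 0" "\<And>x. \<bar>x - x0\<bar> < d1 \<Longrightarrow> cmod (H (b x)) \<le> e1 * \<bar>x - x0\<bar>" using bd[OF e1(1)] by blast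
  define d where "d = min d1 (1/8) / (l^2)"
  have l2: "4 \<le> l^2" using l(1) power_mono[of 2 l 2] by simp
  have d: "d > 0" using d1 l by (auto simp: d_def)
  show ?thesis
  proof (intro exI[of _ d] conjI d allI impI)
    fix z assume z: "\<phi> (Re z) < Im z" "cmod (z - ?\<zeta>) < d"
    define h where "h = cmod (z - ?\<zeta>)"
    define r where "r = h * l^2"
    have h: "h > 0" using z by (auto simp: h_def)
    have hr: "4 * h \<le> r" using h l2 by (simp add: r_def)
    have rd: "r < d1" "r < 1/8" "r > 0"
    proof -
      have "r < min d1 (1/8)" using z(2) l2 unfolding h_def[symmetric] d_def r_def by (subst (asm) pos_less_divide_eq) auto
      then show "r < d1" "r < 1/8" by auto
      show "r > 0" using h hr by simp
    qed
    define W where "W = {w. \<phi> (Re w) < Im w \<and> cmod (w - ?\<zeta>) < r}"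
    define C where "C = {w. \<phi> (Re w) \<le> Im w \<and> cmod (w - ?\<zeta>) \<le> r}"
    have c\<phi>: "continuous_on UNIV (\<lambda>z. \<phi> (Re z))"
      by (rule continuous_on_compose2[OF \<phi>_continuous[of UNIV]]) (auto intro: continuous_intros)
    have oW: "open W" unfolding W_def
      by (intro open_Collect_conj open_Collect_less c\<phi> continuous_intros)
    have cC: "closed C" unfolding C_def
      by (intro closed_Collect_conj closed_Collect_le c\<phi> continuous_intros)
    have WC: "closure W \<subseteq> C" by (rule closure_minimal[OF _ cC]) (auto simp: W_def C_def)
    have near: "\<bar>Re w - x0\<bar> \<le> r \<and> Im w < 1/2" if "w \<in> C" for w
      using that abs_Re_le_cmod[of "w - ?\<zeta>"] abs_Im_le_cmod[of "w - ?\<zeta>"] \<phi>_bound[of x0] x0 rd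
      by (auto simp: C_def)
    have WU: "W \<subseteq> ?U"
    proof
      fix w assume w: "w \<in> W"
      then have "w \<in> C" by (auto simp: W_def C_def)
      from near[OF this] show "w \<in> ?U" using w x0 rd by (auto simp: W_def Om_def)
    qed
    have cWU: "closure W \<subseteq> closure ?U" using WU by (rule closure_mono)
    \<comment> \<open>The shift by \<open>h\<close> moves the branch point of the square root out of the closed domain.\<close>
    define \<omega> where "\<omega> = (\<lambda>w. (- \<i> * (w - ?\<zeta>) + of_real h) / of_real r)"
    have \<omega>Re: "Re (\<omega> w) = (Im w - \<phi> x0 + h) / r" and \<omega>Im: "Im (\<omega> w) = - (Re w - x0) / r" for w
      by (simp_all add: \<omega>_def)
    have \<omega>lo: "- \<bar>Im (\<omega> w)\<bar> / 8 < Re (\<omega> w)" if "w \<in> C" for w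
    proof -
      have "\<phi> x0 \<le> \<phi> (Re w) + \<bar>Re w - x0\<bar> / 8" by (rule \<phi>_le)
      then have "- \<bar>Re w - x0\<bar> / 8 < Im w - \<phi> x0 + h" using that h by (simp add: C_def)
      then have "- \<bar>Re w - x0\<bar> / 8 / r < (Im w - \<phi> x0 + h) / r" using rd by (intro divide_strict_right_mono) auto
      then show ?thesis using rd by (simp add: \<omega>Re \<omega>Im abs_divide mult.commute abs_minus_commute[of x0 "Re w"])
    qed
    have \<omega>np: "\<omega> w \<notin> \<real>\<^sub>\<le>\<^sub>0" if "w \<in> C" for w
      using \<omega>lo[OF that] by (auto simp: complex_nonpos_Reals_iff)
    have \<omega>lo': "- cmod (\<omega> w) / 8 \<le> Re (\<omega> w)" if "w \<in> C" for w
      using \<omega>lo[OF that] abs_Im_le_cmod[of "\<omega> w"] by linarith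
    define P where "P = (\<lambda>w. H w * exp (- of_real l * csqrt (\<omega> w)))"
    have normP: "cmod (P w) = cmod (H w) * exp (- l * Re (csqrt (\<omega> w)))" for w
      by (simp add: P_def norm_mult norm_exp_eq_Re del: csqrt.simps)
    have "cmod (P z) \<le> max (e1 * r) (K * r * exp (- l / 3))"
    proof (rule maximum_modulus_frontier[of P W])
      have "P holomorphic_on W"
        unfolding P_def
      proof (intro holomorphic_intros holomorphic_on_subset[OF H(1) WU])
        show "\<omega> holomorphic_on W" unfolding \<omega>_def using rd by (intro holomorphic_intros) auto
        show "\<omega> w \<notin> \<real>\<^sub>\<le>\<^sub>0" if "w \<in> W" for w using \<omega>np that WC closure_subset by blast
      qed
      then show "P holomorphic_on interior W" using oW by (simp add: interior_open)
      have "continuous_on (closure W) \<omega>" unfolding \<omega>_def using rd by (intro continuous_intros) auto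
      moreover have "continuous_on (closure W) H"
        using lipschitz_on_continuous_on[OF H(2)] cWU by (rule continuous_on_subset)
      ultimately show "continuous_on (closure W) P" unfolding P_def
      proof (intro continuous_intros)
        show "continuous_on (closure W) (\<lambda>w. csqrt (\<omega> w))"
          by (rule continuous_on_compose2[OF continuous_on_csqrt])
            (use \<open>continuous_on (closure W) \<omega>\<close> \<omega>np WC in auto)
      qed
      show "bounded W"
        by (rule bounded_subset[of "cball ?\<zeta> r"]) (auto simp: W_def dist_norm norm_minus_commute)
      show "z \<in> W"
      proof -
        have "cmod (z - ?\<zeta>) < r" using h hr unfolding h_def[symmetric] by argo
        then show ?thesis using z(1) by (simp add: W_def)
      qed
      fix w assume "w \<in> frontier W"
      then have wc: "w \<in> closure W" and wn: "w \<notin> W"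
        using interior_open[OF oW] by (simp_all add: frontier_def)
      have wC: "w \<in> C" using wc WC by blast
      show "cmod (P w) \<le> max (e1 * r) (K * r * exp (- l / 3))"
      proof (cases "cmod (w - ?\<zeta>) < r")
        case True
        then have "\<phi> (Re w) = Im w" using wn wC by (auto simp: W_def C_def)
        then have wb: "w = b (Re w)" by (simp add: b_def complex_eq_iff)
        have "cmod (P w) \<le> cmod (H w) * 1"
          unfolding normP using l Re_csqrt[of "\<omega> w"] by (intro mult_left_mono) auto
        also have "cmod (H w) \<le> e1 * \<bar>Re w - x0\<bar>"
          using d1(2)[of "Re w"] near[OF wC] rd wb by simp
        also have "e1 * \<bar>Re w - x0\<bar> \<le> e1 * r" using near[OF wC] e1 by (intro mult_left_mono) auto
        finally show ?thesis by simp
      next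
        case False
        then have wr: "cmod (w - ?\<zeta>) = r" using wC by (simp add: C_def)
        have "1/2 \<le> cmod (\<omega> w)"
        proof -
          have "cmod (- \<i> * (w - ?\<zeta>)) - cmod (of_real (- h)) \<le> cmod (- \<i> * (w - ?\<zeta>) - of_real (- h))"
            by (rule norm_triangle_ineq2)
          then have "r - h \<le> cmod (- \<i> * (w - ?\<zeta>) + of_real h)" using wr h by (simp add: norm_mult)
          then have "r * (1/2) \<le> cmod (- \<i> * (w - ?\<zeta>) + of_real h)" using hr h by linarith
          then have "1/2 \<le> cmod (- \<i> * (w - ?\<zeta>) + of_real h) / r" using rd by (simp add: pos_le_divide_eq mult.commute)
          then show ?thesis unfolding \<omega>_def using rd by (simp add: norm_divide)
        qed
        then have "sqrt (4/9) \<le> sqrt (cmod (\<omega> w))" by (intro real_sqrt_le_mono) auto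
        then have "1 / 3 \<le> sqrt (cmod (\<omega> w)) / 2" by (simp add: real_sqrt_divide)
        then have "1 / 3 \<le> Re (csqrt (\<omega> w))" using Re_csqrt_ge[OF \<omega>lo'[OF wC]] by linarith
        then have "exp (- l * Re (csqrt (\<omega> w))) \<le> exp (- l / 3)"
          using l mult_left_mono[of "1/3" "Re (csqrt (\<omega> w))" l] by (simp del: csqrt.simps)
        moreover have "cmod (H w) \<le> K * r"
        proof -
          have "?\<zeta> \<in> closure ?U" using x0 by (intro b_in_closure) auto
          then have "dist (H w) (H ?\<zeta>) \<le> K * dist w ?\<zeta>" using wc cWU by (intro lipschitz_onD[OF H(2)]) auto
          then show ?thesis using wr H(3) by (simp add: dist_norm)
        qed
        ultimately have "cmod (P w) \<le> K * r * exp (- l / 3)"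
          unfolding normP using K0 rd by (intro mult_mono) auto
        then show ?thesis by simp
      qed
    qed
    also have "max (e1 * r) (K * r * exp (- l / 3)) \<le> e * h / exp 2"
    proof -
      have "e1 * r = e * h / exp 2" using e1(2) unfolding e1(2)[symmetric] r_def by simp
      moreover have "K * r * exp (- l / 3) \<le> e * h / exp 2"
      proof -
        have "K * l^2 * exp (- l / 3) * exp 2 * h \<le> e * h" using l(2) h by (intro mult_right_mono) auto
        then show ?thesis by (simp add: r_def pos_le_divide_eq mult_ac)
      qed
      ultimately show ?thesis by simp
    qed
    finally have Pz: "cmod (P z) \<le> e * h / exp 2" .
    have "l * Re (csqrt (\<omega> z)) \<le> 2"
    proof -
      have "cmod (\<omega> z) \<le> 2 / l^2"
      proof -
        have "cmod (- \<i> * (z - ?\<zeta>) + of_real h) \<le> h + h"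
          by (rule order_trans[OF norm_triangle_ineq]) (use h in \<open>simp add: norm_mult h_def[symmetric]\<close>)
        then have "cmod (\<omega> z) \<le> (h + h) / r" unfolding \<omega>_def using rd by (simp add: norm_divide divide_right_mono)
        then show ?thesis using h l by (simp add: r_def field_simps)
      qed
      then have "sqrt (cmod (\<omega> z)) \<le> sqrt (4 / l^2)"
        using divide_right_mono[of 2 4 "l^2"] by (intro real_sqrt_le_mono) auto
      then have "sqrt (cmod (\<omega> z)) \<le> 2 / l" using l by (simp add: real_sqrt_divide)
      moreover have "Re (csqrt (\<omega> z)) \<le> sqrt (cmod (\<omega> z))" using complex_Re_le_cmod[of "csqrt (\<omega> z)"] by (simp del: csqrt.simps)
      ultimately have "Re (csqrt (\<omega> z)) \<le> 2 / l" by linarith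
      then show ?thesis using l by (simp add: pos_le_divide_eq mult.commute del: csqrt.simps)
    qed
    then have "exp (-2) \<le> exp (- l * Re (csqrt (\<omega> z)))" by (simp del: csqrt.simps)
    then have "cmod (H z) * exp (-2) \<le> cmod (P z)" unfolding normP by (intro mult_left_mono) auto
    then have "cmod (H z) * exp (-2) \<le> e * h / exp 2" using Pz by linarith
    then show "cmod (H z) \<le> e * cmod (z - ?\<zeta>)" by (simp add: exp_minus divide_inverse h_def)
  qed
qed

lemma NT_subset_Om: "z \<in> NT \<kappa> x \<Longrightarrow> 0 < \<kappa> \<Longrightarrow> z \<noteq> b x \<Longrightarrow> z \<in> Om"
proof -
  assume z: "z \<in> NT \<kappa> x" "0 < \<kappa>" "z \<noteq> b x"
  then have "z \<in> ball z (\<kappa> * cmod (z - b x))" by simp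
  then show "z \<in> Om" using z(1) unfolding NT_def by blast
qed

text \<open>Let \<open>c\<close> be the quotient of the derivatives of the primitive and of the curve along the boundary.
  The function \<open>H z = G z - G \<zeta> - c (z - \<zeta>)\<close> is \<open>o(|z - \<zeta>|)\<close> on the boundary, hence in the domain; its
  derivative \<open>f - c\<close> is small at a point whose distance from the boundary is comparable with
  its distance from \<open>\<zeta>\<close>, by Cauchy's inequality on a disc of comparable radius.\<close>
lemma boundary_derivative_imp_limit:
  assumes x0: "\<bar>x0\<bar> < 1/4"
    and f: "f holomorphic_on Om"
    and G: "\<And>z. z \<in> Om \<Longrightarrow> (G has_field_derivative f z) (at z)"
    and G': "C-lipschitz_on (closure {z \<in> Om. Im z < 1/2}) G'" "\<And>z. z \<in> {z \<in> Om. Im z < 1/2} \<Longrightarrow> G' z = G z"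
    and d: "(\<phi> has_real_derivative d) (at x0)" and E: "((\<lambda>x. G' (b x)) has_vector_derivative E) (at x0)"
    and \<kappa>0: "\<kappa>0 > 0"
  shows "(f \<longlongrightarrow> E / Complex 1 d) (at (b x0) within NT \<kappa>0 x0)"
proof -
  let ?U = "{z \<in> Om. Im z < 1/2}" and ?\<zeta> = "b x0"
  have oU: "open ?U"
  proof -
    have "open (Om \<inter> {z. Im z < 1/2})" by (intro open_Int open_Om open_Collect_less continuous_intros)
    moreover have "Om \<inter> {z. Im z < 1/2} = ?U" by blast
    ultimately show ?thesis by simp
  qed
  define c where "c = E / Complex 1 d"
  define H where "H = (\<lambda>z. G' z - G' ?\<zeta> - c * (z - ?\<zeta>))"
  have G'd: "(G' has_field_derivative f z) (at z)" if "z \<in> ?U" for z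
    by (rule has_field_derivative_transform_within_open[OF G oU that]) (use that G'(2) in auto)
  have Hd: "(H has_field_derivative f z - c) (at z)" if "z \<in> ?U" for z
    unfolding H_def by (rule derivative_eq_intros G'd[OF that] refl | simp)+
  have Hh: "H holomorphic_on ?U"
    unfolding holomorphic_on_open[OF oU] using Hd by blast
  have HL: "(C + cmod c)-lipschitz_on (closure ?U) H"
  proof (rule lipschitz_onI)
    fix z w assume zw: "z \<in> closure ?U" "w \<in> closure ?U"
    have "H z - H w = (G' z - G' w) - c * (z - w)" by (simp add: H_def algebra_simps)
    then have "cmod (H z - H w) \<le> cmod (G' z - G' w) + cmod c * cmod (z - w)"
      using norm_triangle_ineq4[of "G' z - G' w" "c * (z - w)"] by (simp add: norm_mult)
    also have "cmod (G' z - G' w) \<le> C * cmod (z - w)" using lipschitz_onD[OF G'(1) zw] by (simp add: dist_norm)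
    finally show "dist (H z) (H w) \<le> (C + cmod c) * dist z w" by (simp add: dist_norm algebra_simps)
  qed (use lipschitz_on_nonneg[OF G'(1)] in auto)
  have bd': "(b has_vector_derivative Complex 1 d) (at x0)"
  proof -
    have "((\<lambda>x. of_real x + \<i> * of_real (\<phi> x)) has_vector_derivative (of_real 1 + \<i> * of_real d)) (at x0)"
      using d by (intro has_vector_derivative_add has_vector_derivative_of_real has_vector_derivative_mult_right)
        (simp_all add: has_real_derivative_iff_has_vector_derivative)
    moreover have "(\<lambda>x. of_real x + \<i> * of_real (\<phi> x)) = b" by (simp add: fun_eq_iff b_def complex_eq_iff)
    moreover have "of_real 1 + \<i> * of_real d = Complex 1 d" by (simp add: complex_eq_iff)
    ultimately show ?thesis by simp
  qed
  have "((\<lambda>x. H (b x)) has_vector_derivative E - c * Complex 1 d) (at x0)"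
    unfolding H_def using has_vector_derivative_diff[OF has_vector_derivative_diff[OF E has_vector_derivative_const[of "G' ?\<zeta>"]]
        has_vector_derivative_mult_right[OF has_vector_derivative_diff[OF bd' has_vector_derivative_const[of ?\<zeta>]], of c]]
    by simp
  then have "((\<lambda>x. H (b x)) has_vector_derivative 0) (at x0)" by (simp add: c_def complex_eq_iff)
  then have "((\<lambda>y. (1 / (y - x0)) *\<^sub>R (H (b y) - H (b x0))) \<longlongrightarrow> 0) (at x0)"
    by (rule has_vector_derivative_quotient)
  then have Hq: "((\<lambda>y. (1 / (y - x0)) *\<^sub>R H (b y)) \<longlongrightarrow> 0) (at x0)" by (simp add: H_def)
  have bd: "\<exists>\<delta>>0. \<forall>x. \<bar>x - x0\<bar> < \<delta> \<longrightarrow> cmod (H (b x)) \<le> e * \<bar>x - x0\<bar>" if e: "e > 0" for e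
  proof -
    from LIM_D[OF Hq e] obtain \<delta> where \<delta>: "\<delta> > 0"
      "\<And>x. x \<noteq> x0 \<and> norm (x - x0) < \<delta> \<Longrightarrow> norm ((1 / (x - x0)) *\<^sub>R H (b x) - 0) < e" by auto
    show ?thesis
    proof (intro exI[of _ \<delta>] conjI \<delta>(1) allI impI)
      fix x assume x: "\<bar>x - x0\<bar> < \<delta>"
      show "cmod (H (b x)) \<le> e * \<bar>x - x0\<bar>"
      proof (cases "x = x0")
        case False
        then have "cmod (H (b x)) / \<bar>x - x0\<bar> < e" using \<delta>(2)[of x] x by simp
        then show ?thesis using False by (simp add: pos_divide_less_eq)
      qed (simp add: H_def)
    qed
  qed
  define \<kappa> where "\<kappa> = min \<kappa>0 (1/2)"
  have \<kappa>: "0 < \<kappa>" "\<kappa> \<le> 1/2" "\<kappa> \<le> \<kappa>0" using \<kappa>0 by (auto simp: \<kappa>_def)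
  show ?thesis
    unfolding c_def[symmetric] tendsto_iff
  proof (intro allI impI)
    fix e :: real assume e: "e > 0"
    define e' where "e' = e * \<kappa> / 6"
    have e': "e' > 0" using e \<kappa> by (simp add: e'_def)
    obtain \<delta> where \<delta>: "\<delta> > 0" "\<And>z. \<phi> (Re z) < Im z \<Longrightarrow> cmod (z - ?\<zeta>) < \<delta> \<Longrightarrow> cmod (H z) \<le> e' * cmod (z - ?\<zeta>)"
      using interior_estimate[OF x0 Hh HL _ bd e'] by (auto simp: H_def)
    have "dist (f z) c < e" if z: "z \<in> NT \<kappa>0 x0" "z \<noteq> ?\<zeta>" "dist z ?\<zeta> < min (\<delta> / 2) (1/16)" for z
    proof -
      define h where "h = cmod (z - ?\<zeta>)"
      have h: "h > 0" "h < \<delta> / 2" "h < 1/16" using z by (auto simp: h_def dist_norm)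
      have \<kappa>h: "\<kappa> * h \<le> (1/2) * h" "\<kappa> * h \<le> \<kappa>0 * h" "\<kappa> * h > 0" using \<kappa> h by (auto intro!: mult_right_mono)
      have near: "w \<in> ?U \<and> cmod (w - ?\<zeta>) \<le> 2 * h" if w: "cmod (z - w) < \<kappa> * h" for w
      proof -
        have "cmod (z - w) < \<kappa>0 * h" using w \<kappa>h(2) by (rule order_less_le_trans)
        then have "w \<in> ball z (\<kappa>0 * h)" by (simp add: dist_norm)
        then have wO: "w \<in> Om" using z(1) by (auto simp: NT_def h_def)
        have le: "cmod (w - ?\<zeta>) \<le> 2 * h"
        proof -
          have "cmod (w - z) < 1/2 * h"
            using order_less_le_trans[OF w \<kappa>h(1)] by (simp add: norm_minus_commute)
          moreover have "cmod (w - ?\<zeta>) \<le> cmod (w - z) + h"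
            using norm_triangle_ineq[of "w - z" "z - ?\<zeta>"] by (simp add: h_def)
          ultimately show ?thesis using h(1) by argo
        qed
        then have "Im w < 1/2" using abs_Im_le_cmod[of "w - ?\<zeta>"] h \<phi>_bound[of x0] x0 by simp
        then show ?thesis using wO le by simp
      qed
      have zU: "z \<in> ?U" using near[of z] \<kappa>h by simp
      have cb: "cball z (\<kappa> * h / 2) \<subseteq> ?U"
        using near \<kappa>h by (auto simp: dist_norm)
      have "norm ((deriv ^^ 1) H z) \<le> fact 1 * (e' * (2 * h)) / (\<kappa> * h / 2) ^ 1"
      proof (rule Cauchy_inequality)
        show "H holomorphic_on ball z (\<kappa> * h / 2)"
          by (rule holomorphic_on_subset[OF Hh]) (use cb ball_subset_cball in blast)
        show "continuous_on (cball z (\<kappa> * h / 2)) H"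
          by (rule holomorphic_on_imp_continuous_on[OF holomorphic_on_subset[OF Hh cb]])
        show "0 < \<kappa> * h / 2" using \<kappa>h by simp
        fix w assume "cmod (z - w) = \<kappa> * h / 2"
        then have w: "w \<in> ?U" "cmod (w - ?\<zeta>) \<le> 2 * h" using near[of w] \<kappa>h by auto
        have "cmod (H w) \<le> e' * cmod (w - ?\<zeta>)" using w h by (intro \<delta>(2)) (auto simp: Om_def)
        also have "\<dots> \<le> e' * (2 * h)" using w e' by (intro mult_left_mono) auto
        finally show "cmod (H w) \<le> e' * (2 * h)" .
      qed
      also have "fact 1 * (e' * (2 * h)) / (\<kappa> * h / 2) ^ 1 = e * (2/3)"
        using \<kappa> h by (simp add: e'_def field_simps)
      also have "(deriv ^^ 1) H z = f z - c" using DERIV_imp_deriv[OF Hd[OF zU]] by simp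
      finally show ?thesis using e by (simp add: dist_norm)
    qed
    then show "\<forall>\<^sub>F z in at ?\<zeta> within NT \<kappa>0 x0. dist (f z) c < e"
      unfolding eventually_at using \<delta>(1) by (intro exI[of _ "min (\<delta> / 2) (1/16)"]) auto
  qed
qed

lemma bounded_holomorphic_limits:
  assumes f: "f holomorphic_on Om" and f1: "\<And>z. z \<in> Om \<Longrightarrow> cmod (f z) \<le> 1"
  shows "negligible {x. \<bar>x\<bar> < 1/4 \<and> \<not> (\<exists>d c. (\<phi> has_real_derivative d) (at x) \<and>
    (\<forall>\<kappa>>0. (f \<longlongrightarrow> c) (at (b x) within NT \<kappa> x)))}"
proof -
  let ?U = "{z \<in> Om. Im z < 1/2}"
  obtain G where G: "\<And>z. z \<in> Om \<Longrightarrow> (G has_field_derivative f z) (at z)" using primitive[OF f] by blast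
  obtain G' where G': "2-lipschitz_on (closure ?U) G'" "\<And>z. z \<in> ?U \<Longrightarrow> G' z = G z"
    using lipschitz_extend_closure[OF primitive_Lipschitz[OF G f1]] by blast
  define cl where "cl = (\<lambda>x :: real. max (-1/4) (min x (1/4)))"
  define B where "B = (\<lambda>x. G' (b (cl x)))"
  have clU: "b (cl x) \<in> closure ?U" for x by (intro b_in_closure) (auto simp: cl_def)
  have "4-lipschitz_on UNIV B"
  proof (rule lipschitz_onI)
    fix x y :: real
    have "dist (B x) (B y) \<le> 2 * dist (b (cl x)) (b (cl y))" unfolding B_def by (rule lipschitz_onD[OF G'(1) clU clU])
    also have "dist (b (cl x)) (b (cl y)) \<le> \<bar>cl x - cl y\<bar> + \<bar>\<phi> (cl x) - \<phi> (cl y)\<bar>"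
      using cmod_le[of "b (cl x) - b (cl y)"] by (simp add: dist_norm)
    also have "\<dots> \<le> 2 * \<bar>cl x - cl y\<bar>" using lip[of "cl x" "cl y"] abs_ge_zero[of "cl x - cl y"] by argo
    also have "\<bar>cl x - cl y\<bar> \<le> \<bar>x - y\<bar>" unfolding cl_def by (auto simp: max_def min_def)
    finally show "dist (B x) (B y) \<le> 4 * dist x y" by (simp add: dist_real_def)
  qed simp
  then have N1: "negligible {x. \<not> (\<exists>D. (B has_vector_derivative D) (at x))}"
    by (rule Lipschitz_complex_differentiable_ae)
  have "(1/8)-lipschitz_on UNIV \<phi>" using lip by (intro lipschitz_onI) (simp_all add: dist_real_def)
  then have N2: "negligible {x. \<not> (\<exists>D. (\<phi> has_real_derivative D) (at x))}"
    by (rule Lipschitz_differentiable_ae)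
  show ?thesis
  proof (rule negligible_subset[OF negligible_Un[OF N1 N2]], rule subsetI, rule ccontr)
    fix x assume x: "x \<in> {x. \<bar>x\<bar> < 1/4 \<and> \<not> (\<exists>d c. (\<phi> has_real_derivative d) (at x) \<and>
        (\<forall>\<kappa>>0. (f \<longlongrightarrow> c) (at (b x) within NT \<kappa> x)))}"
      and nx: "x \<notin> {x. \<not> (\<exists>D. (B has_vector_derivative D) (at x))} \<union> {x. \<not> (\<exists>D. (\<phi> has_real_derivative D) (at x))}"
    then have x4: "\<bar>x\<bar> < 1/4" by blast
    obtain E where E: "(B has_vector_derivative E) (at x)" using nx by blast
    obtain d where d: "(\<phi> has_real_derivative d) (at x)" using nx by blast
    have "((\<lambda>x. G' (b x)) has_vector_derivative E) (at x)"
      by (rule has_vector_derivative_transform_within_open[OF E, of "{-1/4<..<1/4}"]) (use x4 in \<open>auto simp: B_def cl_def\<close>)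
    from boundary_derivative_imp_limit[OF x4 f G G' d this]
    have "\<forall>\<kappa>>0. (f \<longlongrightarrow> E / Complex 1 d) (at (b x) within NT \<kappa> x)" by blast
    then show False using x d by blast
  qed
qed

end

context lipschitz_graph
begin

lemma negligible_if_AE_lborel:
  assumes "AE x in lborel. P x" shows "negligible {x :: real. \<not> P x}"
proof -
  from assms obtain N where "N \<in> null_sets lborel" "{x. \<not> P x} \<subseteq> N" by (auto simp: eventually_ae_filter)
  then have "negligible N" unfolding negligible_iff_null_sets by (blast intro: null_sets_completionI)
  then show ?thesis using \<open>{x. \<not> P x} \<subseteq> N\<close> by (rule negligible_subset)
qed

lemma Re_csqrt_right_half_plane:
  assumes "0 \<le> Re z"
  shows "\<bar>Im (csqrt z)\<bar> \<le> Re (csqrt z)" and "sqrt (cmod z / 2) \<le> Re (csqrt z)"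
proof -
  have "\<bar>Im (csqrt z)\<bar> \<le> sqrt ((cmod z - Re z) / 2)" using complex_Re_le_cmod[of z] by (simp add: abs_mult)
  also have "\<dots> \<le> sqrt ((cmod z + Re z) / 2)" using assms by (intro real_sqrt_le_mono) simp
  finally show "\<bar>Im (csqrt z)\<bar> \<le> Re (csqrt z)" by simp
  have "sqrt (cmod z / 2) \<le> sqrt ((cmod z + Re z) / 2)" using assms by (intro real_sqrt_le_mono) simp
  then show "sqrt (cmod z / 2) \<le> Re (csqrt z)" by simp
qed

text \<open>The function \<open>sqrt f\<close> has values in the sector \<open>|Im| \<le> Re\<close>, so the real part of a primitive \<open>Q\<close> increases
  along segments of slope at most three quarters, at a rate of at least a quarter of the real part of \<open>sqrt f\<close>.
  Joining the raised graphs to a fixed compact segment by such segments bounds \<open>Re Q\<close> on them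
  uniformly, so the mean difference quotients of \<open>Re Q\<close> along the raised graphs are bounded. At a point where \<open>f\<close> is
  infinite these quotients tend to infinity, and Fatou's lemma applies.\<close>
lemma not_infinite_ae:
  assumes f: "f holomorphic_on Om" and f1: "\<And>z. z \<in> Om \<Longrightarrow> 1 \<le> Re (f z)"
  shows "negligible {x. \<bar>x\<bar> < 1/8 \<and> ((\<lambda>z. 1 / f z) \<longlongrightarrow> 0) (at (b x) within NT (1/8) x)}"
proof -
  have qh: "(\<lambda>z. csqrt (f z)) holomorphic_on Om"
    using f1 by (intro holomorphic_intros f) (fastforce simp: complex_nonpos_Reals_iff)
  obtain Q where Q: "\<And>z. z \<in> Om \<Longrightarrow> (Q has_field_derivative csqrt (f z)) (at z)" using primitive[OF qh] by blast
  \<comment> \<open>Along segments of slope at most three quarters the real part of the primitive increases.\<close>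
  have incr: "(Re w - Re z) * m / 4 \<le> Re (Q w) - Re (Q z)"
    if seg: "closed_segment z w \<subseteq> Om" and slope: "\<bar>Im w - Im z\<bar> \<le> 3/4 * (Re w - Re z)"
      and m: "\<And>u. u \<in> closed_segment z w \<Longrightarrow> m \<le> Re (csqrt (f u))" for z w m
  proof -
    obtain u where u: "u \<in> closed_segment z w" "Re (Q w) - Re (Q z) = Re (csqrt (f u) * (w - z))"
      using complex_mvt_line[of z w Q "\<lambda>u. csqrt (f u)"] Q seg by blast
    define p where "p = csqrt (f u)"
    have p: "\<bar>Im p\<bar> \<le> Re p" "m \<le> Re p"
      using Re_csqrt_right_half_plane(1)[of "f u"] f1[of u] u(1) seg m[OF u(1)] unfolding p_def by fastforce+
    have r: "0 \<le> Re w - Re z" using slope abs_ge_zero[of "Im w - Im z"] by argo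
    have "Im p * (Im w - Im z) \<le> \<bar>Im p\<bar> * \<bar>Im w - Im z\<bar>" by (metis abs_ge_self abs_mult)
    also have "\<dots> \<le> Re p * (3/4 * (Re w - Re z))" using p slope by (intro mult_mono) auto
    finally have "Re p * (Re w - Re z) - Re p * (3/4 * (Re w - Re z)) \<le> Re (p * (w - z))" by simp
    moreover have "Re p * (Re w - Re z) - Re p * (3/4 * (Re w - Re z)) = Re p * (Re w - Re z) / 4" by (simp add: field_simps)
    moreover have "m * (Re w - Re z) \<le> Re p * (Re w - Re z)" using p r by (intro mult_right_mono) auto
    moreover have "Re (Q w) - Re (Q z) = Re (p * (w - z))" unfolding p_def by (rule u(2))
    moreover have "(Re w - Re z) * m = m * (Re w - Re z)" by (rule mult.commute)
    ultimately show ?thesis by argo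
  qed
  have incr0: "Re (Q z) \<le> Re (Q w)"
    if "closed_segment z w \<subseteq> Om" "\<bar>Im w - Im z\<bar> \<le> 3/4 * (Re w - Re z)" for z w
  proof -
    have "(Re w - Re z) * 0 / 4 \<le> Re (Q w) - Re (Q z)" by (rule incr[OF that Re_csqrt])
    then show ?thesis by simp
  qed
  define \<beta> where "\<beta> = (\<lambda>h x. Complex x (\<phi> x + h))"
  define S where "S = (\<lambda>h x. Re (Q (\<beta> h x)))"
  have \<beta>Om: "\<beta> h x \<in> Om" if "0 < h" "h \<le> 1/32" "\<bar>x\<bar> \<le> 1/4" for h x
  proof -
    have "\<phi> x + h < 1" "\<bar>x\<bar> < 1" using \<phi>_bound[of x] that by argo+
    then show ?thesis using that by (simp add: \<beta>_def Om_def)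
  qed
  define T where "T = {z. Im z = 1/4 \<and> \<bar>Re z\<bar> \<le> 3/4}"
  have TOm: "T \<subseteq> Om"
  proof
    fix z assume "z \<in> T"
    then have "Im z = 1/4" "\<bar>Re z\<bar> \<le> 3/4" by (auto simp: T_def)
    moreover have "\<phi> (Re z) < 1/4" using \<phi>_bound[of "Re z"] \<open>\<bar>Re z\<bar> \<le> 3/4\<close> by argo
    ultimately show "z \<in> Om" by (simp add: Om_def)
  qed
  have "compact T"
  proof (rule compact_eq_bounded_closed[THEN iffD2], rule conjI)
    have "T \<subseteq> cball 0 1"
    proof
      fix z assume "z \<in> T"
      then have "cmod z \<le> 1" using cmod_le[of z] by (auto simp: T_def)
      then show "z \<in> cball 0 1" by simp
    qed
    then show "bounded T" using bounded_subset bounded_cball by blast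
    show "closed T" unfolding T_def by (intro closed_Collect_conj closed_Collect_eq closed_Collect_le continuous_intros)
  qed
  moreover have contQ: "continuous_on Om Q"
    using Q by (intro continuous_at_imp_continuous_on ballI) (blast intro: DERIV_isCont)
  ultimately have "compact (Q ` T)" using TOm by (intro compact_continuous_image) (auto intro: continuous_on_subset)
  then have "bounded (Q ` T)" by (rule compact_imp_bounded)
  then obtain M where M: "\<And>z. z \<in> T \<Longrightarrow> cmod (Q z) \<le> M" by (auto simp: bounded_iff)
  have Sb: "\<bar>S h x\<bar> \<le> M" if h: "0 < h" "h \<le> 1/32" and x: "\<bar>x\<bar> \<le> 1/4" for h x
  proof -
    define t where "t = (1/4 - (\<phi> x + h)) * (4/3)"
    have t: "0 \<le> t" "t \<le> 1/2" using \<phi>_bound[of x] h x unfolding t_def by argo+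
    define p1 p2 where "p1 = Complex (x - t) (1/4)" and "p2 = Complex (x + t) (1/4)"
    have pT: "p1 \<in> T" "p2 \<in> T" using t x unfolding p1_def p2_def T_def mem_Collect_eq complex.sel by argo+
    have im: "1/4 - (\<phi> x + h) = 3/4 * t" by (simp add: t_def)
    have \<beta>: "Re (\<beta> h x) = x" "Im (\<beta> h x) = \<phi> x + h" by (simp_all add: \<beta>_def)
    have pO: "p1 \<in> Om" "p2 \<in> Om" using pT TOm by blast+
    have "\<bar>Re (\<beta> h x) - Re p1\<bar> / 8 \<le> \<bar>Im (\<beta> h x) - Im p1\<bar>" "\<bar>Re p2 - Re (\<beta> h x)\<bar> / 8 \<le> \<bar>Im p2 - Im (\<beta> h x)\<bar>"
      using im t unfolding \<beta> p1_def p2_def complex.sel by argo+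
    then have "closed_segment p1 (\<beta> h x) \<subseteq> Om" "closed_segment (\<beta> h x) p2 \<subseteq> Om"
      using steep_segment[OF pO(1) \<beta>Om[OF h x]] steep_segment[OF \<beta>Om[OF h x] pO(2)] by blast+
    moreover have "\<bar>Im (\<beta> h x) - Im p1\<bar> \<le> 3/4 * (Re (\<beta> h x) - Re p1)" "\<bar>Im p2 - Im (\<beta> h x)\<bar> \<le> 3/4 * (Re p2 - Re (\<beta> h x))"
      using im t unfolding \<beta> p1_def p2_def complex.sel by argo+
    ultimately have "Re (Q p1) \<le> S h x" "S h x \<le> Re (Q p2)" unfolding S_def by (blast intro: incr0)+
    moreover have "\<bar>Re (Q p1)\<bar> \<le> M" "\<bar>Re (Q p2)\<bar> \<le> M"
      using M[OF pT(1)] M[OF pT(2)] abs_Re_le_cmod order_trans by blast+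
    ultimately show ?thesis by argo
  qed
  \<comment> \<open>The segment joining two neighbouring points of the raised graph is nontangential.\<close>
  have near: "u \<in> NT (1/8) x \<and> u \<noteq> b x \<and> cmod (u - b x) \<le> 3 * h \<and> u \<in> Om"
    if h: "0 < h" "h \<le> 1/32" and x: "\<bar>x\<bar> \<le> 1/8" and u: "u \<in> closed_segment (\<beta> h x) (\<beta> h (x + h))" for h x u
  proof -
    obtain s where s: "0 \<le> s" "s \<le> 1" "Re u = x + s * h" "Im u = \<phi> x + h + s * (\<phi> (x + h) - \<phi> x)"
      using closed_segment_coordinates[OF u] by (auto simp: \<beta>_def)
    define t where "t = s * (\<phi> (x + h) - \<phi> x)"
    have "\<bar>t\<bar> = s * \<bar>\<phi> (x + h) - \<phi> x\<bar>" using s by (simp add: t_def abs_mult)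
    also have "\<dots> \<le> 1 * (h / 8)" using s h lip[of "x + h" x] by (intro mult_mono) auto
    finally have t: "\<bar>t\<bar> \<le> h / 8" by simp
    have sh: "0 \<le> s * h" "s * h \<le> h" using s h by (auto simp: mult_left_le_one_le)
    have Imu: "Im u = \<phi> x + h + t" by (simp add: s(4) t_def)
    have nb: "cmod (u - b x) \<le> 9/4 * h"
    proof -
      have "cmod (u - b x) \<le> \<bar>Re (u - b x)\<bar> + \<bar>Im (u - b x)\<bar>" by (rule cmod_le)
      also have "\<dots> = \<bar>s * h\<bar> + \<bar>h + t\<bar>" by (simp add: s(3) Imu)
      also have "\<dots> \<le> 9/4 * h" using sh t h by argo
      finally show ?thesis .
    qed
    have "ball u (1/8 * cmod (u - b x)) \<subseteq> Om"
    proof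
      fix w assume "w \<in> ball u (1/8 * cmod (u - b x))"
      then have w: "cmod (w - u) < 9/32 * h" using nb by (simp add: dist_norm norm_minus_commute)
      have w1: "\<bar>Re w - Re u\<bar> < 9/32 * h" "\<bar>Im w - Im u\<bar> < 9/32 * h"
        using abs_Re_le_cmod[of "w - u"] abs_Im_le_cmod[of "w - u"] w by auto
      have w2: "\<bar>Re w - x\<bar> \<le> 41/32 * h" using w1 s(3) sh by argo
      have "\<phi> (Re w) \<le> \<phi> x + \<bar>x - Re w\<bar> / 8" by (rule \<phi>_le)
      then have "\<phi> (Re w) < Im w" using w1 w2 Imu t h abs_minus_commute[of x "Re w"] by argo
      moreover have "\<bar>Re w\<bar> < 1" using w2 x h by argo
      moreover have "Im w < 1" using w1 Imu t h \<phi>_bound[of x] x by argo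
      ultimately show "w \<in> Om" by (simp add: Om_def)
    qed
    then have nt: "u \<in> NT (1/8) x" by (simp add: NT_def)
    have "Im u \<noteq> \<phi> x" using Imu t h by argo
    then have ne: "u \<noteq> b x" by auto
    have "cmod (u - b x) \<le> 3 * h" using nb h by argo
    then show ?thesis using nt ne NT_subset_Om[OF nt _ ne] by simp
  qed
  have slope: "\<bar>Im (\<beta> h (x + h)) - Im (\<beta> h x)\<bar> \<le> 3/4 * (Re (\<beta> h (x + h)) - Re (\<beta> h x))" if "0 < h" for h x
    using lip[of "x + h" x] that unfolding \<beta>_def complex.sel by argo
  define h where "h = (\<lambda>n. 1 / (real n + 32))"
  have h: "0 < h n" "h n \<le> 1/32" for n by (auto simp: h_def field_simps)
  have hlim: "h \<longlonglongrightarrow> 0" unfolding h_def by real_asymp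
  define k where "k = (\<lambda>n x. (S (h n) (x + h n) - S (h n) x) / h n)"
  have kge: "m / 4 \<le> k n x" if x: "\<bar>x\<bar> \<le> 1/8"
    and m: "\<And>u. u \<in> closed_segment (\<beta> (h n) x) (\<beta> (h n) (x + h n)) \<Longrightarrow> m \<le> Re (csqrt (f u))" for m n x
  proof -
    have "(Re (\<beta> (h n) (x + h n)) - Re (\<beta> (h n) x)) * m / 4 \<le> Re (Q (\<beta> (h n) (x + h n))) - Re (Q (\<beta> (h n) x))"
      by (rule incr[OF _ slope[OF h(1)] m]) (use near[OF h x] in blast)
    then have "h n * m / 4 \<le> S (h n) (x + h n) - S (h n) x" by (simp add: S_def \<beta>_def)
    then show ?thesis using h(1)[of n] by (simp add: k_def field_simps)
  qed
  have k0: "0 \<le> k n x" if "\<bar>x\<bar> \<le> 1/8" for n x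
  proof -
    have "0 / 4 \<le> k n x" by (rule kge[OF that Re_csqrt])
    then show ?thesis by simp
  qed
  have contS: "continuous_on {-1/4..1/4} (S (h n))" for n
  proof -
    have "continuous_on {-1/4..1/4} (\<beta> (h n))"
      unfolding \<beta>_def by (intro continuous_on_Complex continuous_intros \<phi>_continuous)
    moreover have "\<beta> (h n) ` {-1/4..1/4} \<subseteq> Om" using \<beta>Om[OF h] by auto
    ultimately show ?thesis unfolding S_def
      by (intro continuous_on_Re continuous_on_compose2[OF contQ])
  qed
  define kk where "kk = (\<lambda>n x. ennreal (k n x) * indicator {-1/8..1/8} x)"
  have contk: "continuous_on {-1/8..1/8} (k n)" for n
  proof -
    have "continuous_on {-1/8..1/8} (\<lambda>x. S (h n) (x + h n))"
      by (rule continuous_on_compose2[OF contS]) (use h[of n] in \<open>auto intro!: continuous_intros\<close>)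
    moreover have "continuous_on {-1/8..1/8} (S (h n))" by (rule continuous_on_subset[OF contS]) auto
    ultimately show ?thesis unfolding k_def using h(1)[of n] by (intro continuous_intros) auto
  qed
  have kkm: "kk n \<in> borel_measurable lborel" for n
  proof -
    have "(\<lambda>x. indicator {-1/8..1/8} x *\<^sub>R k n x) \<in> borel_measurable borel"
      by (rule borel_measurable_continuous_on_indicator[OF _ contk]) simp
    then have "(\<lambda>x. indicator {-1/8..1/8} x * k n x) \<in> borel_measurable lborel" by simp
    then have "(\<lambda>x. ennreal (indicator {-1/8..1/8} x * k n x)) \<in> borel_measurable lborel"
      by (rule measurable_compose[OF _ measurable_ennreal])
    moreover have "(\<lambda>x. ennreal (indicator {-1/8..1/8} x * k n x)) = kk n"
      by (simp add: kk_def fun_eq_iff indicator_def)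
    ultimately show ?thesis by simp
  qed
  have kint: "(\<integral>\<^sup>+x. kk n x \<partial>lborel) \<le> ennreal (2 * M)" for n
  proof -
    obtain T where T: "\<And>x. x \<in> {-1/4..1/4} \<Longrightarrow> (T has_vector_derivative S (h n) x) (at x within {-1/4..1/4})"
      using antiderivative_continuous[OF contS[of n]] by blast
    have T': "(T has_real_derivative S (h n) x) (at x)" if "x \<in> {-1/4<..<1/4}" for x
      using T[of x] that at_within_Icc_at[of "-1/4" x "1/4"] by (auto simp: has_real_derivative_iff_has_vector_derivative)
    define I where "I = ((T (1/8 + h n) - T (1/8)) - (T (-1/8 + h n) - T (-1/8))) / h n"
    have "((\<lambda>x. k n x) has_integral (T (1/8 + h n) - T (1/8)) / h n - (T (-1/8 + h n) - T (-1/8)) / h n) {-1/8..1/8}"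
    proof (rule fundamental_theorem_of_calculus)
      fix x :: real assume x: "x \<in> {-1/8..1/8}"
      have "((\<lambda>x. T (x + h n)) has_real_derivative S (h n) (x + h n)) (at x)"
        using T'[of "x + h n"] x h[of n] by (intro DERIV_shift[THEN iffD1]) (auto simp: add.commute)
      moreover have "(T has_real_derivative S (h n) x) (at x)" using T'[of x] x by auto
      ultimately have "((\<lambda>x. (T (x + h n) - T x) / h n) has_real_derivative k n x) (at x)"
        unfolding k_def by (intro DERIV_cdivide DERIV_diff)
      then show "((\<lambda>x. (T (x + h n) - T x) / h n) has_vector_derivative k n x) (at x within {-1/8..1/8})"
        by (simp add: has_real_derivative_iff_has_vector_derivative has_vector_derivative_at_within)
    qed simp
    then have I: "(k n has_integral I) {-1/8..1/8}" by (simp add: I_def diff_divide_distrib)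
    have mv: "\<bar>T (x + h n) - T x\<bar> \<le> M * h n" if x: "\<bar>x\<bar> \<le> 1/8" for x
    proof -
      have "\<exists>z>x. z < x + h n \<and> T (x + h n) - T x = (x + h n - x) * S (h n) z"
        using h[of n] x by (intro MVT2 T') auto
      then obtain z where z: "x < z" "z < x + h n" "T (x + h n) - T x = h n * S (h n) z" by auto
      have "\<bar>S (h n) z\<bar> \<le> M" using z x h[of n] by (intro Sb) auto
      then show ?thesis using z(3) h(1)[of n] by (simp add: abs_mult)
    qed
    have "I \<le> 2 * M"
    proof -
      have "(T (1/8 + h n) - T (1/8)) - (T (-1/8 + h n) - T (-1/8)) \<le> 2 * (M * h n)"
        using add_mono[OF abs_le_D1[OF mv[of "1/8"]] abs_le_D2[OF mv[of "-1/8"]]] by simp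
      then show ?thesis using h(1)[of n] by (simp add: I_def pos_divide_le_eq)
    qed
    moreover have "(\<integral>\<^sup>+x. kk n x \<partial>lborel) = ennreal I"
      unfolding kk_def
    proof (rule nn_integral_has_integral_lebesgue'[OF _ I])
      show "0 \<le> k n x" if "x \<in> {-1/8..1/8}" for x using that by (intro k0) auto
    qed
    ultimately show ?thesis by (simp add: ennreal_leI)
  qed
  have "(\<integral>\<^sup>+x. liminf (\<lambda>n. kk n x) \<partial>lborel) \<le> liminf (\<lambda>n. \<integral>\<^sup>+x. kk n x \<partial>lborel)"
    by (rule nn_integral_liminf[OF kkm])
  also have "\<dots> \<le> ennreal (2 * M)"
    by (rule Liminf_le) (simp_all add: kint)
  also have "\<dots> < \<infinity>" by simp
  finally have "(\<integral>\<^sup>+x. liminf (\<lambda>n. kk n x) \<partial>lborel) \<noteq> \<infinity>" by simp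
  then have "AE x in lborel. liminf (\<lambda>n. kk n x) \<noteq> \<infinity>"
    by (intro nn_integral_PInf_AE borel_measurable_liminf kkm)
  then have neg: "negligible {x. \<not> liminf (\<lambda>n. kk n x) \<noteq> \<infinity>}" by (rule negligible_if_AE_lborel)
  show ?thesis
  proof (rule negligible_subset[OF neg], rule subsetI)
    fix x assume "x \<in> {x. \<bar>x\<bar> < 1/8 \<and> ((\<lambda>z. 1 / f z) \<longlongrightarrow> 0) (at (b x) within NT (1/8) x)}"
    then have x: "\<bar>x\<bar> < 1/8" and lim: "((\<lambda>z. 1 / f z) \<longlongrightarrow> 0) (at (b x) within NT (1/8) x)" by auto
    have ev: "\<forall>\<^sub>F n in sequentially. ennreal m \<le> kk n x" if m: "m > 0" for m
    proof -
      define e where "e = 1 / (2 * (4 * m)^2)"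
      have e: "e > 0" using m by (simp add: e_def)
      have "\<forall>\<^sub>F z in at (b x) within NT (1/8) x. dist (1 / f z) 0 < e" using lim e by (rule tendstoD)
      then obtain \<delta> where \<delta>: "\<delta> > 0" "\<And>z. z \<in> NT (1/8) x \<Longrightarrow> z \<noteq> b x \<Longrightarrow> dist z (b x) < \<delta> \<Longrightarrow> dist (1 / f z) 0 < e"
        unfolding eventually_at by blast
      have "\<forall>\<^sub>F n in sequentially. h n < \<delta> / 4" using hlim \<delta>(1) by (intro order_tendstoD) auto
      then show ?thesis
      proof eventually_elim
        case (elim n)
        have "4 * m \<le> Re (csqrt (f u))" if u: "u \<in> closed_segment (\<beta> (h n) x) (\<beta> (h n) (x + h n))" for u
        proof -
          have nu: "u \<in> NT (1/8) x" "u \<noteq> b x" "cmod (u - b x) \<le> 3 * h n" "u \<in> Om" using near[OF h _ u] x by auto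
          then have "dist u (b x) < \<delta>" using elim h(1)[of n] unfolding dist_norm by argo
          then have lt: "1 / cmod (f u) < e" using \<delta>(2)[OF nu(1,2)] by (simp add: norm_divide)
          have fu: "1 \<le> Re (f u)" "0 < cmod (f u)" using f1[OF nu(4)] complex_Re_le_cmod[of "f u"] by argo+
          have "1 / e < cmod (f u)" using lt e fu by (simp add: field_simps)
          then have "(4 * m)^2 \<le> cmod (f u) / 2" by (simp add: e_def)
          then have "sqrt ((4 * m)^2) \<le> sqrt (cmod (f u) / 2)" by (rule real_sqrt_le_mono)
          then have "4 * m \<le> sqrt (cmod (f u) / 2)" using m by (simp only: real_sqrt_abs)
          also have "\<dots> \<le> Re (csqrt (f u))" using fu(1) by (intro Re_csqrt_right_half_plane(2)) simp
          finally show ?thesis .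
        qed
        then have "4 * m / 4 \<le> k n x" using x by (intro kge) auto
        moreover have "x \<in> {-1/8..1/8}" using x unfolding atLeastAtMost_iff by argo
        ultimately show ?case by (simp add: kk_def ennreal_leI)
      qed
    qed
    have "ennreal m \<le> liminf (\<lambda>n. kk n x)" if "m > 0" for m
      by (rule Liminf_bounded[OF ev[OF that]])
    then have "ennreal (real j) \<le> liminf (\<lambda>n. kk n x)" for j
      by (cases "j = 0") auto
    then have "of_nat j \<le> liminf (\<lambda>n. kk n x)" for j by (simp add: ennreal_of_nat_eq_real_of_nat)
    then have "liminf (\<lambda>n. kk n x) = \<infinity>"
      by (metis ennreal_Ex_less_of_nat infinity_ennreal_def less_top linorder_not_less)
    then show "x \<in> {x. \<not> liminf (\<lambda>n. kk n x) \<noteq> \<infinity>}" by simp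
  qed
qed

text \<open>The two preceding results are applied to the bounded function \<open>1 / f\<close> and to \<open>f\<close>.\<close>
theorem limits_of_functions_with_positive_real_part:
  assumes f: "f holomorphic_on Om" and f1: "\<And>z. z \<in> Om \<Longrightarrow> 1 \<le> Re (f z)"
  shows "negligible {x. \<bar>x\<bar> < 1/8 \<and> \<not> (\<exists>d c. (\<phi> has_real_derivative d) (at x) \<and>
    (\<forall>\<kappa>>0. (f \<longlongrightarrow> c) (at (b x) within NT \<kappa> x)))}"
proof -
  have f0: "f z \<noteq> 0" if "z \<in> Om" for z using f1[OF that] by auto
  have gh: "(\<lambda>z. 1 / f z) holomorphic_on Om" using f0 by (intro holomorphic_intros f) auto
  have g1: "cmod (1 / f z) \<le> 1" if "z \<in> Om" for z
    using order_trans[OF f1[OF that] complex_Re_le_cmod[of "f z"]] by (simp add: norm_divide divide_le_eq_1)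
  have N1: "negligible {x. \<bar>x\<bar> < 1/4 \<and> \<not> (\<exists>d c. (\<phi> has_real_derivative d) (at x) \<and>
        (\<forall>\<kappa>>0. ((\<lambda>z. 1 / f z) \<longlongrightarrow> c) (at (b x) within NT \<kappa> x)))}"
    by (rule bounded_holomorphic_limits[OF gh]) (rule g1)
  have N2: "negligible {x. \<bar>x\<bar> < 1/8 \<and> ((\<lambda>z. 1 / f z) \<longlongrightarrow> 0) (at (b x) within NT (1/8) x)}"
    by (rule not_infinite_ae[OF f]) (rule f1)
  show ?thesis
  proof (rule negligible_subset[OF negligible_Un[OF N1 N2]], rule subsetI, rule ccontr)
    fix x assume x: "x \<in> {x. \<bar>x\<bar> < 1/8 \<and> \<not> (\<exists>d c. (\<phi> has_real_derivative d) (at x) \<and>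
        (\<forall>\<kappa>>0. (f \<longlongrightarrow> c) (at (b x) within NT \<kappa> x)))}"
      and nx: "x \<notin> {x. \<bar>x\<bar> < 1/4 \<and> \<not> (\<exists>d c. (\<phi> has_real_derivative d) (at x) \<and>
        (\<forall>\<kappa>>0. ((\<lambda>z. 1 / f z) \<longlongrightarrow> c) (at (b x) within NT \<kappa> x)))} \<union>
        {x. \<bar>x\<bar> < 1/8 \<and> ((\<lambda>z. 1 / f z) \<longlongrightarrow> 0) (at (b x) within NT (1/8) x)}"
    have x8: "\<bar>x\<bar> < 1/8" "\<bar>x\<bar> < 1/4" using x by auto
    obtain d c where dc: "(\<phi> has_real_derivative d) (at x)"
      "\<And>\<kappa>. \<kappa> > 0 \<Longrightarrow> ((\<lambda>z. 1 / f z) \<longlongrightarrow> c) (at (b x) within NT \<kappa> x)" using nx x8 by blast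
    have "c \<noteq> 0" using dc(2)[of "1/8"] nx x8 by auto
    have "(f \<longlongrightarrow> 1 / c) (at (b x) within NT \<kappa> x)" if "\<kappa> > 0" for \<kappa>
      using tendsto_divide[OF tendsto_const[of 1] dc(2)[OF that] \<open>c \<noteq> 0\<close>] by simp
    then show False using x dc(1) by blast
  qed
qed

end

section \<open>Tangents, sectors and inner normals\<close>

text \<open>A sector described by an inequality between a linear and a convex function instead of an
  argument; convexity is visible in this form.\<close>
definition normal_cone :: "complex \<Rightarrow> complex \<Rightarrow> real \<Rightarrow> real \<Rightarrow> complex set" where
  "normal_cone \<zeta> n c r = {z. c * cmod (z - \<zeta>) < Re ((z - \<zeta>) / n) \<and> cmod (z - \<zeta>) < r}"

lemma abs_Arg_less_iff:
  assumes "w \<noteq> 0" "0 < \<alpha>" "\<alpha> \<le> pi"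
  shows "\<bar>Arg w\<bar> < \<alpha> \<longleftrightarrow> cos \<alpha> * cmod w < Re w"
proof -
  have "Re w = Re (rcis (cmod w) (Arg w))" by (simp only: rcis_cmod_Arg)
  then have "Re w = cmod w * cos \<bar>Arg w\<bar>" by simp
  then have "cos \<alpha> * cmod w < Re w \<longleftrightarrow> cos \<alpha> < cos \<bar>Arg w\<bar>" using assms(1) by (simp add: mult.commute)
  also have "\<dots> \<longleftrightarrow> \<bar>Arg w\<bar> < \<alpha>"
    using assms Arg_bounded[of w] by (intro cos_mono_less_eq) auto
  finally show ?thesis by simp
qed

lemma sector_eq_cone:
  assumes "cmod n = 1" "0 < \<alpha>" "\<alpha> < pi / 2"
  shows "sector \<zeta> n \<alpha> r = normal_cone \<zeta> n (cos \<alpha>) r"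
proof (rule set_eqI)
  fix z
  have n: "n \<noteq> 0" "cmod ((z - \<zeta>) / n) = cmod (z - \<zeta>)" using assms(1) by (auto simp: norm_divide)
  show "z \<in> sector \<zeta> n \<alpha> r \<longleftrightarrow> z \<in> normal_cone \<zeta> n (cos \<alpha>) r"
  proof (cases "z = \<zeta>")
    case False
    then have "(z - \<zeta>) / n \<noteq> 0" using n by simp
    then show ?thesis using abs_Arg_less_iff[of "(z - \<zeta>) / n" \<alpha>] assms n False
      by (auto simp: sector_def normal_cone_def)
  qed (simp add: sector_def normal_cone_def)
qed

lemma convex_cone:
  assumes "0 \<le> c" shows "convex (normal_cone \<zeta> n c r)"
proof (rule convexI)
  fix x y and u v :: real assume xy: "x \<in> normal_cone \<zeta> n c r" "y \<in> normal_cone \<zeta> n c r" and uv: "0 \<le> u" "0 \<le> v" "u + v = 1"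
  let ?z = "u *\<^sub>R x + v *\<^sub>R y"
  have eq: "?z - \<zeta> = u *\<^sub>R (x - \<zeta>) + v *\<^sub>R (y - \<zeta>)"
    using uv(3) by (simp add: algebra_simps flip: scaleR_add_left)
  have le: "cmod (?z - \<zeta>) \<le> u * cmod (x - \<zeta>) + v * cmod (y - \<zeta>)"
    unfolding eq using norm_triangle_ineq[of "u *\<^sub>R (x - \<zeta>)" "v *\<^sub>R (y - \<zeta>)"] uv by simp
  have conv: "u * a + v * b < u * a' + v * b'" if "a < a'" "b < b'" for a b a' b' :: real
  proof (cases "u = 0")
    case True
    then show ?thesis using uv that by simp
  next
    case False
    then have "u * a < u * a'" using that uv by simp
    moreover have "v * b \<le> v * b'" using that uv by (intro mult_left_mono) auto
    ultimately show ?thesis by simp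
  qed
  have "c * cmod (?z - \<zeta>) \<le> c * (u * cmod (x - \<zeta>) + v * cmod (y - \<zeta>))" using le assms by (rule mult_left_mono)
  also have "\<dots> = u * (c * cmod (x - \<zeta>)) + v * (c * cmod (y - \<zeta>))" by (simp add: algebra_simps)
  also have "\<dots> < u * Re ((x - \<zeta>) / n) + v * Re ((y - \<zeta>) / n)" using xy by (intro conv) (auto simp: normal_cone_def)
  also have "\<dots> = Re ((?z - \<zeta>) / n)"
  proof -
    have "(?z - \<zeta>) / n = u *\<^sub>R ((x - \<zeta>) / n) + v *\<^sub>R ((y - \<zeta>) / n)"
      unfolding eq by (simp add: add_divide_distrib scaleR_conv_of_real)
    then show ?thesis by simp
  qed
  finally have 1: "c * cmod (?z - \<zeta>) < Re ((?z - \<zeta>) / n)" .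
  have "cmod (?z - \<zeta>) < u * r + v * r"
    using le conv[of "cmod (x - \<zeta>)" r "cmod (y - \<zeta>)" r] xy by (auto simp: normal_cone_def)
  also have "u * r + v * r = r" using uv(3) by (simp flip: distrib_right)
  finally show "?z \<in> normal_cone \<zeta> n c r" using 1 by (simp add: normal_cone_def)
qed

text \<open>All chords that end near \<open>\<zeta>\<close> come from parameters near that of \<open>\<zeta>\<close>, by compactness and
  because the curve is simple; so the limits of the chord directions confine the whole curve near
  \<open>\<zeta>\<close> to a thin double cone around the tangent, and both halves of this cone are visited.\<close>
lemma tangent_direction_props:
  assumes "jordan_curve \<gamma>" "tangent_direction \<gamma> \<zeta> \<tau>"
  shows tangent_norm: "cmod \<tau> = 1" and tangent_in_path: "\<zeta> \<in> path_image \<gamma>"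
    and tangent_cone: "e > 0 \<Longrightarrow> \<exists>d>0. \<forall>z\<in>path_image \<gamma>. cmod (z - \<zeta>) < d \<longrightarrow> \<bar>Im ((z - \<zeta>) / \<tau>)\<bar> \<le> e * cmod (z - \<zeta>)"
    and tangent_sides: "d > 0 \<Longrightarrow> \<exists>z1\<in>path_image \<gamma>. \<exists>z2\<in>path_image \<gamma>. z1 \<noteq> \<zeta> \<and> z2 \<noteq> \<zeta> \<and> cmod (z1 - \<zeta>) < d \<and> cmod (z2 - \<zeta>) < d \<and>
        0 < Re ((z1 - \<zeta>) / \<tau>) \<and> Re ((z2 - \<zeta>) / \<tau>) < 0"
    and tangent_unique: "tangent_direction \<gamma> \<zeta> \<tau>' \<Longrightarrow> \<tau>' = \<tau>"
    and tangent_connected: "connected (path_image \<gamma> - {\<zeta>})"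
proof -
  have simple: "simple_path \<gamma>" and closed: "\<gamma> 1 = \<gamma> 0" "pathfinish \<gamma> = pathstart \<gamma>"
    using assms(1) by (auto simp: jordan_curve_def pathfinish_def pathstart_def)
  have eqD: "s = t \<or> s = 0 \<and> t = 1 \<or> s = 1 \<and> t = 0" if "s \<in> {0..1}" "t \<in> {0..1}" "\<gamma> s = \<gamma> t" for s t
    using simple that unfolding simple_path_def loop_free_def by blast
  have path: "continuous_on {0..1} \<gamma>" using simple simple_path_def path_def by blast
  obtain t where t: "t \<in> {0..<1}" "\<gamma> t = \<zeta>"
    and R: "((\<lambda>s. sgn (\<gamma> (frac s) - \<zeta>)) \<longlongrightarrow> \<tau>) (at_right t)"
    and Lt: "((\<lambda>s. sgn (\<gamma> (frac s) - \<zeta>)) \<longlongrightarrow> - \<tau>) (at_left t)"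
    using assms(2) unfolding tangent_direction_def by blast
  have uniq: "s = t" if "s \<in> {0..<1}" "\<gamma> s = \<zeta>" for s
    using eqD[of s t] that t by auto
  have frac01: "frac s \<in> {0..<1}" for s :: real by (simp add: frac_lt_1)
  show in_path: "\<zeta> \<in> path_image \<gamma>" using t by (auto simp: path_image_def)
  have ne: "\<gamma> (frac s) \<noteq> \<zeta>" if "s \<noteq> t" "\<bar>s - t\<bar> < 1" for s
  proof
    assume "\<gamma> (frac s) = \<zeta>"
    then have "frac s = t" using uniq frac01 by blast
    then have st: "s - t = of_int \<lfloor>s\<rfloor>" by (simp add: frac_def)
    then have "\<bar>\<lfloor>s\<rfloor>\<bar> < 1" using that(2) by (metis of_int_abs of_int_less_1_iff)
    then show False using st that(1) by simp
  qed
  have evR: "\<forall>\<^sub>F s in at_right t. \<gamma> (frac s) \<noteq> \<zeta>"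
  proof (rule eventually_mono)
    show "\<forall>\<^sub>F s in at_right t. s \<in> {t<..<t + 1}" by (rule eventually_at_right_real) simp
    show "\<gamma> (frac s) \<noteq> \<zeta>" if "s \<in> {t<..<t + 1}" for s using that by (intro ne) auto
  qed
  have evL: "\<forall>\<^sub>F s in at_left t. \<gamma> (frac s) \<noteq> \<zeta>"
  proof (rule eventually_mono)
    show "\<forall>\<^sub>F s in at_left t. s \<in> {t - 1<..<t}" by (rule eventually_at_left_real) simp
    show "\<gamma> (frac s) \<noteq> \<zeta>" if "s \<in> {t - 1<..<t}" for s using that by (intro ne) auto
  qed
  show norm1: "cmod \<tau> = 1"
  proof (rule tendsto_unique)
    show "((\<lambda>s. cmod (sgn (\<gamma> (frac s) - \<zeta>))) \<longlongrightarrow> cmod \<tau>) (at_right t)" using R by (rule tendsto_norm)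
    show "((\<lambda>s. cmod (sgn (\<gamma> (frac s) - \<zeta>))) \<longlongrightarrow> 1) (at_right t)"
      by (rule tendsto_eventually) (use evR in \<open>auto elim!: eventually_mono simp: norm_sgn\<close>)
  qed simp
  then have \<tau>0: "\<tau> \<noteq> 0" by auto
  have sg: "(z - \<zeta>) / \<tau> = of_real (cmod (z - \<zeta>)) * (sgn (z - \<zeta>) / \<tau>)" for z
  proof -
    have "of_real (cmod (z - \<zeta>)) * sgn (z - \<zeta>) = z - \<zeta>"
      by (cases "z = \<zeta>") (simp_all add: sgn_div_norm scaleR_conv_of_real)
    then show ?thesis by (metis times_divide_eq_right)
  qed
  have close: "\<exists>\<eta>>0. \<eta> < 1 \<and> (\<forall>s. 0 < \<bar>s - t\<bar> \<and> \<bar>s - t\<bar> < \<eta> \<longrightarrow>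
      cmod (sgn (\<gamma> (frac s) - \<zeta>) - (if t < s then \<tau> else - \<tau>)) < e)" if "e > 0" for e
  proof -
    have "\<forall>\<^sub>F s in at_right t. dist (sgn (\<gamma> (frac s) - \<zeta>)) \<tau> < e" using R that by (rule tendstoD)
    then obtain b1 where b1: "b1 > t" "\<And>s. t < s \<Longrightarrow> s < b1 \<Longrightarrow> dist (sgn (\<gamma> (frac s) - \<zeta>)) \<tau> < e"
      unfolding eventually_at_right_field by blast
    have "\<forall>\<^sub>F s in at_left t. dist (sgn (\<gamma> (frac s) - \<zeta>)) (- \<tau>) < e" using Lt that by (rule tendstoD)
    then obtain b2 where b2: "b2 < t" "\<And>s. b2 < s \<Longrightarrow> s < t \<Longrightarrow> dist (sgn (\<gamma> (frac s) - \<zeta>)) (- \<tau>) < e"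
      unfolding eventually_at_left_field by blast
    show ?thesis
    proof (intro exI[of _ "min (1/2) (min (b1 - t) (t - b2))"] conjI allI impI)
      fix s assume s: "0 < \<bar>s - t\<bar> \<and> \<bar>s - t\<bar> < min (1/2) (min (b1 - t) (t - b2))"
      show "cmod (sgn (\<gamma> (frac s) - \<zeta>) - (if t < s then \<tau> else - \<tau>)) < e"
      proof (cases "t < s")
        case True
        then have "s < b1" using s by auto
        then show ?thesis using b1(2) True by (simp add: dist_norm)
      next
        case False
        then have "s < t" "b2 < s" using s by auto
        then show ?thesis using b2(2)[of s] False by (simp add: dist_norm)
      qed
    qed (use b1 b2 in auto)
  qed
  have far: "\<exists>d>0. \<forall>z\<in>path_image \<gamma>. cmod (z - \<zeta>) < d \<longrightarrow> z = \<zeta> \<or> (\<exists>s. 0 < \<bar>s - t\<bar> \<and> \<bar>s - t\<bar> < \<eta> \<and> z = \<gamma> (frac s))"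
    if \<eta>: "\<eta> > 0" "\<eta> < 1" for \<eta>
  proof -
    define C where "C = {s \<in> {0..1}. \<eta> \<le> \<bar>s - t\<bar> \<and> \<eta> \<le> \<bar>s - 1 - t\<bar> \<and> \<eta> \<le> \<bar>s + 1 - t\<bar>}"
    have "closed {s. \<eta> \<le> \<bar>s - t\<bar> \<and> \<eta> \<le> \<bar>s - 1 - t\<bar> \<and> \<eta> \<le> \<bar>s + 1 - t\<bar>}"
      by (intro closed_Collect_conj closed_Collect_le continuous_intros)
    then have "compact ({0..1} \<inter> {s. \<eta> \<le> \<bar>s - t\<bar> \<and> \<eta> \<le> \<bar>s - 1 - t\<bar> \<and> \<eta> \<le> \<bar>s + 1 - t\<bar>})"
      by (intro compact_Int_closed) auto
    moreover have "{0..1} \<inter> {s. \<eta> \<le> \<bar>s - t\<bar> \<and> \<eta> \<le> \<bar>s - 1 - t\<bar> \<and> \<eta> \<le> \<bar>s + 1 - t\<bar>} = C" by (auto simp: C_def)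
    ultimately have "compact C" by simp
    then have "compact (\<gamma> ` C)" by (intro compact_continuous_image continuous_on_subset[OF path]) (auto simp: C_def)
    then have "open (- (\<gamma> ` C))" using compact_imp_closed by blast
    moreover have "\<zeta> \<in> - (\<gamma> ` C)"
    proof
      assume "\<zeta> \<in> \<gamma> ` C"
      then obtain s where s: "s \<in> C" "\<gamma> s = \<gamma> t" using t(2) by auto
      then have "s = t \<or> s = 0 \<and> t = 1 \<or> s = 1 \<and> t = 0" using t by (intro eqD) (auto simp: C_def)
      then show False using s \<eta> t by (auto simp: C_def)
    qed
    ultimately obtain d where d: "d > 0" "ball \<zeta> d \<subseteq> - (\<gamma> ` C)" by (meson openE)
    show ?thesis
    proof (intro exI[of _ d] conjI d(1) ballI impI)
      fix z assume z: "z \<in> path_image \<gamma>" "cmod (z - \<zeta>) < d"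
      obtain s where s: "s \<in> {0..<1}" "z = \<gamma> s"
      proof -
        obtain s where "s \<in> {0..1}" "z = \<gamma> s" using z(1) by (auto simp: path_image_def)
        then show thesis using closed that[of s] that[of 0] by (cases "s = 1") auto
      qed
      have "s \<notin> C" using d(2) z(2) s by (force simp: dist_norm norm_minus_commute)
      then consider "\<bar>s - t\<bar> < \<eta>" | "\<bar>s - 1 - t\<bar> < \<eta>" | "\<bar>s + 1 - t\<bar> < \<eta>" using s by (auto simp: C_def)
      then show "z = \<zeta> \<or> (\<exists>s. 0 < \<bar>s - t\<bar> \<and> \<bar>s - t\<bar> < \<eta> \<and> z = \<gamma> (frac s))"
      proof cases
        case 1
        have fs: "frac s = s" using s(1) by (simp add: frac_eq)
        show ?thesis
        proof (cases "s = t")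
          case True
          then show ?thesis using s t by simp
        next
          case False
          then show ?thesis using 1 fs s(2) by (intro disjI2 exI[of _ s]) auto
        qed
      next
        case 2
        have fs: "frac (s - 1) = s" using s(1) by (simp add: frac_unique_iff)
        then show ?thesis using 2 s t by (intro disjI2 exI[of _ "s - 1"]) auto
      next
        case 3
        have fs: "frac (s + 1) = s" using s(1) by (simp add: frac_unique_iff)
        then show ?thesis using 3 s t by (intro disjI2 exI[of _ "s + 1"]) auto
      qed
    qed
  qed
  show "\<exists>d>0. \<forall>z\<in>path_image \<gamma>. cmod (z - \<zeta>) < d \<longrightarrow> \<bar>Im ((z - \<zeta>) / \<tau>)\<bar> \<le> e * cmod (z - \<zeta>)" if e: "e > 0"
  proof -
    obtain \<eta> where \<eta>: "\<eta> > 0" "\<eta> < 1" "\<And>s. 0 < \<bar>s - t\<bar> \<and> \<bar>s - t\<bar> < \<eta> \<Longrightarrow>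
      cmod (sgn (\<gamma> (frac s) - \<zeta>) - (if t < s then \<tau> else - \<tau>)) < e" using close[OF e] by blast
    obtain d where d: "d > 0" "\<And>z. z\<in>path_image \<gamma> \<Longrightarrow> cmod (z - \<zeta>) < d \<Longrightarrow> z = \<zeta> \<or> (\<exists>s. 0 < \<bar>s - t\<bar> \<and> \<bar>s - t\<bar> < \<eta> \<and> z = \<gamma> (frac s))"
      using far[OF \<eta>(1,2)] by blast
    show ?thesis
    proof (intro exI[of _ d] conjI d(1) ballI impI)
      fix z assume z: "z \<in> path_image \<gamma>" "cmod (z - \<zeta>) < d"
      show "\<bar>Im ((z - \<zeta>) / \<tau>)\<bar> \<le> e * cmod (z - \<zeta>)"
      proof (cases "z = \<zeta>")
        case False
        then obtain s where s: "0 < \<bar>s - t\<bar> \<and> \<bar>s - t\<bar> < \<eta>" "z = \<gamma> (frac s)" using d(2)[OF z] by blast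
        define \<sigma> :: complex where "\<sigma> = (if t < s then 1 else - 1)"
        have "cmod (sgn (z - \<zeta>) - \<sigma> * \<tau>) < e" using \<eta>(3)[OF s(1)] s(2) by (auto simp: \<sigma>_def)
        then have "cmod ((sgn (z - \<zeta>) - \<sigma> * \<tau>) / \<tau>) < e" using norm1 by (simp add: norm_divide)
        moreover have "(sgn (z - \<zeta>) - \<sigma> * \<tau>) / \<tau> = sgn (z - \<zeta>) / \<tau> - \<sigma>" using \<tau>0 by (simp add: field_simps)
        ultimately have "\<bar>Im (sgn (z - \<zeta>) / \<tau> - \<sigma>)\<bar> < e" using abs_Im_le_cmod order_le_less_trans by metis
        then have "\<bar>Im (sgn (z - \<zeta>) / \<tau>)\<bar> < e" by (simp add: \<sigma>_def split: if_splits)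
        then have "cmod (z - \<zeta>) * \<bar>Im (sgn (z - \<zeta>) / \<tau>)\<bar> \<le> cmod (z - \<zeta>) * e" by (intro mult_left_mono) auto
        moreover have "Im ((z - \<zeta>) / \<tau>) = cmod (z - \<zeta>) * Im (sgn (z - \<zeta>) / \<tau>)"
          using arg_cong[OF sg[of z], of Im] by (simp del: times_divide_eq_right times_divide_eq_left)
        ultimately show ?thesis by (simp add: abs_mult mult.commute)
      qed simp
    qed
  qed
  show "\<tau>' = \<tau>" if \<tau>': "tangent_direction \<gamma> \<zeta> \<tau>'"
  proof -
    obtain t' where t': "t' \<in> {0..<1}" "\<gamma> t' = \<zeta>" "((\<lambda>s. sgn (\<gamma> (frac s) - \<zeta>)) \<longlongrightarrow> \<tau>') (at_right t')"
      using \<tau>' unfolding tangent_direction_def by blast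
    have "t' = t" using uniq t' by blast
    then show ?thesis using t'(3) R by (intro tendsto_unique[of "at_right t"]) auto
  qed
  show "connected (path_image \<gamma> - {\<zeta>})"
  proof -
    have "simple_path (shiftpath t \<gamma>)" using t simple closed by (intro simple_path_shiftpath) auto
    then have "connected (path_image (shiftpath t \<gamma>) - {pathstart (shiftpath t \<gamma>), pathfinish (shiftpath t \<gamma>)})"
      by (rule connected_simple_path_endless)
    then show ?thesis using t closed by (simp add: path_image_shiftpath endpoints_shiftpath)
  qed
  show "\<exists>z1\<in>path_image \<gamma>. \<exists>z2\<in>path_image \<gamma>. z1 \<noteq> \<zeta> \<and> z2 \<noteq> \<zeta> \<and> cmod (z1 - \<zeta>) < d \<and> cmod (z2 - \<zeta>) < d \<and>
        0 < Re ((z1 - \<zeta>) / \<tau>) \<and> Re ((z2 - \<zeta>) / \<tau>) < 0" if d: "d > 0"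
  proof -
    obtain \<eta> where \<eta>: "\<eta> > 0" "\<eta> < 1" "\<And>s. 0 < \<bar>s - t\<bar> \<and> \<bar>s - t\<bar> < \<eta> \<Longrightarrow>
      cmod (sgn (\<gamma> (frac s) - \<zeta>) - (if t < s then \<tau> else - \<tau>)) < 1" using close[of 1] by auto
    have inp: "\<gamma> (frac s) \<in> path_image \<gamma>" for s using frac01[of s] by (auto simp: path_image_def)
    have per: "\<exists>\<mu>>0. \<forall>s. \<bar>s - t\<bar> < \<mu> \<longrightarrow> cmod (\<gamma> (frac s) - \<zeta>) < d"
    proof (cases "t = 0")
      case False
      then have t0: "t \<in> {0<..<1}" using t by auto
      have "continuous (at t) \<gamma>" using path t0 by (intro continuous_on_interior[of "{0..1}"]) auto
      then have "\<exists>\<mu>>0. \<forall>s. \<bar>s - t\<bar> < \<mu> \<longrightarrow> dist (\<gamma> s) (\<gamma> t) < d"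
        using d unfolding continuous_at_eps_delta by (simp add: dist_real_def)
      then obtain \<mu> where \<mu>: "\<mu> > 0" "\<And>s. \<bar>s - t\<bar> < \<mu> \<Longrightarrow> dist (\<gamma> s) (\<gamma> t) < d" by blast
      show ?thesis
      proof (intro exI[of _ "min \<mu> (min t (1 - t))"] conjI allI impI)
        fix s assume s: "\<bar>s - t\<bar> < min \<mu> (min t (1 - t))"
        then have "s \<in> {0..<1}" by auto
        then have "frac s = s" by (simp add: frac_eq)
        then show "cmod (\<gamma> (frac s) - \<zeta>) < d" using \<mu>(2)[of s] s t by (simp add: dist_norm)
      qed (use \<mu> t0 in auto)
    next
      case True
      obtain \<mu>1 where \<mu>1: "\<mu>1 > 0" "\<And>s. s \<in> {0..1} \<Longrightarrow> dist s 0 < \<mu>1 \<Longrightarrow> dist (\<gamma> s) (\<gamma> 0) < d"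
        using path d unfolding continuous_on_iff by (metis atLeastAtMost_iff order_refl zero_le_one)
      obtain \<mu>2 where \<mu>2: "\<mu>2 > 0" "\<And>s. s \<in> {0..1} \<Longrightarrow> dist s 1 < \<mu>2 \<Longrightarrow> dist (\<gamma> s) (\<gamma> 1) < d"
        using path d unfolding continuous_on_iff by (metis atLeastAtMost_iff order_refl zero_le_one)
      have \<zeta>: "\<gamma> 0 = \<zeta>" "\<gamma> 1 = \<zeta>" using True t closed by auto
      show ?thesis
      proof (intro exI[of _ "min 1 (min \<mu>1 \<mu>2)"] conjI allI impI)
        fix s assume s: "\<bar>s - t\<bar> < min 1 (min \<mu>1 \<mu>2)"
        show "cmod (\<gamma> (frac s) - \<zeta>) < d"
        proof (cases "0 \<le> s")
          case True
          then have "frac s = s" using s \<open>t = 0\<close> by (simp add: frac_eq)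
          then show ?thesis using \<mu>1(2)[of s] s True \<zeta> \<open>t = 0\<close> by (simp add: dist_norm)
        next
          case False
          then have "frac s = s + 1" using s \<open>t = 0\<close> by (simp add: frac_unique_iff)
          then show ?thesis using \<mu>2(2)[of "s + 1"] s False \<zeta> \<open>t = 0\<close> by (simp add: dist_norm)
        qed
      qed (use \<mu>1 \<mu>2 in auto)
    qed
    then obtain \<mu> where \<mu>: "\<mu> > 0" "\<And>s. \<bar>s - t\<bar> < \<mu> \<Longrightarrow> cmod (\<gamma> (frac s) - \<zeta>) < d" by blast
    define m where "m = min \<mu> \<eta> / 2"
    have m: "0 < m" "m < \<mu>" "m < \<eta>" using \<mu> \<eta> by (auto simp: m_def)
    define z1 z2 where "z1 = \<gamma> (frac (t + m))" and "z2 = \<gamma> (frac (t - m))"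
    have ne12: "z1 \<noteq> \<zeta>" "z2 \<noteq> \<zeta>" unfolding z1_def z2_def using m \<eta> by (intro ne; simp)+
    have "cmod (sgn (z1 - \<zeta>) - \<tau>) < 1" "cmod (sgn (z2 - \<zeta>) + \<tau>) < 1"
      using \<eta>(3)[of "t + m"] \<eta>(3)[of "t - m"] m by (simp_all add: z1_def z2_def)
    then have "cmod ((sgn (z1 - \<zeta>) - \<tau>) / \<tau>) < 1" "cmod ((sgn (z2 - \<zeta>) + \<tau>) / \<tau>) < 1"
      using norm1 by (simp_all add: norm_divide)
    moreover have "(sgn (z1 - \<zeta>) - \<tau>) / \<tau> = sgn (z1 - \<zeta>) / \<tau> - 1" "(sgn (z2 - \<zeta>) + \<tau>) / \<tau> = sgn (z2 - \<zeta>) / \<tau> + 1"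
      using \<tau>0 by (simp_all add: field_simps)
    ultimately have "\<bar>Re (sgn (z1 - \<zeta>) / \<tau> - 1)\<bar> < 1" "\<bar>Re (sgn (z2 - \<zeta>) / \<tau> + 1)\<bar> < 1"
      using abs_Re_le_cmod order_le_less_trans by metis+
    then have "0 < Re (sgn (z1 - \<zeta>) / \<tau>)" "Re (sgn (z2 - \<zeta>) / \<tau>) < 0" by auto
    moreover have "Re ((z - \<zeta>) / \<tau>) = cmod (z - \<zeta>) * Re (sgn (z - \<zeta>) / \<tau>)" for z
      using arg_cong[OF sg[of z], of Re] by (simp del: times_divide_eq_right times_divide_eq_left)
    ultimately have "0 < Re ((z1 - \<zeta>) / \<tau>)" "Re ((z2 - \<zeta>) / \<tau>) < 0"
      using ne12 by (simp_all add: mult_pos_neg)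
    moreover have "cmod (z1 - \<zeta>) < d" "cmod (z2 - \<zeta>) < d" unfolding z1_def z2_def using m by (intro \<mu>(2); simp)+
    ultimately show ?thesis using ne12 inp unfolding z1_def z2_def by blast
  qed
qed

lemma tangent_sector_avoids_path:
  assumes J: "jordan_curve \<gamma>" and t: "tangent_direction \<gamma> \<zeta> \<tau>" and n: "n = \<i> * \<tau> \<or> n = - \<i> * \<tau>" and c: "0 < c"
  shows "\<exists>r>0. normal_cone \<zeta> n c r \<inter> path_image \<gamma> = {}"
proof -
  obtain d where d: "d > 0" "\<And>z. z\<in>path_image \<gamma> \<Longrightarrow> cmod (z - \<zeta>) < d \<Longrightarrow> \<bar>Im ((z - \<zeta>) / \<tau>)\<bar> \<le> c * cmod (z - \<zeta>)"
    using tangent_cone[OF J t c] by blast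
  have t0: "\<tau> \<noteq> 0" using tangent_norm[OF J t] by auto
  have Re: "\<bar>Re (w / n)\<bar> = \<bar>Im (w / \<tau>)\<bar>" for w
    using n
  proof
    assume "n = \<i> * \<tau>"
    then have "w / n = - \<i> * (w / \<tau>)" using t0 by (simp add: field_simps)
    from arg_cong[OF this, of Re] show ?thesis by (simp del: times_divide_eq_right times_divide_eq_left)
  next
    assume "n = - \<i> * \<tau>"
    then have "w / n = \<i> * (w / \<tau>)" using t0 by (simp add: field_simps)
    from arg_cong[OF this, of Re] show ?thesis by (simp del: times_divide_eq_right times_divide_eq_left)
  qed
  have "z \<notin> path_image \<gamma>" if z: "z \<in> normal_cone \<zeta> n c d" for z
  proof
    assume "z \<in> path_image \<gamma>"
    then have "\<bar>Im ((z - \<zeta>) / \<tau>)\<bar> \<le> c * cmod (z - \<zeta>)" using z by (intro d(2)) (auto simp: normal_cone_def)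
    then have "\<bar>Re ((z - \<zeta>) / n)\<bar> \<le> c * cmod (z - \<zeta>)" unfolding Re .
    then show False using z by (auto simp: normal_cone_def)
  qed
  then show ?thesis using d(1) by blast
qed

text \<open>A thin enough sector around the normal avoids the curve, is connected, and contains points of \<open>D\<close>; so
  it lies in the component \<open>D\<close>.\<close>
lemma inner_normal_cone:
  assumes D: "jordan_domain \<gamma> D" and n: "inner_normal D \<gamma> \<zeta> n" and c: "0 < c" "c < 1"
  shows "\<exists>r>0. normal_cone \<zeta> n c r \<subseteq> D"
proof -
  have J: "jordan_curve \<gamma>" and comp: "D \<in> components (- path_image \<gamma>)" using D by (auto simp: jordan_domain_def)
  obtain \<tau> where \<tau>: "tangent_direction \<gamma> \<zeta> \<tau>" "n = \<i> * \<tau> \<or> n = - \<i> * \<tau>"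
    and ev: "\<forall>\<^sub>F h in at_right (0 :: real). \<zeta> + of_real h * n \<in> D" using n by (auto simp: inner_normal_def)
  have n1: "cmod n = 1" using \<tau>(2) tangent_norm[OF J \<tau>(1)] by (auto simp: norm_mult)
  obtain r where r: "r > 0" "normal_cone \<zeta> n c r \<inter> path_image \<gamma> = {}"
    using tangent_sector_avoids_path[OF J \<tau> c(1)] by blast
  obtain b where b: "b > 0" "\<And>h. 0 < h \<Longrightarrow> h < b \<Longrightarrow> \<zeta> + of_real h * n \<in> D"
    using ev unfolding eventually_at_right_field by blast
  define h where "h = min b r / 2"
  have h: "0 < h" "h < b" "h < r" using b r by (auto simp: h_def)
  have "\<zeta> + of_real h * n \<in> normal_cone \<zeta> n c r"
  proof -
    have "(\<zeta> + of_real h * n - \<zeta>) / n = of_real h" using n1 by auto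
    moreover have "cmod (\<zeta> + of_real h * n - \<zeta>) = h" using n1 h by (simp add: norm_mult)
    ultimately show ?thesis using h c by (simp add: normal_cone_def)
  qed
  then have "normal_cone \<zeta> n c r \<subseteq> D"
    using b(2)[OF h(1,2)] r(2) c
    by (intro components_maximal[OF comp] convex_connected convex_cone) auto
  then show ?thesis using r by blast
qed

text \<open>A Jordan domain lies on one side of its boundary curve at a tangent point: otherwise the two
  normals could be joined inside the domain, and the resulting Jordan curve would have the boundary
  curve, and hence both of its sides near \<open>\<zeta>\<close>, in a single complementary component.\<close>
lemma inner_normal_unique:
  assumes D: "jordan_domain \<gamma> D" and n: "inner_normal D \<gamma> \<zeta> n" and n': "inner_normal D \<gamma> \<zeta> n'"
  shows "n' = n"
proof (rule ccontr)
  assume "n' \<noteq> n"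
  have J: "jordan_curve \<gamma>" and comp: "D \<in> components (- path_image \<gamma>)" using D by (auto simp: jordan_domain_def)
  have DP: "D \<inter> path_image \<gamma> = {}" using in_components_subset[OF comp] by blast
  have openD: "open D"
  proof -
    have "closed (path_image \<gamma>)" using J by (intro closed_path_image simple_path_imp_path) (simp add: jordan_curve_def)
    then show ?thesis using comp open_components[of "- path_image \<gamma>"] by auto
  qed
  obtain \<tau> where \<tau>: "tangent_direction \<gamma> \<zeta> \<tau>" "n = \<i> * \<tau> \<or> n = - \<i> * \<tau>"
    and ev: "\<forall>\<^sub>F h in at_right (0 :: real). \<zeta> + of_real h * n \<in> D" using n by (auto simp: inner_normal_def)
  obtain \<tau>' where \<tau>': "tangent_direction \<gamma> \<zeta> \<tau>'" "n' = \<i> * \<tau>' \<or> n' = - \<i> * \<tau>'"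
    and ev': "\<forall>\<^sub>F h in at_right (0 :: real). \<zeta> + of_real h * n' \<in> D" using n' by (auto simp: inner_normal_def)
  have "\<tau>' = \<tau>" using tangent_unique[OF J \<tau>(1) \<tau>'(1)] .
  then have nn: "n' = - n" using \<tau>(2) \<tau>'(2) \<open>n' \<noteq> n\<close> by auto
  have n1: "cmod n = 1" using \<tau>(2) tangent_norm[OF J \<tau>(1)] by (auto simp: norm_mult)
  then have n0: "n \<noteq> 0" by auto
  have \<zeta>P: "\<zeta> \<in> path_image \<gamma>" using tangent_in_path[OF J \<tau>(1)] .
  then have \<zeta>D: "\<zeta> \<notin> D" using DP by blast
  define pt where "pt = (\<lambda>h :: real. \<zeta> + of_real h * n)"
  have pt_inj: "pt h = pt k \<longleftrightarrow> h = k" for h k using n0 by (simp add: pt_def)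
  obtain b1 where b1: "b1 > 0" "\<And>h. 0 < h \<Longrightarrow> h < b1 \<Longrightarrow> \<zeta> + of_real h * n \<in> D"
    using ev unfolding eventually_at_right_field by blast
  obtain b2 where b2: "b2 > 0" "\<And>h. 0 < h \<Longrightarrow> h < b2 \<Longrightarrow> \<zeta> + of_real h * n' \<in> D"
    using ev' unfolding eventually_at_right_field by blast
  define h0 where "h0 = min b1 b2 / 2"
  have h0: "h0 > 0" "h0 < b1" "h0 < b2" using b1 b2 by (auto simp: h0_def)
  have ptD: "pt h \<in> D" if "h \<noteq> 0" "\<bar>h\<bar> \<le> h0" for h
  proof (cases "0 < h")
    case True
    then show ?thesis using b1(2)[of h] that h0 by (simp add: pt_def)
  next
    case False
    then show ?thesis using b2(2)[of "- h"] that h0 by (simp add: pt_def nn)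
  qed
  have "connected D" using in_components_connected[OF comp] .
  then have "path_connected D" using openD connected_open_path_connected by blast
  moreover have "pt h0 \<in> D" "pt (- h0) \<in> D" "pt h0 \<noteq> pt (- h0)" using ptD h0 pt_inj by auto
  ultimately obtain g where g: "arc g" "path_image g \<subseteq> D" "pathstart g = pt h0" "pathfinish g = pt (- h0)"
    unfolding path_connected_arcwise by blast
  have gc: "closed (path_image g)" using g(1) by (simp add: closed_arc_image)
  have ptc: "continuous_on UNIV pt" unfolding pt_def by (intro continuous_intros)
  define T where "T = {h \<in> {0..h0}. pt h \<in> path_image g}"
  define T' where "T' = {h \<in> {0..h0}. pt (- h) \<in> path_image g}"
  have cl: "closed (pt -` path_image g)" "closed ((\<lambda>h. pt (- h)) -` path_image g)"
    by (rule continuous_closed_vimage[OF gc], simp add: pt_def)+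
  have "compact ({0..h0} \<inter> pt -` path_image g)" "compact ({0..h0} \<inter> (\<lambda>h. pt (- h)) -` path_image g)"
    using cl by (auto intro: compact_Int_closed)
  then have cT: "compact T" "compact T'" by (simp_all add: T_def T'_def Int_def vimage_def)
  have neT: "T \<noteq> {}" "T' \<noteq> {}"
    using g h0 pathstart_in_path_image[of g] pathfinish_in_path_image[of g] by (auto simp: T_def T'_def intro!: exI[of _ h0])
  \<comment> \<open>The first hits of the arc on either half of the normal.\<close>
  obtain h1 where h1: "h1 \<in> T" "\<And>h. h \<in> T \<Longrightarrow> h1 \<le> h" using compact_attains_inf[OF cT(1) neT(1)] by blast
  obtain h2 where h2: "h2 \<in> T'" "\<And>h. h \<in> T' \<Longrightarrow> h2 \<le> h" using compact_attains_inf[OF cT(2) neT(2)] by blast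
  have \<zeta>g: "\<zeta> \<notin> path_image g" using g(2) \<zeta>D by blast
  have h1p: "0 < h1" "h1 \<le> h0" "pt h1 \<in> path_image g" and h2p: "0 < h2" "h2 \<le> h0" "pt (- h2) \<in> path_image g"
  proof -
    have "h1 \<noteq> 0" using h1(1) \<zeta>g by (auto simp: T_def pt_def)
    then show "0 < h1" "h1 \<le> h0" "pt h1 \<in> path_image g" using h1(1) by (auto simp: T_def)
    have "h2 \<noteq> 0" using h2(1) \<zeta>g by (auto simp: T'_def pt_def)
    then show "0 < h2" "h2 \<le> h0" "pt (- h2) \<in> path_image g" using h2(1) by (auto simp: T'_def)
  qed
  obtain u v where uv: "u \<in> {0..1}" "v \<in> {0..1}" "g u = pt h1" "g v = pt (- h2)"
    using h1p(3) h2p(3) unfolding path_image_def by (metis imageE)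
  have "u \<noteq> v" using uv pt_inj h1p h2p by auto
  define s where "s = subpath u v g"
  have s: "arc s" "path_image s \<subseteq> path_image g" "pathstart s = pt h1" "pathfinish s = pt (- h2)"
    using arc_subpath_arc[OF g(1) uv(1,2) \<open>u \<noteq> v\<close>] path_image_subpath_subset[OF uv(1,2)] uv
    by (simp_all add: s_def)
  define l where "l = linepath (pt (- h2)) (pt h1)"
  have limg: "path_image l = pt ` {- h2..h1}"
  proof -
    have "path_image l = closed_segment (pt (- h2)) (pt h1)" by (simp add: l_def)
    also have "\<dots> = (\<lambda>x. \<zeta> + x) ` (\<lambda>x. x *\<^sub>R n) ` closed_segment (- h2) h1"
    proof -
      have "linear (\<lambda>x :: real. x *\<^sub>R n)" by (simp add: bounded_linear.linear bounded_linear_scaleR_left)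
      then have "(\<lambda>x. x *\<^sub>R n) ` closed_segment (- h2) h1 = closed_segment ((- h2) *\<^sub>R n) (h1 *\<^sub>R n)"
        by (rule closed_segment_linear_image[symmetric])
      then show ?thesis
        using closed_segment_translation[of \<zeta> "- (of_real h2 * n)" "of_real h1 * n"]
        by (simp add: pt_def scaleR_conv_of_real)
    qed
    also have "closed_segment (- h2) h1 = {- h2..h1}" using h1p h2p by (simp add: closed_segment_eq_real_ivl)
    finally show ?thesis by (simp add: image_image pt_def scaleR_conv_of_real)
  qed
  have larc: "arc l" unfolding l_def using pt_inj h1p h2p by (intro arc_linepath) auto
  have meet: "path_image s \<inter> path_image l \<subseteq> {pathstart s, pathstart l}"
  proof
    fix z assume z: "z \<in> path_image s \<inter> path_image l"
    then obtain h where h: "z = pt h" "- h2 \<le> h" "h \<le> h1" using limg by auto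
    have zg: "pt h \<in> path_image g" using z s(2) h by blast
    have "h = h1 \<or> h = - h2"
    proof (cases "0 \<le> h")
      case True
      then have "h \<in> T" using zg h h1p by (auto simp: T_def)
      then show ?thesis using h1(2) h by force
    next
      case False
      then have "- h \<in> T'" using zg h h2p by (auto simp: T'_def)
      then show ?thesis using h2(2) h by force
    qed
    then show "z \<in> {pathstart s, pathstart l}" using h s(3) by (auto simp: l_def)
  qed
  define C where "C = s +++ l"
  have simpleC: "simple_path C" unfolding C_def
    by (rule simple_path_join_loop[OF s(1) larc _ _ meet]) (use s in \<open>simp_all add: l_def\<close>)
  have closedC: "pathfinish C = pathstart C" using s by (simp add: C_def l_def)
  have imgC: "path_image C = path_image s \<union> path_image l"
    unfolding C_def by (rule path_image_join) (simp add: s l_def)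
  have CD: "path_image C \<subseteq> insert \<zeta> D"
  proof
    fix z assume "z \<in> path_image C"
    then consider "z \<in> path_image s" | h where "z = pt h" "- h2 \<le> h" "h \<le> h1" using imgC limg by auto
    then show "z \<in> insert \<zeta> D"
    proof cases
      case 1
      then show ?thesis using s(2) g(2) by blast
    next
      case 2
      then show ?thesis using ptD[of h] h1p h2p by (cases "h = 0") (auto simp: pt_def)
    qed
  qed
  have \<zeta>C: "\<zeta> \<in> path_image C"
  proof -
    have "pt 0 \<in> pt ` {- h2..h1}" using h1p h2p by auto
    then show ?thesis using imgC limg by (simp add: pt_def)
  qed
  obtain \<rho>0 where \<rho>0: "\<rho>0 > 0" "ball \<zeta> \<rho>0 \<inter> path_image g = {}"
    using gc \<zeta>g by (meson open_Compl openE ComplI disjoint_eq_subset_Compl)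
  define \<rho> where "\<rho> = min \<rho>0 (min h1 h2)"
  have \<rho>: "\<rho> > 0" using \<rho>0 h1p h2p by (simp add: \<rho>_def)
  have CB: "z \<in> path_image C \<longleftrightarrow> Im ((z - \<zeta>) / n) = 0" if z: "cmod (z - \<zeta>) < \<rho>" for z
  proof
    assume "z \<in> path_image C"
    moreover have "z \<notin> path_image g" using \<rho>0 z by (auto simp: \<rho>_def dist_norm norm_minus_commute disjoint_iff)
    ultimately obtain h where "z = pt h" using imgC limg s(2) by auto
    then show "Im ((z - \<zeta>) / n) = 0" using n0 by (simp add: pt_def)
  next
    assume I: "Im ((z - \<zeta>) / n) = 0"
    define h where "h = Re ((z - \<zeta>) / n)"
    have "(z - \<zeta>) / n = of_real h" using I by (simp add: h_def complex_eq_iff)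
    then have zh: "z = pt h" using n0 by (simp add: pt_def field_simps)
    then have "\<bar>h\<bar> < \<rho>" using z n1 by (simp add: pt_def norm_mult)
    then have "h \<in> {- h2..h1}" by (auto simp: \<rho>_def)
    then show "z \<in> path_image C" using imgC limg zh by auto
  qed
  define Hp where "Hp = ball \<zeta> \<rho> \<inter> {z. 0 < Im ((z - \<zeta>) / n)}"
  define Hm where "Hm = ball \<zeta> \<rho> \<inter> {z. Im ((z - \<zeta>) / n) < 0}"
  have lin: "Im ((z - \<zeta>) / n) = Im (z / n) - Im (\<zeta> / n)" for z by (simp add: diff_divide_distrib)
  have linear: "linear (\<lambda>z. Im (z / n))" 
    by (intro bounded_linear.linear bounded_linear_compose[OF bounded_linear_Im] bounded_linear_divide)
  have cvx: "convex Hp" "convex Hm"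
  proof -
    have "convex ((\<lambda>z. Im (z / n)) -` {Im (\<zeta> / n)<..})" "convex ((\<lambda>z. Im (z / n)) -` {..<Im (\<zeta> / n)})"
      by (intro convex_linear_vimage[OF linear] convex_real_interval)+
    then show "convex Hp" "convex Hm" unfolding Hp_def Hm_def lin
      by (auto intro!: convex_Int simp: vimage_def)
  qed
  have ReIm: "\<exists>\<sigma>. (\<sigma> = 1 \<or> \<sigma> = -1) \<and> (\<forall>w. Im (w / n) = \<sigma> * Re (w / \<tau>))"
    using \<tau>(2)
  proof
    have t0: "\<tau> \<noteq> 0" using tangent_norm[OF J \<tau>(1)] by auto
    assume "n = \<i> * \<tau>"
    then have "w / n = - \<i> * (w / \<tau>)" for w using t0 by (simp add: field_simps)
    from arg_cong[OF this, of Im] show ?thesis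
      by (intro exI[of _ "-1"]) (simp del: times_divide_eq_right times_divide_eq_left)
  next
    have t0: "\<tau> \<noteq> 0" using tangent_norm[OF J \<tau>(1)] by auto
    assume "n = - \<i> * \<tau>"
    then have "w / n = \<i> * (w / \<tau>)" for w using t0 by (simp add: field_simps)
    from arg_cong[OF this, of Im] show ?thesis
      by (intro exI[of _ 1]) (simp del: times_divide_eq_right times_divide_eq_left)
  qed
  have meetH: "Hp \<inter> (path_image \<gamma> - {\<zeta>}) \<noteq> {}" "Hm \<inter> (path_image \<gamma> - {\<zeta>}) \<noteq> {}"
  proof -
    obtain z1 z2 where z: "z1 \<in> path_image \<gamma>" "z2 \<in> path_image \<gamma>" "z1 \<noteq> \<zeta>" "z2 \<noteq> \<zeta>" "cmod (z1 - \<zeta>) < \<rho>" "cmod (z2 - \<zeta>) < \<rho>"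
      "0 < Re ((z1 - \<zeta>) / \<tau>)" "Re ((z2 - \<zeta>) / \<tau>) < 0" using tangent_sides[OF J \<tau>(1) \<rho>] by blast
    obtain \<sigma> where \<sigma>: "\<sigma> = 1 \<or> \<sigma> = -1" "\<And>w. Im (w / n) = \<sigma> * Re (w / \<tau>)" using ReIm by blast
    have b: "z1 \<in> ball \<zeta> \<rho>" "z2 \<in> ball \<zeta> \<rho>" using z by (auto simp: dist_norm norm_minus_commute)
    show "Hp \<inter> (path_image \<gamma> - {\<zeta>}) \<noteq> {}" "Hm \<inter> (path_image \<gamma> - {\<zeta>}) \<noteq> {}"
      using \<sigma>(1) z b unfolding Hp_def Hm_def \<sigma>(2) by fastforce+
  qed
  \<comment> \<open>Both half discs are joined through the given curve, without crossing \<open>C\<close>.\<close>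
  define S where "S = Hp \<union> (path_image \<gamma> - {\<zeta>}) \<union> Hm"
  have connS: "connected S"
  proof -
    have 1: "connected (Hp \<union> (path_image \<gamma> - {\<zeta>}))"
      by (rule connected_Un[OF convex_connected[OF cvx(1)] tangent_connected[OF J \<tau>(1)] meetH(1)])
    show ?thesis unfolding S_def
      by (rule connected_Un[OF 1 convex_connected[OF cvx(2)]]) (use meetH(2) in blast)
  qed
  have SC: "S \<inter> path_image C = {}"
  proof -
    have "z \<notin> path_image C" if "z \<in> Hp \<union> Hm" for z
      using that CB[of z] by (auto simp: Hp_def Hm_def dist_norm norm_minus_commute)
    moreover have "(path_image \<gamma> - {\<zeta>}) \<inter> path_image C = {}" using CD DP by blast
    ultimately show ?thesis by (auto simp: S_def)
  qed
  note jio = Jordan_inside_outside[OF simpleC closedC]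
  have near: "z \<in> S \<or> z \<in> path_image C" if "dist \<zeta> z < \<rho>" for z
    using CB[of z] that by (auto simp: S_def Hp_def Hm_def dist_norm norm_minus_commute)
  have touch: "\<exists>z\<in>X. dist \<zeta> z < \<rho>" if "frontier X = path_image C" for X
  proof -
    have "\<zeta> \<in> closure X" using that \<zeta>C by (auto simp: frontier_def)
    then show ?thesis using \<rho> by (auto simp: closure_approachable dist_commute)
  qed
  let ?I = "inside (path_image C)" and ?O = "outside (path_image C)"
  have fr: "frontier ?I = path_image C" "frontier ?O = path_image C" and op: "open ?I" "open ?O"
    and un: "?I \<union> ?O = - path_image C" and dj: "?I \<inter> ?O = {}"
    by (insert jio, (elim conjE, assumption)+)
  obtain z1 where z1: "z1 \<in> ?I" "dist \<zeta> z1 < \<rho>" using touch[OF fr(1)] by blast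
  obtain z2 where z2: "z2 \<in> ?O" "dist \<zeta> z2 < \<rho>" using touch[OF fr(2)] by blast
  have "z1 \<in> S" "z2 \<in> S" using near[OF z1(2)] near[OF z2(2)] z1(1) z2(1) un by blast+
  moreover have "S \<subseteq> ?I \<union> ?O" using SC un by blast
  moreover have "?I \<inter> ?O \<inter> S = {}" using dj by blast
  ultimately show False
    using connectedD[OF connS op] z1(1) z2(1) by blast
qed

section \<open>Sawtooth regions\<close>

lemma negligible_isolated_points:
  "negligible {x \<in> X. \<not> x islimpt (X :: real set)}"
proof -
  define h where "h = (\<lambda>(p,q). THE x. x \<in> X \<inter> {p<..<q})"
  have "{x \<in> X. \<not> x islimpt X} \<subseteq> h ` (\<rat> \<times> \<rat>)"
  proof
    fix x assume "x \<in> {x \<in> X. \<not> x islimpt X}"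
    then have x: "x \<in> X" "\<not> x islimpt X" by auto
    then obtain e where e: "e > 0" "\<And>y. y \<in> X \<Longrightarrow> y \<noteq> x \<Longrightarrow> \<not> dist y x < e"
      unfolding islimpt_approachable by blast
    obtain p where p: "p \<in> \<rat>" "x - e < p" "p < x" using Rats_dense_in_real[of "x - e" x] e by auto
    obtain q where q: "q \<in> \<rat>" "x < q" "q < x + e" using Rats_dense_in_real[of x "x + e"] e by auto
    have "y = x" if "y \<in> X \<inter> {p<..<q}" for y
    proof (rule ccontr)
      assume "y \<noteq> x"
      moreover have "dist y x < e" using that p q by (simp add: dist_real_def abs_less_iff)
      ultimately show False using e(2)[of y] that by blast
    qed
    moreover have "x \<in> X \<inter> {p<..<q}" using x p q by simp
    ultimately have "(THE x. x \<in> X \<inter> {p<..<q}) = x" by (rule the_equality[rotated])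
    then have "x = h (p, q)" by (simp add: h_def)
    then show "x \<in> h ` (\<rat> \<times> \<rat>)" using p(1) q(1) by (intro image_eqI[of _ _ "(p, q)"]) auto
  qed
  moreover have "countable (h ` (\<rat> \<times> \<rat>))" by (intro countable_image countable_SIGMA countable_rat)
  ultimately have "countable {x \<in> X. \<not> x islimpt X}" by (rule countable_subset)
  then show ?thesis
    unfolding negligible_iff_null_sets by (blast intro: null_sets_completionI countable_imp_null_set_lborel)
qed

definition limit_in_sectors :: "complex set \<Rightarrow> (real \<Rightarrow> complex) \<Rightarrow> (complex \<Rightarrow> complex) \<Rightarrow> complex \<Rightarrow> complex \<Rightarrow> bool" where
  "limit_in_sectors D \<gamma> f \<zeta> y \<longleftrightarrow> (\<forall>n \<alpha> r. inner_normal D \<gamma> \<zeta> n \<longrightarrow> 0 < \<alpha> \<longrightarrow> \<alpha> < pi / 2 \<longrightarrow>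
     (f \<longlongrightarrow> y) (at \<zeta> within sector \<zeta> n \<alpha> r))"

text \<open>The affine map \<open>w \<mapsto> \<zeta>0 + m w\<close> turns the imaginary axis approximately into the direction of the normal.
  Collected are the positions, in the coordinate \<open>w\<close>, of the points of the curve near \<open>\<zeta>0\<close> above which a
  sector that is wide, upright and of fixed size lies in the domain and carries the bound \<open>- K\<close>. Only the frame is
  common to them; each point keeps its own normal.\<close>
definition sawtooth_base :: "complex set \<Rightarrow> (real \<Rightarrow> complex) \<Rightarrow> (complex \<Rightarrow> complex) \<Rightarrow> complex \<Rightarrow> complex \<Rightarrow> real \<Rightarrow> complex set" where
  "sawtooth_base D \<gamma> f \<zeta>0 m K = {w. cmod w < 1/32 \<and> \<zeta>0 + m * w \<in> path_image \<gamma> \<and>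
     (\<exists>n. inner_normal D \<gamma> (\<zeta>0 + m * w) n \<and> 0 < Im (n / m)) \<and>
     (\<forall>w'. \<bar>Re w' - Re w\<bar> / 8 < Im w' - Im w \<and> cmod (w' - w) < 3 \<longrightarrow> \<zeta>0 + m * w' \<in> D \<and> - K \<le> Re (f (\<zeta>0 + m * w')))}"

text \<open>No point of the base lies in the sector of another one, since sectors are in the domain and base points on
  the curve. So the base lies on its lower envelope \<open>\<phi>\<close>, which is Lipschitz, and every
  point above \<open>\<phi>\<close> is in some sector. The results on Lipschitz domains give limits at almost
  every abscissa, in approach regions of the sawtooth. Unless the abscissa is isolated, points of the base
  converge to the given one; they are on the curve and on the graph, so the
  tangent of the graph is the tangent of the curve, and each sector about the normal ends in an approach
  region of the sawtooth.\<close>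
lemma sawtooth_limits:
  assumes D: "jordan_domain \<gamma> D" and f: "f holomorphic_on D" and m: "m \<noteq> 0"
  shows "\<exists>Z. negligible Z \<and> (\<forall>w\<in>sawtooth_base D \<gamma> f \<zeta>0 m K. Re w \<notin> Z \<longrightarrow> (\<exists>y. limit_in_sectors D \<gamma> f (\<zeta>0 + m * w) y))"
proof (cases "sawtooth_base D \<gamma> f \<zeta>0 m K = {}")
  case False
  define W where "W = sawtooth_base D \<gamma> f \<zeta>0 m K"
  have neW: "W \<noteq> {}" using False by (simp add: W_def)
  have J: "jordan_curve \<gamma>" and comp: "D \<in> components (- path_image \<gamma>)" using D by (auto simp: jordan_domain_def)
  have DP: "D \<inter> path_image \<gamma> = {}" using in_components_subset[OF comp] by blast
  have W1: "cmod w < 1/32" "\<zeta>0 + m * w \<in> path_image \<gamma>" if "w \<in> W" for w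
    using that by (auto simp: W_def sawtooth_base_def)
  have W1': "\<bar>Re w\<bar> < 1/32" "\<bar>Im w\<bar> < 1/32" if "w \<in> W" for w
    using W1(1)[OF that] abs_Re_le_cmod[of w] abs_Im_le_cmod[of w] by argo+
  have W2: "\<zeta>0 + m * w' \<in> D" "- K \<le> Re (f (\<zeta>0 + m * w'))"
    if "w \<in> W" "\<bar>Re w' - Re w\<bar> / 8 < Im w' - Im w" "cmod (w' - w) < 3" for w w'
    using that by (auto simp: W_def sawtooth_base_def)
  define \<phi> where "\<phi> = (\<lambda>x. INF w\<in>W. Im w + \<bar>x - Re w\<bar> / 8)"
  have bdd: "bdd_below ((\<lambda>w. Im w + \<bar>x - Re w\<bar> / 8) ` W)" for x
  proof (rule bdd_belowI2)
    fix w assume "w \<in> W"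
    then show "-1/32 \<le> Im w + \<bar>x - Re w\<bar> / 8" using W1'(2)[of w] abs_ge_zero[of "x - Re w"] by argo
  qed
  have \<phi>_le: "\<phi> x \<le> Im w + \<bar>x - Re w\<bar> / 8" if "w \<in> W" for x w
    unfolding \<phi>_def by (rule cINF_lower[OF bdd that])
  have \<phi>_ge: "c \<le> \<phi> x" if "\<And>w. w \<in> W \<Longrightarrow> c \<le> Im w + \<bar>x - Re w\<bar> / 8" for c x
    unfolding \<phi>_def by (rule cINF_greatest[OF neW]) (rule that)
  have \<phi>W: "\<phi> (Re w) = Im w" if w: "w \<in> W" for w
  proof (rule antisym)
    show "\<phi> (Re w) \<le> Im w" using \<phi>_le[OF w, of "Re w"] by simp
    show "Im w \<le> \<phi> (Re w)"
    proof (rule \<phi>_ge, rule ccontr)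
      fix w' assume w': "w' \<in> W" and "\<not> Im w \<le> Im w' + \<bar>Re w - Re w'\<bar> / 8"
      then have lt: "\<bar>Re w - Re w'\<bar> / 8 < Im w - Im w'" by argo
      have "cmod (w - w') < 3" using norm_triangle_ineq4[of w w'] W1(1)[OF w] W1(1)[OF w'] by argo
      then have "\<zeta>0 + m * w \<in> D" using W2(1)[OF w' lt] by blast
      then show False using W1(2)[OF w] DP by blast
    qed
  qed
  have lip1: "\<phi> x \<le> \<phi> y + \<bar>x - y\<bar> / 8" for x y
  proof -
    have "\<phi> x - \<bar>x - y\<bar> / 8 \<le> \<phi> y"
    proof (rule \<phi>_ge)
      fix w assume "w \<in> W"
      then have "\<phi> x \<le> Im w + \<bar>x - Re w\<bar> / 8" by (rule \<phi>_le)
      then show "\<phi> x - \<bar>x - y\<bar> / 8 \<le> Im w + \<bar>y - Re w\<bar> / 8"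
        using abs_triangle_ineq[of "x - y" "y - Re w"] by (simp add: field_simps)
    qed
    then show ?thesis by simp
  qed
  interpret lipschitz_graph \<phi>
  proof
    show "\<bar>\<phi> x - \<phi> y\<bar> \<le> \<bar>x - y\<bar> / 8" for x y
      using lip1[of x y] lip1[of y x] abs_minus_commute[of x y] by argo
    obtain w where w: "w \<in> W" using neW by blast
    have "\<phi> 0 \<le> 1/16" using \<phi>_le[OF w, of 0] W1'[OF w] by argo
    moreover have "- 1/16 \<le> \<phi> 0"
    proof (rule \<phi>_ge)
      fix w assume "w \<in> W"
      then show "- 1/16 \<le> Im w + \<bar>0 - Re w\<bar> / 8" using W1'[of w] abs_ge_zero[of "0 - Re w"] by argo
    qed
    ultimately show "\<bar>\<phi> 0\<bar> \<le> 1/16" by argo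
  qed
  have OmD: "\<zeta>0 + m * z \<in> D \<and> - K \<le> Re (f (\<zeta>0 + m * z))" if z: "z \<in> Om" for z
  proof -
    have "\<phi> (Re z) < Im z" using z by (simp add: Om_def)
    then obtain w where w: "w \<in> W" "Im w + \<bar>Re z - Re w\<bar> / 8 < Im z"
      unfolding \<phi>_def cINF_less_iff[OF neW bdd] by blast
    have lt: "\<bar>Re z - Re w\<bar> / 8 < Im z - Im w" using w(2) by argo
    have z': "\<bar>Re z\<bar> < 1" "Im z < 1" using z by (auto simp: Om_def)
    have "cmod (z - w) \<le> \<bar>Re z - Re w\<bar> + \<bar>Im z - Im w\<bar>" using cmod_le[of "z - w"] by simp
    also have "\<dots> < 3" using z' W1'[OF w(1)] lt by argo
    finally show ?thesis using W2[OF w(1) lt] by blast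
  qed
  \<comment> \<open>The constant makes the real part at least one.\<close>
  define F where "F = (\<lambda>w. f (\<zeta>0 + m * w) + of_real (K + 1))"
  have Fh: "F holomorphic_on Om"
  proof -
    have "(f \<circ> (\<lambda>w. \<zeta>0 + m * w)) holomorphic_on Om"
      by (rule holomorphic_on_compose_gen[OF _ f]) (use OmD in \<open>auto intro!: holomorphic_intros\<close>)
    then show ?thesis unfolding F_def o_def by (intro holomorphic_intros)
  qed
  have F1: "1 \<le> Re (F z)" if "z \<in> Om" for z using OmD[OF that] by (simp add: F_def)
  have N1: "negligible {x. \<bar>x\<bar> < 1/8 \<and> \<not> (\<exists>d c. (\<phi> has_real_derivative d) (at x) \<and>
    (\<forall>\<kappa>>0. (F \<longlongrightarrow> c) (at (b x) within NT \<kappa> x)))}" (is "negligible ?Z1")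
    by (rule limits_of_functions_with_positive_real_part[OF Fh]) (rule F1)
  define X where "X = Re ` W"
  define Z where "Z = ?Z1 \<union> {x \<in> X. \<not> x islimpt X}"
  have "negligible Z" unfolding Z_def by (intro negligible_Un N1 negligible_isolated_points)
  moreover have "\<exists>y. limit_in_sectors D \<gamma> f (\<zeta>0 + m * w) y" if w: "w \<in> W" and nZ: "Re w \<notin> Z" for w
  proof -
    define x where "x = Re w"
    define \<zeta> where "\<zeta> = \<zeta>0 + m * w"
    have wb: "w = b x" using \<phi>W[OF w] by (simp add: complex_eq_iff x_def)
    have x32: "\<bar>x\<bar> < 1/32" using W1'[OF w] by (simp add: x_def)
    obtain d c where d: "(\<phi> has_real_derivative d) (at x)"
      and c: "\<And>\<kappa>. \<kappa> > 0 \<Longrightarrow> (F \<longlongrightarrow> c) (at (b x) within NT \<kappa> x)"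
      using nZ x32 unfolding Z_def x_def[symmetric] by auto
    have lim: "x islimpt X" using nZ w unfolding Z_def x_def X_def by blast
    obtain n where n: "inner_normal D \<gamma> \<zeta> n" "0 < Im (n / m)"
      using w unfolding W_def sawtooth_base_def \<zeta>_def by blast
    obtain \<tau> where \<tau>: "tangent_direction \<gamma> \<zeta> \<tau>" "n = \<i> * \<tau> \<or> n = - \<i> * \<tau>"
      using n(1) by (auto simp: inner_normal_def)
    have \<tau>0: "\<tau> \<noteq> 0" using tangent_norm[OF J \<tau>(1)] by auto
    define t where "t = Complex 1 d"
    have t0: "t \<noteq> 0" by (simp add: t_def complex_eq_iff)
    \<comment> \<open>The chords that join points of the base are chords of both the graph and the curve.\<close>
    have tangent: "Im (m * t / \<tau>) = 0"
    proof -
      define q where "q = (\<lambda>x'. (b x' - b x) / of_real (x' - x))"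
      have "((\<lambda>y. (\<phi> y - \<phi> x) / (y - x)) \<longlongrightarrow> d) (at x within X)"
        using has_field_derivative_subset[OF d, of X] by (simp add: has_field_derivative_iff)
      then have "((\<lambda>y. Complex 1 ((\<phi> y - \<phi> x) / (y - x))) \<longlongrightarrow> t) (at x within X)"
        unfolding t_def by (intro tendsto_Complex tendsto_const)
      moreover have "\<forall>\<^sub>F y in at x within X. Complex 1 ((\<phi> y - \<phi> x) / (y - x)) = q y"
        unfolding eventually_at_filter
      proof (intro always_eventually allI impI)
        fix y assume "y \<noteq> x"
        then show "Complex 1 ((\<phi> y - \<phi> x) / (y - x)) = q y"
          by (simp add: q_def b_def complex_eq_iff Re_divide_of_real Im_divide_of_real)
      qed
      ultimately have q: "(q \<longlongrightarrow> t) (at x within X)" by (rule Lim_transform_eventually)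
      have nt: "at x within X \<noteq> bot" using lim by (simp add: trivial_limit_within)
      have est: "\<bar>Im (m * t / \<tau>)\<bar> \<le> e * cmod (m * t)" if e: "e > 0" for e
      proof (rule tendsto_le[OF nt])
        show "((\<lambda>y. e * cmod (m * q y)) \<longlongrightarrow> e * cmod (m * t)) (at x within X)" by (intro tendsto_intros q)
        show "((\<lambda>y. \<bar>Im (m * q y / \<tau>)\<bar>) \<longlongrightarrow> \<bar>Im (m * t / \<tau>)\<bar>) (at x within X)"
          by (intro tendsto_intros q \<tau>0)
        obtain \<delta> where \<delta>: "\<delta> > 0" "\<And>z. z\<in>path_image \<gamma> \<Longrightarrow> cmod (z - \<zeta>) < \<delta> \<Longrightarrow> \<bar>Im ((z - \<zeta>) / \<tau>)\<bar> \<le> e * cmod (z - \<zeta>)"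
          using tangent_cone[OF J \<tau>(1) e] by blast
        show "\<forall>\<^sub>F y in at x within X. \<bar>Im (m * q y / \<tau>)\<bar> \<le> e * cmod (m * q y)"
          unfolding eventually_at
        proof (intro exI[of _ "\<delta> / (2 * cmod m)"] conjI ballI impI)
          show "0 < \<delta> / (2 * cmod m)" using \<delta> m by simp
          fix y assume yX: "y \<in> X" and y: "y \<noteq> x \<and> dist y x < \<delta> / (2 * cmod m)"
          obtain w' where w': "w' \<in> W" "y = Re w'" using yX by (auto simp: X_def)
          have wb': "w' = b y" using \<phi>W[OF w'(1)] by (simp add: complex_eq_iff w'(2))
          have diff0: "(\<zeta>0 + m * w') - \<zeta> = m * (b y - b x)" unfolding \<zeta>_def wb' by (simp add: wb[symmetric] right_diff_distrib)
          have "q y * of_real (y - x) = b y - b x" using y by (simp add: q_def del: of_real_diff)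
          then have diff: "(\<zeta>0 + m * w') - \<zeta> = m * q y * of_real (y - x)" unfolding diff0 by (simp only: mult.assoc)
          have "cmod (b y - b x) \<le> \<bar>y - x\<bar> + \<bar>\<phi> y - \<phi> x\<bar>" using cmod_le[of "b y - b x"] by simp
          also have "\<dots> \<le> 2 * \<bar>y - x\<bar>" using lip[of y x] abs_ge_zero[of "y - x"] by argo
          finally have "cmod m * cmod (b y - b x) \<le> cmod m * (2 * \<bar>y - x\<bar>)" by (intro mult_left_mono) auto
          also have "\<dots> < \<delta>" using y m by (simp add: dist_real_def field_simps)
          finally have "cmod ((\<zeta>0 + m * w') - \<zeta>) < \<delta>"
            unfolding diff0 norm_mult .
          then have "\<bar>Im (((\<zeta>0 + m * w') - \<zeta>) / \<tau>)\<bar> \<le> e * cmod ((\<zeta>0 + m * w') - \<zeta>)"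
            by (rule \<delta>(2)[OF W1(2)[OF w'(1)]])
          moreover have "Im (m * q y * of_real (y - x) / \<tau>) = (y - x) * Im (m * q y / \<tau>)"
          proof -
            have "m * q y * of_real (y - x) / \<tau> = of_real (y - x) * (m * q y / \<tau>)" by simp
            then show ?thesis by (simp del: times_divide_eq_right times_divide_eq_left of_real_diff)
          qed
          moreover have "cmod (m * q y * of_real (y - x)) = \<bar>y - x\<bar> * cmod (m * q y)"
            by (simp add: norm_mult del: of_real_diff)
          ultimately have "\<bar>y - x\<bar> * \<bar>Im (m * q y / \<tau>)\<bar> \<le> \<bar>y - x\<bar> * (e * cmod (m * q y))"
            unfolding diff by (simp add: abs_mult mult.left_commute)
          then show "\<bar>Im (m * q y / \<tau>)\<bar> \<le> e * cmod (m * q y)" using y by simp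
        qed
      qed
      have "\<bar>Im (m * t / \<tau>)\<bar> \<le> 0"
      proof (rule field_le_epsilon)
        fix e :: real assume e: "e > 0"
        have "0 < cmod (m * t)" using m t0 by simp
        then show "\<bar>Im (m * t / \<tau>)\<bar> \<le> 0 + e" using est[of "e / cmod (m * t)"] e by simp
      qed
      then show ?thesis by simp
    qed
    obtain \<rho> where \<rho>: "\<rho> > 0" "n * of_real \<rho> = \<i> * m * t"
    proof -
      define k where "k = Re (m * t / \<tau>)"
      have "m * t / \<tau> = of_real k" using tangent by (simp add: k_def complex_eq_iff)
      then have mt: "m * t = of_real k * \<tau>" using \<tau>0 by (simp add: field_simps)
      have "\<exists>\<rho>. n * of_real \<rho> = \<i> * m * t"
        using \<tau>(2)
      proof
        assume "n = \<i> * \<tau>"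
        then show ?thesis using mt by (intro exI[of _ k]) (simp add: mult_ac)
      next
        assume "n = - \<i> * \<tau>"
        then show ?thesis using mt by (intro exI[of _ "- k"]) (simp add: mult_ac)
      qed
      then obtain \<rho> where \<rho>: "n * of_real \<rho> = \<i> * m * t" by blast
      then have "n / m * of_real \<rho> = \<i> * t" using m by (simp add: field_simps)
      then have "Im (n / m * of_real \<rho>) = 1" by (simp add: t_def)
      moreover have "Im (w * of_real \<rho>) = Im w * \<rho>" for w by simp
      ultimately have "Im (n / m) * \<rho> = 1" by (simp only:)
      then have "\<rho> > 0" using n(2) by (metis zero_less_mult_pos zero_less_one)
      then show thesis using that \<rho> by blast
    qed
    have main: "(f \<longlongrightarrow> c - of_real (K + 1)) (at \<zeta> within sector \<zeta> n \<alpha> r)" if \<alpha>: "0 < \<alpha>" "\<alpha> < pi / 2" for \<alpha> r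
    proof -
      have n1: "cmod n = 1" using \<tau>(2) tangent_norm[OF J \<tau>(1)] by (auto simp: norm_mult)
      have ca: "0 < cos \<alpha>" using \<alpha> by (intro cos_gt_zero) auto
      \<comment> \<open>In the coordinates of the frame the sector is \<open>Im v - d Re v > c1 |v|\<close>.\<close>
      define c1 where "c1 = cos \<alpha> * cmod m * (1 + d^2) / \<rho>"
      have d2: "0 < 1 + d^2" by (simp add: add_pos_nonneg)
      have c1: "c1 > 0" unfolding c1_def using ca m d2 \<rho> by simp
      define \<kappa> where "\<kappa> = min 1 (c1 / (4 * (1 + \<bar>d\<bar>)))"
      have \<kappa>: "0 < \<kappa>" "\<kappa> \<le> 1" "(1 + \<bar>d\<bar>) * \<kappa> \<le> c1 / 4"
      proof -
        show "0 < \<kappa>" "\<kappa> \<le> 1" using c1 by (auto simp: \<kappa>_def add_pos_nonneg)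
        have "(1 + \<bar>d\<bar>) * \<kappa> \<le> (1 + \<bar>d\<bar>) * (c1 / (4 * (1 + \<bar>d\<bar>)))" by (intro mult_left_mono) (auto simp: \<kappa>_def)
        also have "\<dots> = c1 / 4"
        proof -
          have "1 + \<bar>d\<bar> \<noteq> 0" using abs_ge_zero[of d] by argo
          moreover have "e * (c1 / (4 * e)) = c1 / 4" if "e \<noteq> 0" for e using that by simp
          ultimately show ?thesis by blast
        qed
        finally show "(1 + \<bar>d\<bar>) * \<kappa> \<le> c1 / 4" .
      qed
      have "((\<lambda>y. (\<phi> y - \<phi> x) / (y - x)) \<longlongrightarrow> d) (at x)" using d by (simp add: has_field_derivative_iff)
      from LIM_D[OF this, of "c1 / 8"] c1 obtain \<delta> where \<delta>: "\<delta> > 0"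
        "\<And>y. y \<noteq> x \<and> norm (y - x) < \<delta> \<Longrightarrow> norm ((\<phi> y - \<phi> x) / (y - x) - d) < c1 / 8" by auto
      have \<phi>d: "\<phi> (x + p) \<le> \<phi> x + d * p + c1 / 8 * \<bar>p\<bar>" if p: "\<bar>p\<bar> < \<delta>" for p
      proof (cases "p = 0")
        case False
        then have "\<bar>(\<phi> (x + p) - \<phi> x) / p - d\<bar> < c1 / 8" using \<delta>(2)[of "x + p"] p by simp
        then have "\<bar>p\<bar> * \<bar>(\<phi> (x + p) - \<phi> x) / p - d\<bar> \<le> \<bar>p\<bar> * (c1 / 8)" by (intro mult_left_mono) auto
        moreover have "\<bar>p\<bar> * \<bar>(\<phi> (x + p) - \<phi> x) / p - d\<bar> = \<bar>\<phi> (x + p) - \<phi> x - d * p\<bar>"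
          using False by (simp add: abs_mult[symmetric] field_simps)
        ultimately have "\<phi> (x + p) - \<phi> x - d * p \<le> \<bar>p\<bar> * (c1 / 8)" by argo
        then show ?thesis by (simp add: mult.commute)
      qed simp
      define \<omega> where "\<omega> = (\<lambda>z. (z - \<zeta>0) / m)"
      have \<omega>\<zeta>: "\<omega> \<zeta> = b x" using m by (simp add: \<omega>_def \<zeta>_def wb)
      have \<omega>d: "z - \<zeta> = m * (\<omega> z - b x)" for z using m by (simp add: \<omega>_def \<zeta>_def wb[symmetric] field_simps)
      have NTsec: "\<omega> z \<in> NT \<kappa> x" if z: "z \<in> sector \<zeta> n \<alpha> r" and small: "cmod (\<omega> z - b x) < min (\<delta> / 2) (1/8)" for z
      proof -
        define v where "v = \<omega> z - b x"
        have "z \<in> normal_cone \<zeta> n (cos \<alpha>) r" using z sector_eq_cone[OF n1 \<alpha>] by simp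
        then have ineq: "cos \<alpha> * cmod (m * v) < Re (m * v / n)" by (simp add: normal_cone_def \<omega>d v_def)
        have mvn: "m * v / n = of_real (\<rho> / (1 + d^2)) * (v * (- \<i>) * cnj t)"
        proof -
          have tc: "t * cnj t = of_real (1 + d^2)" by (simp add: t_def complex_mult_cnj complex_eq_iff power2_eq_square)
          have "t * (cnj t * of_real (1 / (1 + d^2))) = of_real ((1 + d^2) * (1 / (1 + d^2)))"
            unfolding mult.assoc[symmetric] tc by (simp only: of_real_mult)
          also have "\<dots> = 1" using d2 by simp
          finally have it: "inverse t = cnj t * of_real (1 / (1 + d^2))" by (rule inverse_unique)
          have n0: "n \<noteq> 0" using n1 by auto
          have "of_real \<rho> * (v * (- \<i>)) * inverse t * n = (n * of_real \<rho>) * (- \<i> * v) * inverse t" by (simp add: mult_ac)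
          also have "\<dots> = m * v" unfolding \<rho>(2) using t0 by (simp add: field_simps)
          finally have "m * v / n = of_real \<rho> * (v * (- \<i>)) * inverse t"
            unfolding nonzero_divide_eq_eq[OF n0] by (rule sym)
          then show ?thesis unfolding it by simp
        qed
        have "Re (m * v / n) = \<rho> / (1 + d^2) * Re (v * (- \<i>) * cnj t)"
        proof -
          have "Re (of_real a * w) = a * Re w" for a w by simp
          then show ?thesis unfolding mvn by blast
        qed
        also have "Re (v * (- \<i>) * cnj t) = Im v - d * Re v" by (simp add: t_def algebra_simps)
        finally have "cos \<alpha> * cmod m * cmod v < \<rho> / (1 + d^2) * (Im v - d * Re v)" using ineq by (simp add: norm_mult mult.assoc)
        then have "(cos \<alpha> * cmod m * cmod v) * ((1 + d^2) / \<rho>) < (\<rho> / (1 + d^2) * (Im v - d * Re v)) * ((1 + d^2) / \<rho>)"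
          using d2 \<rho> by (intro mult_strict_right_mono) auto
        moreover have "(\<rho> / e * Y) * (e / \<rho>) = Y" if "e \<noteq> 0" for e Y using that \<rho>(1) by simp
        moreover have "(cos \<alpha> * cmod m * cmod v) * ((1 + d^2) / \<rho>) = c1 * cmod v" by (simp add: c1_def)
        ultimately have key: "c1 * cmod v < Im v - d * Re v" using d2 by (metis less_irrefl)
        have vs: "cmod v < \<delta> / 2" "cmod v < 1/8" using small by (auto simp: v_def)
        have "ball (\<omega> z) (\<kappa> * cmod v) \<subseteq> Om"
        proof
          fix u assume "u \<in> ball (\<omega> z) (\<kappa> * cmod v)"
          then have u: "cmod (u - \<omega> z) < \<kappa> * cmod v" by (simp add: dist_norm norm_minus_commute)
          define p where "p = Re (u - b x)"
          define q where "q = Im (u - b x)"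
          have pq: "\<bar>p - Re v\<bar> \<le> cmod (u - \<omega> z)" "\<bar>q - Im v\<bar> \<le> cmod (u - \<omega> z)"
            using abs_Re_le_cmod[of "u - \<omega> z"] abs_Im_le_cmod[of "u - \<omega> z"] by (simp_all add: p_def q_def v_def)
          have "\<kappa> * cmod v \<le> 1 * cmod v" using \<kappa> by (intro mult_right_mono) auto
          then have ul: "cmod (u - \<omega> z) \<le> cmod v" using u by simp
          have p2: "\<bar>p\<bar> \<le> 2 * cmod v" "\<bar>q\<bar> \<le> 2 * cmod v"
            using pq ul abs_Re_le_cmod[of v] abs_Im_le_cmod[of v] by argo+
          have "\<bar>d\<bar> * \<bar>p - Re v\<bar> \<le> \<bar>d\<bar> * (\<kappa> * cmod v)" using pq u by (intro mult_left_mono) auto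
          then have "d * (p - Re v) \<le> \<bar>d\<bar> * (\<kappa> * cmod v)" using abs_ge_self[of "d * (p - Re v)"] by (simp add: abs_mult)
          then have dp: "d * p \<le> d * Re v + \<bar>d\<bar> * (\<kappa> * cmod v)" by (simp add: right_diff_distrib)
          have "(1 + \<bar>d\<bar>) * \<kappa> * cmod v \<le> c1 / 4 * cmod v" using \<kappa>(3) by (intro mult_right_mono) auto
          then have k4: "\<kappa> * cmod v + \<bar>d\<bar> * (\<kappa> * cmod v) \<le> c1 * cmod v / 4" by (simp add: algebra_simps)
          have "\<phi> (x + p) \<le> \<phi> x + d * p + c1 / 8 * \<bar>p\<bar>" using p2 vs by (intro \<phi>d) auto
          also have "c1 / 8 * \<bar>p\<bar> \<le> c1 / 8 * (2 * cmod v)" using p2 c1 by (intro mult_left_mono) auto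
          finally have "\<phi> (x + p) \<le> \<phi> x + d * p + c1 * cmod v / 4" by simp
          moreover have "0 < c1 * cmod v \<or> cmod v = 0" using c1 by auto
          moreover have "0 \<le> c1 * cmod v" using c1 by simp
          ultimately have "\<phi> (x + p) < \<phi> x + q" using key dp k4 pq u by argo
          moreover have "\<bar>x + p\<bar> < 1" "\<phi> x + q < 1" using p2 vs x32 \<phi>_bound[of x] by argo+
          ultimately show "u \<in> Om" by (simp add: Om_def p_def q_def)
        qed
        then show ?thesis by (simp add: NT_def v_def)
      qed
      have "filterlim \<omega> (at (b x) within NT \<kappa> x) (at \<zeta> within sector \<zeta> n \<alpha> r)"
        unfolding filterlim_at
      proof
        have t: "(\<omega> \<longlongrightarrow> \<omega> \<zeta>) (at \<zeta> within sector \<zeta> n \<alpha> r)" unfolding \<omega>_def using m by (intro tendsto_intros) auto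
        then show "(\<omega> \<longlongrightarrow> b x) (at \<zeta> within sector \<zeta> n \<alpha> r)" by (simp only: \<omega>\<zeta>)
        from tendstoD[OF this, of "min (\<delta> / 2) (1/8)"] \<delta>(1)
        have "\<forall>\<^sub>F z in at \<zeta> within sector \<zeta> n \<alpha> r. dist (\<omega> z) (b x) < min (\<delta> / 2) (1/8)" by simp
        moreover have "\<forall>\<^sub>F z in at \<zeta> within sector \<zeta> n \<alpha> r. z \<in> sector \<zeta> n \<alpha> r \<and> z \<noteq> \<zeta>"
          by (simp add: eventually_at_filter)
        ultimately show "\<forall>\<^sub>F z in at \<zeta> within sector \<zeta> n \<alpha> r. \<omega> z \<in> NT \<kappa> x \<and> \<omega> z \<noteq> b x"
        proof eventually_elim
          case (elim z)
          then have "\<omega> z \<in> NT \<kappa> x" by (intro NTsec) (auto simp: dist_norm)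
          moreover have "\<omega> z \<noteq> b x" using elim \<omega>d[of z] by auto
          ultimately show ?case by blast
        qed
      qed
      from filterlim_compose[OF c[OF \<kappa>(1)] this]
      have "((\<lambda>z. F (\<omega> z)) \<longlongrightarrow> c) (at \<zeta> within sector \<zeta> n \<alpha> r)" .
      then have "((\<lambda>z. F (\<omega> z) - of_real (K + 1)) \<longlongrightarrow> c - of_real (K + 1)) (at \<zeta> within sector \<zeta> n \<alpha> r)"
        by (intro tendsto_diff tendsto_const)
      moreover have "(\<lambda>z. F (\<omega> z) - of_real (K + 1)) = f" using m by (simp add: F_def \<omega>_def fun_eq_iff)
      ultimately show ?thesis by simp
    qed
    have "limit_in_sectors D \<gamma> f \<zeta> (c - of_real (K + 1))"
      unfolding limit_in_sectors_def
    proof (intro allI impI)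
      fix n' \<alpha> r assume n': "inner_normal D \<gamma> \<zeta> n'" and \<alpha>: "0 < \<alpha>" "\<alpha> < pi / 2"
      have "n' = n" using inner_normal_unique[OF D n(1) n'] .
      then show "(f \<longlongrightarrow> c - of_real (K + 1)) (at \<zeta> within sector \<zeta> n' \<alpha> r)" using main[OF \<alpha>] by simp
    qed
    then show ?thesis unfolding \<zeta>_def by blast
  qed
  ultimately show ?thesis unfolding W_def by blast
qed (auto intro: exI[of _ "{}"])

section \<open>Limits almost everywhere on the boundary\<close>

text \<open>The frame \<open>m\<close> is chosen close to \<open>- \<i> n r / 6\<close> and \<open>\<zeta>0\<close> close to \<open>\<zeta>\<close>. An upright sector with slopes
  above one eighth has vectors with \<open>|v| < 9 Im v\<close>, and a perturbation by one percent keeps it inside the sector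
  of half angle \<open>arccos (1/20)\<close>.\<close>
lemma sawtooth_cover:
  assumes D: "jordan_domain \<gamma> D" and n: "inner_normal D \<gamma> \<zeta> n" and r: "0 < r"
    and bound: "\<And>z. z \<in> normal_cone \<zeta> n (1/20) r \<Longrightarrow> z \<in> D \<and> - K \<le> Re (f z)"
    and dense: "\<And>X :: complex set. open X \<Longrightarrow> X \<noteq> {} \<Longrightarrow> \<exists>d\<in>Q. d \<in> X"
  shows "\<exists>\<zeta>0\<in>Q. \<exists>m\<in>Q - {0}. \<exists>k :: nat. (\<zeta> - \<zeta>0) / m \<in> sawtooth_base D \<gamma> f \<zeta>0 m (real k)"
proof -
  have J: "jordan_curve \<gamma>" using D by (simp add: jordan_domain_def)
  obtain \<tau> where \<tau>: "tangent_direction \<gamma> \<zeta> \<tau>" "n = \<i> * \<tau> \<or> n = - \<i> * \<tau>"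
    using n by (auto simp: inner_normal_def)
  have n1: "cmod n = 1" using \<tau>(2) tangent_norm[OF J \<tau>(1)] by (auto simp: norm_mult)
  then have n0: "n \<noteq> 0" by auto
  define a where "a = - \<i> * n * of_real (r / 6)"
  have a: "cmod a = r / 6" using n1 r by (simp add: a_def norm_mult)
  then have a0: "a \<noteq> 0" using r by auto
  obtain m where m: "m \<in> Q" "m \<in> ball a (cmod a / 100)" using dense[of "ball a (cmod a / 100)"] a r by auto
  \<comment> \<open>The factor by which the approximate frame differs from the exact one.\<close>
  define \<mu> where "\<mu> = m / a"
  have m_eq: "m = a * \<mu>" using a0 by (simp add: \<mu>_def)
  have \<mu>: "cmod (\<mu> - 1) < 1/100"
  proof -
    have "\<mu> - 1 = (m - a) / a" using a0 by (simp add: \<mu>_def field_simps)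
    then have "cmod (\<mu> - 1) = cmod (m - a) / cmod a" by (simp add: norm_divide)
    also have "\<dots> < 1/100" using m(2) a0 by (simp add: dist_norm norm_minus_commute field_simps)
    finally show ?thesis .
  qed
  have \<mu>n: "cmod \<mu> < 101/100" using norm_triangle_ineq[of "\<mu> - 1" 1] \<mu> by simp
  have \<mu>R: "0 < Re \<mu>" using abs_Re_le_cmod[of "\<mu> - 1"] \<mu> by simp
  have \<mu>0: "\<mu> \<noteq> 0" using \<mu>R by auto
  have m0: "m \<noteq> 0" using m_eq a0 \<mu>0 by simp
  have mn: "cmod m = r / 6 * cmod \<mu>" using m_eq a by (simp add: norm_mult)
  obtain \<zeta>0 where \<zeta>0: "\<zeta>0 \<in> Q" "\<zeta>0 \<in> ball \<zeta> (cmod m / 32)" using dense[of "ball \<zeta> (cmod m / 32)"] m0 by auto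
  obtain k :: nat where k: "K \<le> real k" using real_arch_simple by blast
  define w where "w = (\<zeta> - \<zeta>0) / m"
  have \<zeta>w: "\<zeta>0 + m * w = \<zeta>" using m0 by (simp add: w_def)
  have "w \<in> sawtooth_base D \<gamma> f \<zeta>0 m (real k)"
    unfolding sawtooth_base_def mem_Collect_eq \<zeta>w
  proof (intro conjI exI[of _ n] allI impI)
    show "cmod w < 1/32" using \<zeta>0(2) m0 by (simp add: w_def norm_divide dist_norm field_simps)
    show "\<zeta> \<in> path_image \<gamma>" by (rule tangent_in_path[OF J \<tau>(1)])
    show "inner_normal D \<gamma> \<zeta> n" by (rule n)
    show "0 < Im (n / m)"
    proof -
      have "n / m = of_real (6 / r) * (\<i> / \<mu>)" using n0 r \<mu>0 by (simp add: m_eq a_def field_simps)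
      then have "Im (n / m) = 6 / r * Im (\<i> / \<mu>)"
      proof -
        have "Im (of_real x * z) = x * Im z" for x z by simp
        then show ?thesis using \<open>n / m = _\<close> by presburger
      qed
      also have "Im (\<i> / \<mu>) = Re \<mu> / (cmod \<mu>)^2" by (simp add: Im_divide cmod_power2)
      finally show ?thesis using r \<mu>R \<mu>0 by simp
    qed
    fix w' assume w': "\<bar>Re w' - Re w\<bar> / 8 < Im w' - Im w \<and> cmod (w' - w) < 3"
    define v where "v = w' - w"
    have v: "\<bar>Re v\<bar> < 8 * Im v" "cmod v < 3" using w' by (auto simp: v_def)
    have vle: "cmod v < 9 * Im v" using cmod_le[of v] v(1) by argo
    have zv: "(\<zeta>0 + m * w') - \<zeta> = m * v" unfolding v_def right_diff_distrib using \<zeta>w by auto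
    have "\<zeta>0 + m * w' \<in> normal_cone \<zeta> n (1/20) r"
      unfolding normal_cone_def mem_Collect_eq zv
    proof
      have "cmod (m * v) = r / 6 * (cmod \<mu> * cmod v)" by (simp add: norm_mult mn)
      moreover have "cmod \<mu> * cmod v \<le> 101/100 * cmod v" using \<mu>n by (intro mult_right_mono) auto
      moreover have "r / 6 * (cmod \<mu> * cmod v) \<le> r / 6 * (101/100 * cmod v)"
        using calculation(2) r by (intro mult_left_mono) auto
      ultimately have mv: "cmod (m * v) \<le> r / 6 * (101/100 * cmod v)" by argo
      also have "r / 6 * (101/100 * cmod v) \<le> r / 6 * (303/100)" using v r by (intro mult_left_mono) auto
      also have "\<dots> < r" using r by simp
      finally show "cmod (m * v) < r" .
      have "m * v / n = of_real (r / 6) * (- \<i> * v * \<mu>)" using n0 by (simp add: m_eq a_def field_simps)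
      moreover have "Re (of_real x * z) = x * Re z" for x z by simp
      ultimately have Re: "Re (m * v / n) = r / 6 * Re (- \<i> * v * \<mu>)" by presburger
      have "- \<i> * v * \<mu> = - \<i> * v + (- \<i> * v * (\<mu> - 1))" by (simp add: algebra_simps)
      then have "Re (- \<i> * v * \<mu>) = Im v + Re (- \<i> * v * (\<mu> - 1))" by simp
      moreover have "\<bar>Re (- \<i> * v * (\<mu> - 1))\<bar> \<le> cmod v * (1/100)"
      proof -
        have "\<bar>Re (- \<i> * v * (\<mu> - 1))\<bar> \<le> cmod (- \<i> * v * (\<mu> - 1))" by (rule abs_Re_le_cmod)
        also have "\<dots> = cmod v * cmod (\<mu> - 1)" by (simp add: norm_mult)
        also have "\<dots> \<le> cmod v * (1/100)" using \<mu> by (intro mult_left_mono) auto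
        finally show ?thesis .
      qed
      ultimately have "1/20 * (101/100 * cmod v) < Re (- \<i> * v * \<mu>)" using vle norm_ge_zero[of v] by argo
      then have "r / 6 * (1/20 * (101/100 * cmod v)) < r / 6 * Re (- \<i> * v * \<mu>)" using r by (intro mult_strict_left_mono) auto
      then show "1/20 * cmod (m * v) < Re (m * v / n)" unfolding Re using mv by argo
    qed
    from bound[OF this] show "\<zeta>0 + m * w' \<in> D" "- real k \<le> Re (f (\<zeta>0 + m * w'))" using k by auto
  qed
  then show ?thesis using \<zeta>0(1) m(1) m0 unfolding w_def by blast
qed

context rectifiable_jordan
begin

text \<open>For each of countably many frames the bad points have their abscissa in a null set. Along the natural
  parametrization the abscissa has a nonzero derivative at these points, because the normal is close to the
  vertical axis of the frame, so the bad parameters form a null set as well.\<close>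
lemma one_sided_bound_imp_limit_ae:
  assumes D: "jordan_domain \<gamma> D" and f: "f holomorphic_on D"
  shows "negligible {s \<in> {0..L}. (\<exists>n r K. inner_normal D \<gamma> (g s) n \<and> 0 < r \<and>
      (\<forall>z\<in>normal_cone (g s) n (1/20) r. z \<in> D \<and> - K \<le> Re (f z))) \<and> \<not> (\<exists>y. limit_in_sectors D \<gamma> f (g s) y)}"
proof -
  obtain Q :: "complex set" where Q: "countable Q" "\<And>X. open X \<Longrightarrow> X \<noteq> {} \<Longrightarrow> \<exists>d\<in>Q. d \<in> X"
    using countable_dense_exists by blast
  define I where "I = Q \<times> (Q - {0}) \<times> (UNIV :: nat set)"
  have cI: "countable I" unfolding I_def
    by (rule countable_SIGMA[OF Q(1) countable_SIGMA[OF countable_Diff[OF Q(1)] countableI_type]])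
  define Z where "Z = (\<lambda>\<zeta>0 m k. SOME Z. negligible Z \<and>
      (\<forall>w\<in>sawtooth_base D \<gamma> f \<zeta>0 m (real k). Re w \<notin> Z \<longrightarrow> (\<exists>y. limit_in_sectors D \<gamma> f (\<zeta>0 + m * w) y)))"
  have Z0: "negligible (Z \<zeta>0 m k) \<and>
      (\<forall>w\<in>sawtooth_base D \<gamma> f \<zeta>0 m (real k). Re w \<notin> Z \<zeta>0 m k \<longrightarrow> (\<exists>y. limit_in_sectors D \<gamma> f (\<zeta>0 + m * w) y))"
    if "m \<noteq> 0" for \<zeta>0 m k
    unfolding Z_def by (rule someI_ex[OF sawtooth_limits[OF D f that]])
  have Z: "negligible (Z \<zeta>0 m k)" if "m \<noteq> 0" for \<zeta>0 m k using Z0[OF that] by blast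
  have Z2: "\<exists>y. limit_in_sectors D \<gamma> f (\<zeta>0 + m * w) y"
    if "m \<noteq> 0" "w \<in> sawtooth_base D \<gamma> f \<zeta>0 m (real k)" "Re w \<notin> Z \<zeta>0 m k" for \<zeta>0 m k w
    using Z0[OF that(1)] that(2,3) by blast
  have J: "jordan_curve \<gamma>" by (rule jordan)
  define good where "good = (\<lambda>s. s \<in> {0<..<L} \<and> (\<exists>\<tau>. norm \<tau> = 1 \<and> (g has_vector_derivative \<tau>) (at s)))"
  define T where "T = (\<lambda>(\<zeta>0,m,k). {s. good s \<and> (g s - \<zeta>0) / m \<in> sawtooth_base D \<gamma> f \<zeta>0 m (real k) \<and> Re ((g s - \<zeta>0) / m) \<in> Z \<zeta>0 m k})"
  have negT: "negligible (T (\<zeta>0,m,k))" if m: "m \<noteq> 0" for \<zeta>0 m k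
  proof (rule negligible_by_nonzero_derivative[where p = "\<lambda>s. Re ((g s - \<zeta>0) / m)"])
    show "negligible ((\<lambda>s. Re ((g s - \<zeta>0) / m)) ` T (\<zeta>0,m,k))"
      by (rule negligible_subset[OF Z[OF m]]) (auto simp: T_def)
    fix s assume "s \<in> T (\<zeta>0,m,k)"
    then have gs: "good s" and w: "(g s - \<zeta>0) / m \<in> sawtooth_base D \<gamma> f \<zeta>0 m (real k)" by (auto simp: T_def)
    obtain \<tau> where \<tau>: "norm \<tau> = 1" "(g has_vector_derivative \<tau>) (at s)" and sL: "s \<in> {0<..<L}" using gs by (auto simp: good_def)
    have td: "tangent_direction \<gamma> (g s) \<tau>" by (rule tangent_direction_natural_param[OF sL \<tau>(2,1)])
    have eq: "\<zeta>0 + m * ((g s - \<zeta>0) / m) = g s" using m by simp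
    obtain n where n: "inner_normal D \<gamma> (g s) n" "0 < Im (n / m)"
      using w unfolding sawtooth_base_def mem_Collect_eq eq by blast
    obtain \<tau>' where \<tau>': "tangent_direction \<gamma> (g s) \<tau>'" "n = \<i> * \<tau>' \<or> n = - \<i> * \<tau>'" using n(1) by (auto simp: inner_normal_def)
    have "\<tau>' = \<tau>" by (rule tangent_unique[OF J td \<tau>'(1)])
    then have "n / m = \<i> * (\<tau> / m) \<or> n / m = - (\<i> * (\<tau> / m))" using \<tau>'(2) by auto
    then have "Im (n / m) = Re (\<tau> / m) \<or> Im (n / m) = - Re (\<tau> / m)"
      by (elim disjE) (simp_all del: times_divide_eq_right)
    then have R: "Re (\<tau> / m) \<noteq> 0" using n(2) by auto
    have "((\<lambda>s. (g s - \<zeta>0) / m) has_vector_derivative (\<tau> - 0) / m) (at s)"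
      by (intro has_vector_derivative_divide has_vector_derivative_diff has_vector_derivative_const \<tau>(2))
    then have "((\<lambda>s. Re ((g s - \<zeta>0) / m)) has_vector_derivative Re (\<tau> / m)) (at s)"
      using bounded_linear.has_vector_derivative[OF bounded_linear_Re] by simp
    then show "\<exists>d. d \<noteq> 0 \<and> ((\<lambda>s. Re ((g s - \<zeta>0) / m)) has_real_derivative d) (at s)"
      using R by (auto simp: has_real_derivative_iff_has_vector_derivative)
  qed
  have "negligible (\<Union>i\<in>I. T i)"
  proof (rule negligible_countable_Union)
    show "countable (T ` I)" using cI by (rule countable_image)
    fix S assume "S \<in> T ` I"
    then obtain \<zeta>0 m k where "S = T (\<zeta>0,m,k)" "m \<noteq> 0" by (auto simp: I_def)
    then show "negligible S" using negT by simp
  qed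
  moreover have "negligible {s \<in> {0..L}. \<not> good s}" using unit_speed_ae by (simp add: good_def)
  ultimately have "negligible ((\<Union>i\<in>I. T i) \<union> {s \<in> {0..L}. \<not> good s})" by (rule negligible_Un)
  then show ?thesis
  proof (rule negligible_subset, intro subsetI)
    fix s assume "s \<in> {s \<in> {0..L}. (\<exists>n r K. inner_normal D \<gamma> (g s) n \<and> 0 < r \<and>
      (\<forall>z\<in>normal_cone (g s) n (1/20) r. z \<in> D \<and> - K \<le> Re (f z))) \<and> \<not> (\<exists>y. limit_in_sectors D \<gamma> f (g s) y)}"
    then obtain n r K where s: "s \<in> {0..L}" "inner_normal D \<gamma> (g s) n" "0 < r"
      "\<And>z. z\<in>normal_cone (g s) n (1/20) r \<Longrightarrow> z \<in> D \<and> - K \<le> Re (f z)" and no: "\<not> (\<exists>y. limit_in_sectors D \<gamma> f (g s) y)"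
      by blast
    obtain \<zeta>0 m k where c: "\<zeta>0 \<in> Q" "m \<in> Q - {0}" "(g s - \<zeta>0) / m \<in> sawtooth_base D \<gamma> f \<zeta>0 m (real k)"
      using sawtooth_cover[OF D s(2,3,4) Q(2)] by blast
    have m: "m \<noteq> 0" using c(2) by simp
    have "Re ((g s - \<zeta>0) / m) \<in> Z \<zeta>0 m k"
    proof (rule ccontr)
      assume "Re ((g s - \<zeta>0) / m) \<notin> Z \<zeta>0 m k"
      from Z2[OF m c(3) this] show False using no m by simp
    qed
    then have "good s \<Longrightarrow> s \<in> T (\<zeta>0,m,k)" using c(3) by (simp add: T_def)
    moreover have "(\<zeta>0,m,k) \<in> I" using c by (simp add: I_def)
    ultimately show "s \<in> (\<Union>i\<in>I. T i) \<union> {s \<in> {0..L}. \<not> good s}" using s(1) by blast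
  qed
qed

subsection \<open>Arc length measure\<close>

abbreviation M where "M \<equiv> arc_length_measure \<gamma>"

lemma arc_length_measure_sets:
  "space M = path_image \<gamma>"
  "sets M = {Y. Y \<subseteq> path_image \<gamma> \<and> g -` Y \<inter> {0..L} \<in> sets lebesgue}"
  "Y \<in> sets M \<Longrightarrow> emeasure M Y = emeasure lebesgue (g -` Y \<inter> {0..L})"
proof -
  define \<A> where "\<A> = {Y. Y \<subseteq> path_image \<gamma> \<and> g -` Y \<inter> {0..L} \<in> sets lebesgue}"
  have gP: "g s \<in> path_image \<gamma>" if "s \<in> {0..L}" for s using natural_param_image that by blast
  have sa: "sigma_algebra (path_image \<gamma>) \<A>"
    unfolding sigma_algebra_iff2
  proof (intro conjI ballI allI impI)
    show "\<A> \<subseteq> Pow (path_image \<gamma>)" by (auto simp: \<A>_def)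
    show "{} \<in> \<A>" by (simp add: \<A>_def)
    fix Y assume Y: "Y \<in> \<A>"
    have "g -` (path_image \<gamma> - Y) \<inter> {0..L} = {0..L} - (g -` Y \<inter> {0..L})" using gP by auto
    also have "\<dots> \<in> sets lebesgue" using Y by (intro sets.Diff) (auto simp: \<A>_def)
    finally show "path_image \<gamma> - Y \<in> \<A>" by (simp add: \<A>_def)
  next
    fix Y :: "nat \<Rightarrow> complex set" assume Y: "range Y \<subseteq> \<A>"
    have "g -` (\<Union>i. Y i) \<inter> {0..L} = (\<Union>i. g -` Y i \<inter> {0..L})" by auto
    also have "\<dots> \<in> sets lebesgue" using Y by (intro sets.countable_nat_UN) (auto simp: \<A>_def)
    finally show "(\<Union>i. Y i) \<in> \<A>" using Y by (auto simp: \<A>_def)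
  qed
  have sub: "\<A> \<subseteq> Pow (path_image \<gamma>)" by (auto simp: \<A>_def)
  have Mdef: "M = distr (lebesgue_on {0..L}) (sigma (path_image \<gamma>) \<A>) g"
    unfolding arc_length_measure_def \<A>_def ..
  have sets_sigma: "sets (sigma (path_image \<gamma>) \<A>) = \<A>"
    using sub sigma_algebra.sigma_sets_eq[OF sa] by simp
  show sp: "space M = path_image \<gamma>" unfolding Mdef space_distr by (rule space_measure_of[OF sub])
  have setsM: "sets M = \<A>" unfolding Mdef sets_distr by (rule sets_sigma)
  then show "sets M = {Y. Y \<subseteq> path_image \<gamma> \<and> g -` Y \<inter> {0..L} \<in> sets lebesgue}" by (simp only: \<A>_def)
  have gm: "g \<in> measurable (lebesgue_on {0..L}) (sigma (path_image \<gamma>) \<A>)"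
    unfolding measurable_def sets_sigma
  proof (intro CollectI conjI ballI)
    show "g \<in> space (lebesgue_on {0..L}) \<rightarrow> space (sigma (path_image \<gamma>) \<A>)" 
      unfolding space_measure_of[OF sub] by (rule Pi_I) (use gP in \<open>simp add: space_restrict_space\<close>)
    fix Y assume "Y \<in> \<A>"
    then show "g -` Y \<inter> space (lebesgue_on {0..L}) \<in> sets (lebesgue_on {0..L})"
      by (simp add: \<A>_def space_restrict_space sets_restrict_space_iff)
  qed
  assume "Y \<in> sets M"
  then have Y: "Y \<in> \<A>" unfolding setsM .
  have "emeasure M Y = emeasure (lebesgue_on {0..L}) (g -` Y \<inter> {0..L})"
  proof -
    have "space (lebesgue_on {0..L}) = {0..L}" by (simp add: space_restrict_space)
    moreover have "Y \<in> sets (sigma (path_image \<gamma>) \<A>)" unfolding sets_sigma by (rule Y)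
    ultimately show ?thesis unfolding Mdef by (simp only: emeasure_distr[OF gm])
  qed
  also have "\<dots> = emeasure lebesgue (g -` Y \<inter> {0..L})"
    by (rule emeasure_restrict_space) auto
  finally show "emeasure M Y = emeasure lebesgue (g -` Y \<inter> {0..L})" .
qed

text \<open>The base point of the curve, which has two parameters, is put into the exceptional set; the
  natural parametrization is injective otherwise.\<close>
lemma AE_arc_length_measure:
  assumes neg: "negligible {s \<in> {0..L}. \<not> P (g s)}"
  shows "AE \<zeta> in M. P \<zeta>"
proof (rule AE_I)
  define N where "N = {s \<in> {0..L}. \<not> P (g s)} \<union> {0, L}"
  have Nneg: "negligible N" unfolding N_def using neg by (intro negligible_Un) auto
  have NL: "N \<subseteq> {0..L}" using L_pos by (auto simp: N_def)
  have pre: "g -` (g ` N) \<inter> {0..L} = N"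
  proof
    show "N \<subseteq> g -` (g ` N) \<inter> {0..L}" using NL by blast
    show "g -` (g ` N) \<inter> {0..L} \<subseteq> N"
    proof
      fix s assume s: "s \<in> g -` (g ` N) \<inter> {0..L}"
      then obtain s' where s': "s' \<in> N" "g s = g s'" by blast
      have "s' \<in> {0..L}" using s'(1) NL by blast
      then have "s = s' \<or> s = 0 \<and> s' = L \<or> s = L \<and> s' = 0" using s s'(2) by (intro natural_param_eqD) auto
      then show "s \<in> N" using s' by (auto simp: N_def)
    qed
  qed
  have Nsets: "N \<in> sets lebesgue" using Nneg negligible_imp_sets by blast
  have img: "g ` N \<subseteq> path_image \<gamma>" using NL natural_param_image by blast
  show gN: "g ` N \<in> sets M" unfolding arc_length_measure_sets(2) using img Nsets pre by simp
  show "emeasure M (g ` N) = 0"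
    unfolding arc_length_measure_sets(3)[OF gN] pre using Nneg Nsets by (simp add: negligible_iff_emeasure0)
  show "{\<zeta> \<in> space M. \<not> P \<zeta>} \<subseteq> g ` N"
  proof
    fix \<zeta> assume "\<zeta> \<in> {\<zeta> \<in> space M. \<not> P \<zeta>}"
    then have "\<zeta> \<in> g ` {0..L}" "\<not> P \<zeta>" using natural_param_image by (auto simp: arc_length_measure_sets(1))
    then show "\<zeta> \<in> g ` N" by (auto simp: N_def)
  qed
qed

lemma arc_length_measurable_if_ae_eq:
  fixes h :: "complex \<Rightarrow> ereal" and H :: "real \<Rightarrow> ereal"
  assumes E: "E \<in> sets M" and H: "H \<in> borel_measurable lebesgue"
    and ae: "negligible {s \<in> {0..L}. g s \<in> E \<and> h (g s) \<noteq> H s}"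
  shows "h \<in> borel_measurable (restrict_space M E)"
proof (rule measurableI)
  have ESp: "E \<subseteq> path_image \<gamma>" using sets.sets_into_space[OF E] by (simp add: arc_length_measure_sets(1))
  have EL: "g -` E \<inter> {0..L} \<in> sets lebesgue" using E unfolding arc_length_measure_sets(2) by blast
  fix B :: "ereal set" assume B: "B \<in> sets borel"
  let ?N = "{s \<in> {0..L}. g s \<in> E \<and> h (g s) \<noteq> H s}"
  define S where "S = g -` (h -` B \<inter> E) \<inter> {0..L}"
  define S' where "S' = H -` B \<inter> (g -` E \<inter> {0..L})"
  have "H -` B \<in> sets lebesgue" using measurable_sets[OF H B] by simp
  then have S': "S' \<in> sets lebesgue" unfolding S'_def using EL by (rule sets.Int)
  have N: "?N \<in> sets lebesgue" using ae negligible_imp_sets by blast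
  have SN: "S \<inter> ?N \<in> sets lebesgue"
    by (rule negligible_imp_sets, rule negligible_subset[OF ae]) (rule Int_lower2)
  have "S = (S' - ?N) \<union> (S \<inter> ?N)" unfolding S_def S'_def by auto
  moreover have "(S' - ?N) \<union> (S \<inter> ?N) \<in> sets lebesgue" using S' N SN by (intro sets.Un sets.Diff)
  ultimately have "S \<in> sets lebesgue" by simp
  then have "h -` B \<inter> E \<in> sets M" unfolding arc_length_measure_sets(2) S_def using ESp by blast
  then show "h -` B \<inter> space (restrict_space M E) \<in> sets (restrict_space M E)"
    using E ESp by (simp add: space_restrict_space sets_restrict_space_iff arc_length_measure_sets(1) Int_absorb2 Int_absorb1 inf.absorb2)
qed simp

end

lemma normal_in_cone:
  assumes "cmod n = 1" "0 < h" "h < r" "c < 1" shows "\<zeta> + of_real h * n \<in> normal_cone \<zeta> n c r"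
proof -
  have n0: "n \<noteq> 0" using assms(1) by auto
  have "(\<zeta> + of_real h * n - \<zeta>) / n = of_real h" using n0 by simp
  moreover have "cmod (\<zeta> + of_real h * n - \<zeta>) = h" using assms by (simp add: norm_mult)
  ultimately show ?thesis using assms by (simp add: normal_cone_def)
qed

lemma cos_pi4_bounds: "0 < cos (pi / 4)" "cos (pi / 4) < 1" "0 < pi / 4" "pi / 4 < pi / 2"
  using cos_monotone_0_pi[of 0 "pi/4"] by (auto intro: cos_gt_zero)

lemma normal_sequence:
  assumes "cmod n = 1"
  shows "filterlim (\<lambda>k. \<zeta> + of_real (1 / real (Suc k)) * n) (at \<zeta> within sector \<zeta> n (pi / 4) 2) sequentially"
  unfolding filterlim_at
proof
  show "\<forall>\<^sub>F k in sequentially. \<zeta> + of_real (1 / real (Suc k)) * n \<in> sector \<zeta> n (pi / 4) 2 \<and> \<zeta> + of_real (1 / real (Suc k)) * n \<noteq> \<zeta>"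
  proof (intro always_eventually allI conjI)
    fix k
    have h: "0 < 1 / real (Suc k)" "1 / real (Suc k) < 2" by (auto simp: field_simps)
    show "\<zeta> + of_real (1 / real (Suc k)) * n \<in> sector \<zeta> n (pi / 4) 2"
      unfolding sector_eq_cone[OF assms cos_pi4_bounds(3,4)] by (rule normal_in_cone[OF assms h cos_pi4_bounds(2)])
    have "n \<noteq> 0" using assms by auto
    then have "of_real (1 / real (Suc k)) * n \<noteq> 0" using h(1) by (simp del: of_real_divide)
    then show "\<zeta> + of_real (1 / real (Suc k)) * n \<noteq> \<zeta>" by (simp del: of_real_divide mult_eq_0_iff)
  qed
  have "(\<lambda>k. \<zeta> + of_real (1 / real (Suc k)) * n) \<longlonglongrightarrow> \<zeta> + of_real 0 * n"
    by (intro tendsto_intros LIMSEQ_Suc[OF lim_1_over_n])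
  then show "(\<lambda>k. \<zeta> + of_real (1 / real (Suc k)) * n) \<longlonglongrightarrow> \<zeta>" by simp
qed

lemma inner_normal_norm:
  assumes "jordan_domain \<gamma> D" "inner_normal D \<gamma> \<zeta> n" shows "cmod n = 1"
proof -
  have J: "jordan_curve \<gamma>" using assms(1) by (simp add: jordan_domain_def)
  obtain \<tau> where \<tau>: "tangent_direction \<gamma> \<zeta> \<tau>" "n = \<i> * \<tau> \<or> n = - \<i> * \<tau>" using assms(2) by (auto simp: inner_normal_def)
  then show ?thesis using tangent_norm[OF J \<tau>(1)] by (auto simp: norm_mult)
qed

lemma at_within_sector_ne_bot:
  assumes "cmod n = 1" "0 < r" shows "at \<zeta> within sector \<zeta> n (pi / 4) r \<noteq> bot"
proof -
  have "\<zeta> islimpt sector \<zeta> n (pi / 4) r"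
    unfolding islimpt_approachable
  proof (intro allI impI)
    fix e :: real assume e: "e > 0"
    define h where "h = min e r / 2"
    have h: "0 < h" "h < r" "h < e" using e assms by (auto simp: h_def)
    have "\<zeta> + of_real h * n \<in> sector \<zeta> n (pi / 4) r"
      unfolding sector_eq_cone[OF assms(1) cos_pi4_bounds(3,4)] by (rule normal_in_cone[OF assms(1) h(1,2) cos_pi4_bounds(2)])
    moreover have "n \<noteq> 0" using assms by auto
    moreover have "dist (\<zeta> + of_real h * n) \<zeta> < e" using h assms by (simp add: dist_norm norm_mult)
    ultimately show "\<exists>x'\<in>sector \<zeta> n (pi / 4) r. x' \<noteq> \<zeta> \<and> dist x' \<zeta> < e"
      using h by (intro bexI[of _ "\<zeta> + of_real h * n"]) auto
  qed
  then show ?thesis by (simp add: trivial_limit_within)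
qed

lemma has_angular_limit_unique:
  assumes D: "jordan_domain \<gamma> D" and L: "has_angular_limit D \<gamma> w \<zeta> L1" "has_angular_limit D \<gamma> w \<zeta> L2"
  shows "L1 = L2"
proof -
  obtain n1 where n1: "inner_normal D \<gamma> \<zeta> n1" "\<And>\<alpha> r. 0 < \<alpha> \<and> \<alpha> < pi / 2 \<and> 0 < r \<and> sector \<zeta> n1 \<alpha> r \<subseteq> D \<Longrightarrow>
      ((\<lambda>z. ereal (w z)) \<longlongrightarrow> L1) (at \<zeta> within sector \<zeta> n1 \<alpha> r)" using L(1) by (auto simp: has_angular_limit_def)
  obtain n2 where n2: "inner_normal D \<gamma> \<zeta> n2" "\<And>\<alpha> r. 0 < \<alpha> \<and> \<alpha> < pi / 2 \<and> 0 < r \<and> sector \<zeta> n2 \<alpha> r \<subseteq> D \<Longrightarrow>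
      ((\<lambda>z. ereal (w z)) \<longlongrightarrow> L2) (at \<zeta> within sector \<zeta> n2 \<alpha> r)" using L(2) by (auto simp: has_angular_limit_def)
  have eq: "n2 = n1" by (rule inner_normal_unique[OF D n1(1) n2(1)])
  have nn: "cmod n1 = 1" by (rule inner_normal_norm[OF D n1(1)])
  obtain r where r: "r > 0" "normal_cone \<zeta> n1 (cos (pi / 4)) r \<subseteq> D"
    using inner_normal_cone[OF D n1(1) cos_pi4_bounds(1,2)] by blast
  then have s: "0 < pi / 4 \<and> pi / 4 < pi / 2 \<and> 0 < r \<and> sector \<zeta> n1 (pi / 4) r \<subseteq> D"
    using sector_eq_cone[OF nn cos_pi4_bounds(3,4)] cos_pi4_bounds by simp
  show ?thesis
    using tendsto_unique[OF at_within_sector_ne_bot[OF nn r(1)] n1(2)[OF s]] n2(2) s unfolding eq by blast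
qed

lemma angular_limit_eq:
  assumes "jordan_domain \<gamma> D" "has_angular_limit D \<gamma> w \<zeta> L" shows "angular_limit D \<gamma> w \<zeta> = L"
  unfolding angular_limit_def by (rule the_equality) (use assms has_angular_limit_unique in blast)+

text \<open>A thin sector around the opposite direction avoids the curve; if it met \<open>D\<close> it would be
  contained in \<open>D\<close>, and there would be two inner normals.\<close>
lemma outer_normal_outside:
  assumes D: "jordan_domain \<gamma> D" and n: "inner_normal D \<gamma> \<zeta> n"
  shows "\<forall>\<^sub>F h in at_right (0::real). \<zeta> - of_real h * n \<notin> D"
proof -
  have J: "jordan_curve \<gamma>" and comp: "D \<in> components (- path_image \<gamma>)" using D by (auto simp: jordan_domain_def)
  obtain \<tau> where \<tau>: "tangent_direction \<gamma> \<zeta> \<tau>" "n = \<i> * \<tau> \<or> n = - \<i> * \<tau>" using n by (auto simp: inner_normal_def)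
  have nn: "cmod n = 1" by (rule inner_normal_norm[OF D n])
  have \<tau>': "- n = \<i> * \<tau> \<or> - n = - \<i> * \<tau>" using \<tau>(2) by auto
  obtain r where r: "r > 0" "normal_cone \<zeta> (- n) (1/2) r \<inter> path_image \<gamma> = {}"
    using tangent_sector_avoids_path[OF J \<tau>(1) \<tau>', of "1/2"] by auto
  have inc: "\<zeta> - of_real h * n \<in> normal_cone \<zeta> (- n) (1/2) r" if "0 < h" "h < r" for h
    using normal_in_cone[of "- n" h r "1/2" \<zeta>] nn that by simp
  have "normal_cone \<zeta> (- n) (1/2) r \<inter> D = {}"
  proof (rule ccontr)
    assume "normal_cone \<zeta> (- n) (1/2) r \<inter> D \<noteq> {}"
    then have sub: "normal_cone \<zeta> (- n) (1/2) r \<subseteq> D"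
      using r(2) by (intro components_maximal[OF comp] convex_connected convex_cone) auto
    have "\<forall>\<^sub>F h in at_right (0::real). h \<in> {0<..<r}" using r(1) by (rule eventually_at_right_real)
    then have "\<forall>\<^sub>F h in at_right (0::real). \<zeta> + of_real h * (- n) \<in> D"
    proof eventually_elim
      case (elim h)
      then show ?case using inc[of h] sub by auto
    qed
    then have "inner_normal D \<gamma> \<zeta> (- n)" unfolding inner_normal_def using \<tau>(1) \<tau>' by blast
    then have "- n = n" by (rule inner_normal_unique[OF D n])
    then show False using nn by (auto simp: neg_equal_zero)
  qed
  moreover have "\<forall>\<^sub>F h in at_right (0::real). h \<in> {0<..<r}" using r(1) by (rule eventually_at_right_real)
  ultimately show ?thesis by (auto elim!: eventually_mono dest: inc)
qed

context rectifiable_jordan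
begin

text \<open>At almost every point the angular limit is a limit along the inner normal, which is one of the
  two normals \<open>\<plusminus>\<i> T\<close> to the tangent \<open>T\<close>. As the function is set to zero outside the domain, the sum of its
  values along both normals has the same limit, and the choice of the inner normal need not be shown to be measurable.\<close>
lemma angular_limit_measurable:
  fixes w :: "complex \<Rightarrow> real"
  assumes D: "jordan_domain \<gamma> D" and E: "E \<in> sets M" and w: "continuous_on D w"
    and ae: "negligible {s \<in> {0..L}. \<not> (g s \<in> E \<longrightarrow> (\<exists>n y. inner_normal D \<gamma> (g s) n \<and>
        (\<forall>\<alpha> r. 0 < \<alpha> \<longrightarrow> \<alpha> < pi / 2 \<longrightarrow> (w \<longlongrightarrow> y) (at (g s) within sector (g s) n \<alpha> r))))}"
  shows "angular_limit D \<gamma> w \<in> borel_measurable (restrict_space M E)"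
proof -
  have J: "jordan_curve \<gamma>" by (rule jordan)
  have openD: "open D"
  proof -
    have "closed (path_image \<gamma>)" using path by (rule closed_path_image)
    then show ?thesis using D open_components[of "- path_image \<gamma>"] by (auto simp: jordan_domain_def)
  qed
  define h where "h = (\<lambda>s. g (max 0 (min s L)))"
  have hg: "h s = g s" if "s \<in> {0..L}" for s using that by (simp add: h_def)
  have lip: "1-lipschitz_on UNIV h" unfolding h_def by (rule natural_param_extension_Lipschitz)
  obtain T where T: "T \<in> borel_measurable borel" "\<And>x v. (h has_vector_derivative v) (at x) \<Longrightarrow> T x = v"
    by (rule Lipschitz_increment_eq_integral[OF lip]) blast
  have hm: "h \<in> borel_measurable borel"
    by (rule borel_measurable_continuous_onI[OF lipschitz_on_continuous_on[OF lip]])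
  define wD where "wD = (\<lambda>z. indicator D z *\<^sub>R w z)"
  have wDm: "wD \<in> borel_measurable borel"
    unfolding wD_def by (rule borel_measurable_continuous_on_indicator[OF _ w]) (use openD in auto)
  define p where "p = (\<lambda>k s. of_real (1 / real (Suc k)) * (\<i> * T s))"
  have pm: "p k \<in> borel_measurable borel" for k
    unfolding p_def by (intro borel_measurable_times borel_measurable_const T(1))
  define a where "a = (\<lambda>k s. wD (h s + p k s) + wD (h s - p k s))"
  have am: "a k \<in> borel_measurable borel" for k
    unfolding a_def by (intro borel_measurable_add measurable_compose[OF _ wDm] borel_measurable_diff hm pm)
  define H where "H = (\<lambda>s. ereal (lim (\<lambda>k. a k s)))"
  have "H \<in> borel_measurable borel" unfolding H_def
    by (intro borel_measurable_ereal borel_measurable_lim_metric am)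
  then have Hm: "H \<in> borel_measurable lebesgue"
    by (rule measurable_completion[of H lborel borel, unfolded measurable_lborel2])
  show ?thesis
  proof (rule arc_length_measurable_if_ae_eq[OF E Hm])
    show "negligible {s \<in> {0..L}. g s \<in> E \<and> angular_limit D \<gamma> w (g s) \<noteq> H s}"
    proof (rule negligible_subset[OF negligible_Un[OF ae unit_speed_ae]], rule subsetI, rule ccontr)
      fix s assume s: "s \<in> {s \<in> {0..L}. g s \<in> E \<and> angular_limit D \<gamma> w (g s) \<noteq> H s}"
        and ns: "s \<notin> {s \<in> {0..L}. \<not> (g s \<in> E \<longrightarrow> (\<exists>n y. inner_normal D \<gamma> (g s) n \<and>
          (\<forall>\<alpha> r. 0 < \<alpha> \<longrightarrow> \<alpha> < pi / 2 \<longrightarrow> (w \<longlongrightarrow> y) (at (g s) within sector (g s) n \<alpha> r))))} \<union>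
          {s \<in> {0..L}. \<not> (s \<in> {0<..<L} \<and> (\<exists>\<tau>. norm \<tau> = 1 \<and> (g has_vector_derivative \<tau>) (at s)))}"
      obtain n y where n: "inner_normal D \<gamma> (g s) n"
        and lim: "\<And>\<alpha> r. 0 < \<alpha> \<Longrightarrow> \<alpha> < pi / 2 \<Longrightarrow> (w \<longlongrightarrow> y) (at (g s) within sector (g s) n \<alpha> r)"
        using s ns by blast
      obtain \<tau> where \<tau>: "norm \<tau> = 1" "(g has_vector_derivative \<tau>) (at s)" and sL: "s \<in> {0<..<L}" using s ns by blast
      have td: "tangent_direction \<gamma> (g s) \<tau>" by (rule tangent_direction_natural_param[OF sL \<tau>(2,1)])
      have "(h has_vector_derivative \<tau>) (at s)"
        by (rule has_vector_derivative_transform_within_open[OF \<tau>(2), of "{0<..<L}"]) (use sL hg in auto)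
      then have Ts: "T s = \<tau>" by (rule T(2))
      obtain \<tau>' where \<tau>': "tangent_direction \<gamma> (g s) \<tau>'" "n = \<i> * \<tau>' \<or> n = - \<i> * \<tau>'" using n by (auto simp: inner_normal_def)
      have "\<tau>' = \<tau>" by (rule tangent_unique[OF J td \<tau>'(1)])
      then have nT: "\<i> * T s = n \<or> \<i> * T s = - n" using \<tau>'(2) Ts by auto
      have nn: "cmod n = 1" by (rule inner_normal_norm[OF D n])
      let ?e = "\<lambda>k. of_real (1 / real (Suc k)) :: complex"
      have hs: "h s = g s" using sL hg by auto
      have sum: "a k s = wD (g s + ?e k * n) + wD (g s - ?e k * n)" for k
        using nT unfolding a_def p_def hs by auto
      have fl: "filterlim (\<lambda>k. 1 / real (Suc k)) (at_right 0) sequentially"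
        unfolding filterlim_at using LIMSEQ_Suc[OF lim_1_over_n] by auto
      have inD: "\<forall>\<^sub>F k in sequentially. g s + ?e k * n \<in> D"
        using n filterlim_iff[THEN iffD1, OF fl] unfolding inner_normal_def by blast
      have outD: "\<forall>\<^sub>F k in sequentially. g s - ?e k * n \<notin> D"
        using outer_normal_outside[OF D n] filterlim_iff[THEN iffD1, OF fl] by blast
      have "(\<lambda>k. w (g s + ?e k * n)) \<longlonglongrightarrow> y"
        by (rule filterlim_compose[OF lim[OF cos_pi4_bounds(3,4)] normal_sequence[OF nn]])
      moreover have "\<forall>\<^sub>F k in sequentially. w (g s + ?e k * n) = a k s"
        using inD outD by eventually_elim (simp add: sum wD_def)
      ultimately have "(\<lambda>k. a k s) \<longlonglongrightarrow> y" by (rule Lim_transform_eventually)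
      then have "H s = ereal y" by (simp add: H_def limI)
      moreover have "has_angular_limit D \<gamma> w (g s) (ereal y)"
        unfolding has_angular_limit_def using n lim by (intro exI[of _ n]) auto
      ultimately have "angular_limit D \<gamma> w (g s) = H s" using angular_limit_eq[OF D] by simp
      then show False using s by simp
    qed
  qed
qed

end

theorem theorem2:
  fixes \<gamma> :: "real \<Rightarrow> complex" and D E :: "complex set" and u v :: "complex \<Rightarrow> real"
  assumes "jordan_domain \<gamma> D"
    and "rectifiable \<gamma>"
    and "E \<subseteq> path_image \<gamma>" and "E \<in> sets (arc_length_measure \<gamma>)"
    and "harmonic_on u D"
    and "\<And>\<zeta>. \<zeta> \<in> E \<Longrightarrow> has_tangent \<gamma> \<zeta> \<Longrightarrow> \<exists>L. has_angular_limit D \<gamma> u \<zeta> L"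
    and "conjugate_harmonic_on u v D"
  shows "(AE \<zeta> in arc_length_measure \<gamma>. \<zeta> \<in> E \<longrightarrow>
            (\<exists>y :: real. has_angular_limit D \<gamma> v \<zeta> (ereal y)))
       \<and> (AE \<zeta> in arc_length_measure \<gamma>. \<zeta> \<in> E \<longrightarrow> (\<exists>L. has_angular_limit D \<gamma> u \<zeta> L))
       \<and> angular_limit D \<gamma> u \<in> borel_measurable (restrict_space (arc_length_measure \<gamma>) E)
       \<and> angular_limit D \<gamma> v \<in> borel_measurable (restrict_space (arc_length_measure \<gamma>) E)"
proof -
  have J: "jordan_curve \<gamma>" using assms(1) by (simp add: jordan_domain_def)
  interpret rectifiable_jordan \<gamma> by unfold_locales (use assms(2) J in auto)
  note D = assms(1)
  define f where "f = (\<lambda>z. Complex (u z) (v z))"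
  have fh: "f holomorphic_on D"
    using assms(7) unfolding conjugate_harmonic_on_def f_def by (intro analytic_imp_holomorphic) simp
  have mfh: "(\<lambda>z. - f z) holomorphic_on D" using fh by (intro holomorphic_intros)
  have uRe: "u = (\<lambda>z. Re (f z))" and vIm: "v = (\<lambda>z. Im (f z))" by (simp_all add: f_def)
  have fc: "continuous_on D f" using fh by (rule holomorphic_on_imp_continuous_on)
  let ?P = "\<lambda>s. g s \<in> E \<longrightarrow> (\<exists>n y. inner_normal D \<gamma> (g s) n \<and>
      (\<forall>\<alpha> r. 0 < \<alpha> \<longrightarrow> \<alpha> < pi / 2 \<longrightarrow> (f \<longlongrightarrow> y) (at (g s) within sector (g s) n \<alpha> r)))"
  have neg: "negligible {s \<in> {0..L}. \<not> ?P s}"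
  proof (rule negligible_subset[OF negligible_Un[OF negligible_Un[OF one_sided_bound_imp_limit_ae[OF D fh]
          one_sided_bound_imp_limit_ae[OF D mfh]] unit_speed_ae]], rule subsetI, rule ccontr)
    fix s assume "s \<in> {s \<in> {0..L}. \<not> ?P s}"
    then have sL: "s \<in> {0..L}" and sE: "g s \<in> E" and nP: "\<not> ?P s" by blast+
    assume ns: "s \<notin> {s \<in> {0..L}. (\<exists>n r K. inner_normal D \<gamma> (g s) n \<and> 0 < r \<and>
      (\<forall>z\<in>normal_cone (g s) n (1/20) r. z \<in> D \<and> - K \<le> Re (f z))) \<and> \<not> (\<exists>y. limit_in_sectors D \<gamma> f (g s) y)} \<union>
      {s \<in> {0..L}. (\<exists>n r K. inner_normal D \<gamma> (g s) n \<and> 0 < r \<and>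
      (\<forall>z\<in>normal_cone (g s) n (1/20) r. z \<in> D \<and> - K \<le> Re (- f z))) \<and> \<not> (\<exists>y. limit_in_sectors D \<gamma> (\<lambda>z. - f z) (g s) y)} \<union>
      {s \<in> {0..L}. \<not> (s \<in> {0<..<L} \<and> (\<exists>\<tau>. norm \<tau> = 1 \<and> (g has_vector_derivative \<tau>) (at s)))}"
    obtain \<tau> where \<tau>: "norm \<tau> = 1" "(g has_vector_derivative \<tau>) (at s)" and s0: "s \<in> {0<..<L}" using sL ns by blast
    have "has_tangent \<gamma> (g s)"
      unfolding has_tangent_def using tangent_direction_natural_param[OF s0 \<tau>(2,1)] by blast
    from assms(6)[OF sE this] obtain l n where n: "inner_normal D \<gamma> (g s) n"
      and l: "\<And>\<alpha> r. 0 < \<alpha> \<and> \<alpha> < pi / 2 \<and> 0 < r \<and> sector (g s) n \<alpha> r \<subseteq> D \<Longrightarrow>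
        ((\<lambda>z. ereal (u z)) \<longlongrightarrow> l) (at (g s) within sector (g s) n \<alpha> r)"
      unfolding has_angular_limit_def by blast
    have nn: "cmod n = 1" by (rule inner_normal_norm[OF D n])
    define \<alpha> where "\<alpha> = arccos (1/20)"
    have \<alpha>: "0 < \<alpha>" "\<alpha> < pi / 2" "cos \<alpha> = 1/20"
      using arccos_less_mono[of 1 "1/20"] arccos_less_mono[of "1/20" 0] by (auto simp: \<alpha>_def arccos_0 cos_arccos)
    have sec: "sector (g s) n \<alpha> r = normal_cone (g s) n (1/20) r" for r using sector_eq_cone[OF nn \<alpha>(1,2)] \<alpha>(3) by simp
    obtain r where r: "r > 0" "normal_cone (g s) n (1/20) r \<subseteq> D" using inner_normal_cone[OF D n, of "1/20"] by auto
    have ul: "((\<lambda>z. ereal (u z)) \<longlongrightarrow> l) (at (g s) within normal_cone (g s) n (1/20) r)"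
      using l[of \<alpha> r] \<alpha> r unfolding sec by blast
    have "\<exists>y. limit_in_sectors D \<gamma> f (g s) y"
    proof (cases "l = - \<infinity>")
      case False
      then obtain K :: real where K: "ereal K < l" by (metis ereal_dense2 less_ereal.simps(5) ereal_infty_less(2) linorder_not_le ereal_infty_less_eq(2) order_le_less)
      from order_tendstoD(1)[OF ul K] obtain d where d: "d > 0"
        "\<And>z. z \<in> normal_cone (g s) n (1/20) r \<Longrightarrow> z \<noteq> g s \<Longrightarrow> dist z (g s) < d \<Longrightarrow> ereal K < ereal (u z)"
        unfolding eventually_at by blast
      have "z \<in> D \<and> - (- K) \<le> Re (f z)" if z: "z \<in> normal_cone (g s) n (1/20) (min r d)" for z
      proof -
        have "z \<in> normal_cone (g s) n (1/20) r" "z \<noteq> g s" "dist z (g s) < d" using z by (auto simp: normal_cone_def dist_norm)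
        from d(2)[OF this] \<open>z \<in> normal_cone (g s) n (1/20) r\<close> show ?thesis using r(2) by (auto simp: uRe)
      qed
      moreover have "0 < min r d" using r d by simp
      ultimately have "\<exists>n r K. inner_normal D \<gamma> (g s) n \<and> 0 < r \<and> (\<forall>z\<in>normal_cone (g s) n (1/20) r. z \<in> D \<and> - K \<le> Re (f z))"
        using n by blast
      then show ?thesis using ns sL by blast
    next
      case True
      have "l < ereal 0" using True by simp
      from order_tendstoD(2)[OF ul this] obtain d where d: "d > 0"
        "\<And>z. z \<in> normal_cone (g s) n (1/20) r \<Longrightarrow> z \<noteq> g s \<Longrightarrow> dist z (g s) < d \<Longrightarrow> ereal (u z) < ereal 0"
        unfolding eventually_at by blast
      have "z \<in> D \<and> - 0 \<le> Re (- f z)" if z: "z \<in> normal_cone (g s) n (1/20) (min r d)" for z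
      proof -
        have "z \<in> normal_cone (g s) n (1/20) r" "z \<noteq> g s" "dist z (g s) < d" using z by (auto simp: normal_cone_def dist_norm)
        from d(2)[OF this] \<open>z \<in> normal_cone (g s) n (1/20) r\<close> show ?thesis using r(2) by (auto simp: uRe)
      qed
      moreover have "0 < min r d" using r d by simp
      ultimately have "\<exists>n r K. inner_normal D \<gamma> (g s) n \<and> 0 < r \<and> (\<forall>z\<in>normal_cone (g s) n (1/20) r. z \<in> D \<and> - K \<le> Re (- f z))"
        using n by blast
      then obtain y where "limit_in_sectors D \<gamma> (\<lambda>z. - f z) (g s) y" using ns sL by blast
      then have "limit_in_sectors D \<gamma> f (g s) (- y)"
        unfolding limit_in_sectors_def using tendsto_minus[of "\<lambda>z. - f z" y] by simp
      then show ?thesis by blast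
    qed
    then show False using nP n unfolding limit_in_sectors_def by blast
  qed
  have neg_w: "negligible {s \<in> {0..L}. \<not> (g s \<in> E \<longrightarrow> (\<exists>n y. inner_normal D \<gamma> (g s) n \<and>
      (\<forall>\<alpha> r. 0 < \<alpha> \<longrightarrow> \<alpha> < pi / 2 \<longrightarrow> ((\<lambda>z. c (f z)) \<longlongrightarrow> y) (at (g s) within sector (g s) n \<alpha> r))))}"
    if c: "\<And>y F. (f \<longlongrightarrow> y) F \<Longrightarrow> ((\<lambda>z. c (f z)) \<longlongrightarrow> c y) F" for c :: "complex \<Rightarrow> real"
    by (rule negligible_subset[OF neg]) (use c in blast)
  have neg_u: "negligible {s \<in> {0..L}. \<not> (g s \<in> E \<longrightarrow> (\<exists>n y. inner_normal D \<gamma> (g s) n \<and>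
      (\<forall>\<alpha> r. 0 < \<alpha> \<longrightarrow> \<alpha> < pi / 2 \<longrightarrow> (u \<longlongrightarrow> y) (at (g s) within sector (g s) n \<alpha> r))))}"
    unfolding uRe by (rule neg_w) (rule tendsto_Re)
  have neg_v: "negligible {s \<in> {0..L}. \<not> (g s \<in> E \<longrightarrow> (\<exists>n y. inner_normal D \<gamma> (g s) n \<and>
      (\<forall>\<alpha> r. 0 < \<alpha> \<longrightarrow> \<alpha> < pi / 2 \<longrightarrow> (v \<longlongrightarrow> y) (at (g s) within sector (g s) n \<alpha> r))))}"
    unfolding vIm by (rule neg_w) (rule tendsto_Im)
  have ae: "AE \<zeta> in M. \<zeta> \<in> E \<longrightarrow> (\<exists>y :: real. has_angular_limit D \<gamma> w \<zeta> (ereal y))"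
    if w: "negligible {s \<in> {0..L}. \<not> (g s \<in> E \<longrightarrow> (\<exists>n y. inner_normal D \<gamma> (g s) n \<and>
      (\<forall>\<alpha> r. 0 < \<alpha> \<longrightarrow> \<alpha> < pi / 2 \<longrightarrow> (w \<longlongrightarrow> y) (at (g s) within sector (g s) n \<alpha> r))))}" for w
  proof (rule AE_arc_length_measure, rule negligible_subset[OF w], intro subsetI CollectI conjI)
    fix s assume s: "s \<in> {s \<in> {0..L}. \<not> (g s \<in> E \<longrightarrow> (\<exists>y :: real. has_angular_limit D \<gamma> w (g s) (ereal y)))}"
    then show "s \<in> {0..L}" by blast
    show "\<not> (g s \<in> E \<longrightarrow> (\<exists>n y. inner_normal D \<gamma> (g s) n \<and>
      (\<forall>\<alpha> r. 0 < \<alpha> \<longrightarrow> \<alpha> < pi / 2 \<longrightarrow> (w \<longlongrightarrow> y) (at (g s) within sector (g s) n \<alpha> r))))"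
    proof
      assume "g s \<in> E \<longrightarrow> (\<exists>n y. inner_normal D \<gamma> (g s) n \<and>
        (\<forall>\<alpha> r. 0 < \<alpha> \<longrightarrow> \<alpha> < pi / 2 \<longrightarrow> (w \<longlongrightarrow> y) (at (g s) within sector (g s) n \<alpha> r)))"
      then obtain n y where "inner_normal D \<gamma> (g s) n"
        "\<And>\<alpha> r. 0 < \<alpha> \<Longrightarrow> \<alpha> < pi / 2 \<Longrightarrow> (w \<longlongrightarrow> y) (at (g s) within sector (g s) n \<alpha> r)" using s by blast
      then have "has_angular_limit D \<gamma> w (g s) (ereal y)"
        unfolding has_angular_limit_def by (intro exI[of _ n]) auto
      then show False using s by blast
    qed
  qed
  have "AE \<zeta> in M. \<zeta> \<in> E \<longrightarrow> (\<exists>L. has_angular_limit D \<gamma> u \<zeta> L)"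
    using ae[OF neg_u] by eventually_elim blast
  moreover have "continuous_on D u" "continuous_on D v" unfolding uRe vIm by (intro continuous_intros fc)+
  ultimately show ?thesis
    using ae[OF neg_v] angular_limit_measurable[OF D assms(4) _ neg_u] angular_limit_measurable[OF D assms(4) _ neg_v]
    by blast
qed

end
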